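(* Let $d\ge 2$ and $1<r<d$, and suppose that there exist $\beta_1,\beta_2,\alpha>0$ such that for all $t\ge 0$, $$\beta_1 e^{-\alpha t^r}\le \mathbb{P}(\tau_e>t)\le \beta_2 e^{-\alpha t^r}.$$ Then for all $\xi>0$ and $x\in\mathbb{R}^d\setminus\{0\}$, $$\lim_{n\to\infty}\frac{1}{n^r}\log \mathbb{P}\big(\mathrm{T}(0,nx)\ge(\mu(x)+\xi)n\big)=-\alpha\,2^{1-r}\,\lambda_{d,r}\,\xi^r.$$
   Context: First-passage percolation on $\mathbb{Z}^d$. Let $E(\mathbb{Z}^d)$ be the set of undirected nearest-neighbor edges $\langle v,w\rangle=\{v,w\}$, $|v-w|_1=1$. To each edge $e\in E(\mathbb{Z}^d)$ is attached a non-negative random variable $\tau_e$; the family $(\tau_e)_{e\in E(\mathbb{Z}^d)}$ is independent and identically distributed. A path is a finite sequence of vertices whose successive elements are nearest neighbors; it is also viewed as its set of edges. The passage time of a path $\gamma$ is $\mathrm{T}(\gamma)=\sum_{e\in\gamma}\tau_e$. For $x\in\mathbb{R}^d$ let $\lfloor x\rfloor=(\lfloor x_1\rfloor,\dots,\lfloor x_d\rfloor)$. For $x,y\in\mathbb{R}^d$, the first passage time is $\mathrm{T}(x,y)=\inf_\gamma \mathrm{T}(\gamma)$, the infimum being over all finite paths from $\lfloor x\rfloor$ to $\lfloor y\rfloor$. When $\mathbb{E}\tau_e<\infty$, the time constant $\mu(x)\in[0,\infty)$ is the non-random limit $\mu(x)=\lim_{t\to\infty}t^{-1}\mathrm{T}(0,tx)=\lim_{t\to\infty}t^{-1}\mathbb{E}[\mathrm{T}(0,tx)]$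 a.s. Discrete $r$-capacity: let $D_M(x)=\{y\in\mathbb{Z}^d:|y-x|_\infty\le M\}$, $\partial D_M(x)=\{y\in\mathbb{Z}^d:|y-x|_\infty=M\}$, and $E_M=\{\langle x,y\rangle: x,y\in D_M(0),\ |x-y|_1=1\}$. For $M\in\mathbb{N}$, $M\ge1$, $$\lambda_{d,r}(M)=\inf_{f:D_M(0)\to\mathbb{R}}\Big\{\sum_{\langle x,y\rangle\in E_M}|f(x)-f(y)|^r\ :\ f(x)\ge 1\ \forall x\in\partial D_M(0),\ f(0)=0\Big\}.$$ This is non-increasing in $M$, and $\lambda_{d,r}=\lim_{M\to\infty}\lambda_{d,r}(M)$. *)

theory Defs
  imports "HOL-Probability.Probability"
begin

text \<open>The dimension \<open>d\<close> is \<open>CARD('d)\<close>: vertices of the lattice are of type \<open>int ^ 'd\<close>,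
  points of Euclidean space of type \<open>real ^ 'd\<close>.\<close>

definition l1_norm :: "int ^ 'd::finite \<Rightarrow> int" where
  "l1_norm v = (\<Sum>i\<in>UNIV. \<bar>v $ i\<bar>)"

definition linf_norm :: "int ^ 'd::finite \<Rightarrow> int" where
  "linf_norm v = Max (range (\<lambda>i. \<bar>v $ i\<bar>))"

definition nearest_neighbors :: "int ^ 'd::finite \<Rightarrow> int ^ 'd \<Rightarrow> bool" where
  "nearest_neighbors v w \<longleftrightarrow> l1_norm (v - w) = 1"

definition lattice_edges :: "(int ^ 'd::finite) set set" where
  "lattice_edges = {{v, w} | v w. nearest_neighbors v w}"

definition lattice_paths :: "int ^ 'd::finite \<Rightarrow> int ^ 'd \<Rightarrow> (int ^ 'd) list set" where
  "lattice_paths v w =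
    {p. p \<noteq> [] \<and> hd p = v \<and> last p = w \<and> successively nearest_neighbors p}"

definition path_edges :: "'a list \<Rightarrow> 'a set set" where
  "path_edges p = {{p ! i, p ! Suc i} | i. Suc i < length p}"

text \<open>A path is identified with its set of edges, so an edge that is traversed several times
  contributes only once.\<close>

definition path_time :: "((int ^ 'd::finite) set \<Rightarrow> real) \<Rightarrow> (int ^ 'd) list \<Rightarrow> real" where
  "path_time \<tau> p = (\<Sum>e\<in>path_edges p. \<tau> e)"

definition vec_floor :: "real ^ 'd::finite \<Rightarrow> int ^ 'd" where
  "vec_floor x = (\<chi> i. \<lfloor>x $ i\<rfloor>)"

definition first_passage_time ::
  "((int ^ 'd::finite) set \<Rightarrow> real) \<Rightarrow> real ^ 'd \<Rightarrow> real ^ 'd \<Rightarrow> real" where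
  "first_passage_time \<tau> x y =
    (INF p\<in>lattice_paths (vec_floor x) (vec_floor y). path_time \<tau> p)"

text \<open>The time constant is both the almost sure limit of \<open>T(0, t x) / t\<close> and the limit of its
  expectation; the latter is taken as the definition, with \<open>t\<close> a real parameter.\<close>

definition time_constant ::
  "'w measure \<Rightarrow> ((int ^ 'd::finite) set \<Rightarrow> 'w \<Rightarrow> real) \<Rightarrow> real ^ 'd \<Rightarrow> real" where
  "time_constant M \<tau> x =
    Lim at_top (\<lambda>t::real. (\<integral>\<omega>. first_passage_time (\<lambda>e. \<tau> e \<omega>) 0 (t *\<^sub>R x) \<partial>M) / t)"

definition lattice_box :: "nat \<Rightarrow> int ^ 'd::finite \<Rightarrow> (int ^ 'd) set" where
  "lattice_box m x = {y. linf_norm (y - x) \<le> int m}"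

definition lattice_box_boundary :: "nat \<Rightarrow> int ^ 'd::finite \<Rightarrow> (int ^ 'd) set" where
  "lattice_box_boundary m x = {y. linf_norm (y - x) = int m}"

definition box_edges :: "nat \<Rightarrow> (int ^ 'd::finite) set set" where
  "box_edges m =
    {{x, y} | x y. x \<in> lattice_box m 0 \<and> y \<in> lattice_box m 0 \<and> nearest_neighbors x y}"

text \<open>The increment \<open>\<bar>f x - f y\<bar>\<close> along an undirected edge \<open>{x, y}\<close>, written so that it depends
  only on the edge as a set; see the lemma below.\<close>

definition edge_increment :: "('a \<Rightarrow> real) \<Rightarrow> 'a set \<Rightarrow> real" where
  "edge_increment f e = Max (f ` e) - Min (f ` e)"

lemma edge_increment_doubleton: "edge_increment f {x, y} = \<bar>f x - f y\<bar>"
  by (simp add: edge_increment_def max_def min_def)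

text \<open>The functions are total, but only their values on the box matter. For \<open>m = 0\<close> there is no
  admissible function and the value is meaningless; it does not affect the limit.\<close>

definition box_capacity :: "'d::finite itself \<Rightarrow> real \<Rightarrow> nat \<Rightarrow> real" where
  "box_capacity _ r m =
    Inf {(\<Sum>e\<in>box_edges m. edge_increment f e powr r) | f :: int ^ 'd \<Rightarrow> real.
      (\<forall>x\<in>lattice_box_boundary m 0. f x \<ge> 1) \<and> f 0 = 0}"

definition discrete_capacity :: "'d::finite itself \<Rightarrow> real \<Rightarrow> real" where
  "discrete_capacity d r = lim (\<lambda>m. box_capacity d r m)"

end

theory Submission
  imports Defs "HOL-Real_Asymp.Real_Asymp"
begin

text \<open>Lower bound: prescribe on boxes around the two endpoints edge weights proportional to the
  increments of a near-optimal function for the capacity. Every path then loses \<open>\<xi> n / 2\<close> in each of the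
  boxes, and independently of that the rest of the path takes time about \<open>\<mu> n\<close> with a probability bounded
  below.

  Upper bound: the passage times from an endpoint form a function on the box around it, whose energy
  is at most the sum of the \<open>r\<close>-th powers of the weights. So delays \<open>t\<close> and \<open>t'\<close> in the two boxes force
  the weights to satisfy \<open>\<Sum> \<tau>\<^sup>r \<ge> \<lambda> (t\<^sup>r + t'\<^sup>r) \<ge> 2 \<lambda> ((t + t') / 2)\<^sup>r\<close>, and an exponential moment of \<open>\<tau>\<^sup>r\<close>
  gives the rate. It remains to see that a delay elsewhere is much less likely. There, the passage
  time is bounded by its average over random endpoints: first over dyadic cubes around a point of the
  boundary of the box, growing to size \<open>\<delta> n\<close>, and then over the translates of the segment from \<open>0\<close> to
  \<open>n x\<close>. Each average is a sum of independent weights with small coefficients, and because of \<open>r < d\<close>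
  the bounds on its exponential moments beat \<open>exp (- C n\<^sup>r)\<close> for every \<open>C\<close>, except at the finitely many smallest
  scales. At these a delay requires a large edge close to the boundary of the box; choosing the box
  among \<open>L\<close> concentric ones, all of them fail only if there are \<open>L\<close> large edges.\<close>

section \<open>Passage times between lattice points\<close>

text \<open>In the upper bound the points where a good connection leaves the two boxes depend on the
  weights, so the boxes cannot be decoupled from the bulk by independence. A union bound replaces
  it: every failure apart from the capacity estimate is made as unlikely as the target rate,
  uniformly over all candidate points, and there are only polynomially many events.

  The role of \<open>r < d\<close> is seen in a cube of side \<open>2 ^ i\<close>. A delay
  \<open>a\<close> of the average is a total excess \<open>2 ^ (i (d - 1)) a\<close> on about
  \<open>2 ^ (i d)\<close> edges, hence weights of order \<open>a / 2 ^ i\<close> and a cost of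
  order \<open>2 ^ (i (d - r)) a powr r\<close>. For \<open>a\<close> of order n this grows with i,
  and half of the growth can be traded for delays that are summable over i. At small i the constant
  in front is too small for a prescribed rate, so these scales cannot be treated by averaging.

  About the time constant only the convergence of expectations is used. A second moment turns it
  into a probability bounded below; many independent copies of one long step, truncated to finitely
  many paths, turn it into concentration from above.\<close>

definition passage_time ::
  "((int ^ 'd::finite) set \<Rightarrow> real) \<Rightarrow> int ^ 'd \<Rightarrow> int ^ 'd \<Rightarrow> real" where
  "passage_time \<tau> u v = (INF p\<in>lattice_paths u v. path_time \<tau> p)"

lemma first_passage_time_eq:
  "first_passage_time \<tau> x y = passage_time \<tau> (vec_floor x) (vec_floor y)"
  by (simp add: first_passage_time_def passage_time_def)

lemma path_edges_Nil [simp]: "path_edges [] = {}"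
  by (simp add: path_edges_def)

lemma path_edges_single [simp]: "path_edges [x] = {}"
  by (simp add: path_edges_def)

lemma path_edges_Cons2 [simp]: "path_edges (x # y # p) = insert {x, y} (path_edges (y # p))"
proof -
  have "{{(x # y # p) ! i, (x # y # p) ! Suc i} | i. Suc i < length (x # y # p)} =
    insert {x, y} {{(y # p) ! i, (y # p) ! Suc i} | i. Suc i < length (y # p)}"
    (is "?L = ?R")
  proof (intro set_eqI iffI)
    fix e assume "e \<in> ?L"
    then obtain i where i: "e = {(x # y # p) ! i, (x # y # p) ! Suc i}"
      "Suc i < length (x # y # p)" by blast
    show "e \<in> ?R" using i by (cases i) auto
  next
    fix e assume "e \<in> ?R"
    then consider "e = {x, y}" | i where "e = {(y # p) ! i, (y # p) ! Suc i}"
      "Suc i < length (y # p)" by blast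
    then show "e \<in> ?L"
    proof cases
      case 1
      then show ?thesis by (intro CollectI exI[of _ 0]) auto
    next
      case 2
      then show ?thesis by (intro CollectI exI[of _ "Suc i"]) auto
    qed
  qed
  then show ?thesis by (simp only: path_edges_def)
qed

lemma finite_path_edges [simp]: "finite (path_edges p)"
  by (induction p rule: induct_list012) auto

lemma path_edges_append: "path_edges (p @ v # q) = path_edges (p @ [v]) \<union> path_edges (v # q)"
proof (induction p rule: induct_list012)
  case (2 x)
  then show ?case by (cases q) auto
qed auto

lemma path_edges_rev: "path_edges (rev p) = path_edges p"
proof (induction p rule: induct_list012)
  case (3 x y zs)
  have "path_edges (rev (x # y # zs)) = path_edges (rev (y # zs)) \<union> path_edges [y, x]"
    using path_edges_append[of "rev zs" y "[x]"] by simp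
  then show ?case using 3 by (auto simp: insert_commute)
qed auto

lemma nearest_neighbors_sym: "nearest_neighbors v w \<longleftrightarrow> nearest_neighbors w v"
  by (simp add: nearest_neighbors_def l1_norm_def abs_minus_commute)

lemma nearest_neighbors_translate [simp]:
  "nearest_neighbors (a + v) (a + w) \<longleftrightarrow> nearest_neighbors v w"
  by (simp add: nearest_neighbors_def)

lemma edge_in_lattice_edges [intro]: "nearest_neighbors v w \<Longrightarrow> {v, w} \<in> lattice_edges"
  by (auto simp: lattice_edges_def)

lemma path_edges_subset_lattice_edges:
  "successively nearest_neighbors p \<Longrightarrow> path_edges p \<subseteq> lattice_edges"
  by (induction p rule: induct_list012) auto

lemma path_edges_lattice_paths: "p \<in> lattice_paths u v \<Longrightarrow> path_edges p \<subseteq> lattice_edges"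
  by (simp add: lattice_paths_def path_edges_subset_lattice_edges)

lemma path_time_cong:
  "p \<in> lattice_paths u v \<Longrightarrow> (\<And>e. e \<in> lattice_edges \<Longrightarrow> \<tau> e = \<tau>' e) \<Longrightarrow>
    path_time \<tau> p = path_time \<tau>' p"
  unfolding path_time_def by (rule sum.cong) (auto dest: path_edges_lattice_paths)

lemma passage_time_cong:
  "(\<And>e. e \<in> lattice_edges \<Longrightarrow> \<tau> e = \<tau>' e) \<Longrightarrow> passage_time \<tau> u v = passage_time \<tau>' u v"
  unfolding passage_time_def by (rule INF_cong) (auto intro: path_time_cong)

lemma lattice_paths_rev: "p \<in> lattice_paths u v \<Longrightarrow> rev p \<in> lattice_paths v u"
  by (auto simp: lattice_paths_def hd_rev last_rev nearest_neighbors_sym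
      elim: successively_mono)

lemma passage_time_commute: "passage_time \<tau> u v = passage_time \<tau> v u"
proof -
  have *: "path_time \<tau> ` lattice_paths u v \<subseteq> path_time \<tau> ` lattice_paths v u" for u v
  proof
    fix t assume "t \<in> path_time \<tau> ` lattice_paths u v"
    then obtain p where p: "p \<in> lattice_paths u v" "t = path_time \<tau> p" by blast
    then have "t = path_time \<tau> (rev p)" by (simp add: path_time_def path_edges_rev)
    then show "t \<in> path_time \<tau> ` lattice_paths v u" using lattice_paths_rev[OF p(1)] by blast
  qed
  have "path_time \<tau> ` lattice_paths u v = path_time \<tau> ` lattice_paths v u"
    using * by blast
  then show ?thesis by (simp add: passage_time_def)
qed

lemma lattice_paths_append:
  assumes "p \<in> lattice_paths u v" "q \<in> lattice_paths v w"
  shows "p @ tl q \<in> lattice_paths u w" "path_edges (p @ tl q) = path_edges p \<union> path_edges q"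
proof -
  obtain q' where q: "q = v # q'" using assms(2) by (cases q) (auto simp: lattice_paths_def)
  obtain p' where p: "p = p' @ [v]" using assms(1)
    by (cases p rule: rev_cases) (auto simp: lattice_paths_def)
  show "p @ tl q \<in> lattice_paths u w"
    using assms unfolding p q
    by (auto simp: lattice_paths_def successively_append_iff successively_Cons hd_append)
  show "path_edges (p @ tl q) = path_edges p \<union> path_edges q"
    unfolding p q using path_edges_append[of p' v q'] by simp
qed

section \<open>Lines parallel to the axes and connectedness of the lattice\<close>

definition set_coord :: "int ^ 'd::finite \<Rightarrow> 'd \<Rightarrow> int \<Rightarrow> int ^ 'd" where
  "set_coord c b t = (\<chi> j. if j = b then t else c $ j)"

lemma set_coord_nth [simp]: "set_coord c b t $ j = (if j = b then t else c $ j)"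
  by (simp add: set_coord_def)

lemma set_coord_self [simp]: "set_coord c b (c $ b) = c"
  by (simp add: vec_eq_iff)

lemma set_coord_set_coord [simp]: "set_coord (set_coord c b s) b t = set_coord c b t"
  by (simp add: vec_eq_iff)

definition line_edge :: "int ^ 'd::finite \<Rightarrow> 'd \<Rightarrow> int \<Rightarrow> (int ^ 'd) set" where
  "line_edge c b t = {set_coord c b t, set_coord c b (t + 1)}"

lemma nearest_neighbors_set_coord: "nearest_neighbors (set_coord c b t) (set_coord c b (t + 1))"
proof -
  have "l1_norm (set_coord c b t - set_coord c b (t + 1)) = (\<Sum>i\<in>UNIV. if i = b then 1 else 0)"
    unfolding l1_norm_def by (rule sum.cong) auto
  then show ?thesis by (simp add: nearest_neighbors_def)
qed

lemma line_edge_in_lattice_edges [simp]: "line_edge c b t \<in> lattice_edges"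
  unfolding line_edge_def by (intro edge_in_lattice_edges nearest_neighbors_set_coord)

lemma line_path_exists:
  "\<exists>p. p \<in> lattice_paths (set_coord c b s) (set_coord c b (s + int k))"
proof (induction k)
  case 0
  have "[set_coord c b s] \<in> lattice_paths (set_coord c b s) (set_coord c b s)"
    by (simp add: lattice_paths_def)
  then show ?case by auto
next
  case (Suc k)
  then obtain p where p: "p \<in> lattice_paths (set_coord c b s) (set_coord c b (s + int k))" by blast
  have "[set_coord c b (s + int k), set_coord c b (s + int k + 1)] \<in>
    lattice_paths (set_coord c b (s + int k)) (set_coord c b (s + int k + 1))"
    using nearest_neighbors_set_coord by (simp add: lattice_paths_def)
  from lattice_paths_append(1)[OF p this] show ?case
    by (auto simp: algebra_simps)
qed

text \<open>The coordinates are corrected one at a time along lines parallel to the axes. An infimum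
  over an empty set of reals would be an arbitrary value, so the lower bounds on
  \<open>passage_time\<close> rest on this.\<close>

lemma lattice_paths_nonempty [simp]:
  fixes u v :: "int ^ 'd::finite"
  shows "lattice_paths u v \<noteq> {}"
proof -
  have line: "lattice_paths w (set_coord w b t) \<noteq> {}" for w :: "int ^ 'd" and b t
  proof (cases "w $ b \<le> t")
    case True
    then show ?thesis using line_path_exists[of w b "w $ b" "nat (t - w $ b)"] by auto
  next
    case False
    then obtain p where "p \<in> lattice_paths (set_coord w b t) w"
      using line_path_exists[of w b t "nat (w $ b - t)"] by auto
    then show ?thesis using lattice_paths_rev by blast
  qed
  have "\<forall>w. (\<forall>j. j \<notin> B \<longrightarrow> w $ j = u $ j) \<longrightarrow> lattice_paths u w \<noteq> {}"
    if "finite B" for B :: "'d set"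
    using that
  proof (induction B)
    case empty
    have "[u] \<in> lattice_paths u u" by (simp add: lattice_paths_def)
    moreover have "w = u" if "\<forall>j. w $ j = u $ j" for w using that by (simp add: vec_eq_iff)
    ultimately show ?case by auto
  next
    case (insert b B)
    show ?case
    proof (intro allI impI)
      fix w assume w: "\<forall>j. j \<notin> insert b B \<longrightarrow> w $ j = u $ j"
      define w' where "w' = set_coord w b (u $ b)"
      have "lattice_paths u w' \<noteq> {}" using insert.IH w by (auto simp: w'_def)
      then obtain p where p: "p \<in> lattice_paths u w'" by blast
      have "set_coord w' b (w $ b) = w" by (simp add: w'_def)
      then obtain q where q: "q \<in> lattice_paths w' w" using line[of w' b "w $ b"] by auto
      show "lattice_paths u w \<noteq> {}" using lattice_paths_append(1)[OF p q] by blast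
    qed
  qed
  from this[of UNIV] show ?thesis by simp
qed

section \<open>Nonnegative weights: the passage time as a pseudometric\<close>

definition nonneg_weights :: "((int ^ 'd::finite) set \<Rightarrow> real) \<Rightarrow> bool" where
  "nonneg_weights \<tau> \<longleftrightarrow> (\<forall>e\<in>lattice_edges. 0 \<le> \<tau> e)"

lemma nonneg_weightsD: "nonneg_weights \<tau> \<Longrightarrow> e \<in> lattice_edges \<Longrightarrow> 0 \<le> \<tau> e"
  by (simp add: nonneg_weights_def)

lemma path_time_nonneg:
  "nonneg_weights \<tau> \<Longrightarrow> p \<in> lattice_paths u v \<Longrightarrow> 0 \<le> path_time \<tau> p"
  unfolding path_time_def
  by (intro sum_nonneg) (auto dest: path_edges_lattice_paths nonneg_weightsD)

lemma bdd_below_path_time: "nonneg_weights \<tau> \<Longrightarrow> bdd_below (path_time \<tau> ` lattice_paths u v)"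
  using path_time_nonneg by (intro bdd_belowI[of _ 0]) blast

lemma passage_time_le_path_time:
  "nonneg_weights \<tau> \<Longrightarrow> p \<in> lattice_paths u v \<Longrightarrow> passage_time \<tau> u v \<le> path_time \<tau> p"
  unfolding passage_time_def by (intro cINF_lower bdd_below_path_time)

lemma passage_time_greatest:
  "(\<And>p. p \<in> lattice_paths u v \<Longrightarrow> t \<le> path_time \<tau> p) \<Longrightarrow> t \<le> passage_time \<tau> u v"
  unfolding passage_time_def by (intro cINF_greatest) auto

lemma passage_time_nonneg: "nonneg_weights \<tau> \<Longrightarrow> 0 \<le> passage_time \<tau> u v"
  by (intro passage_time_greatest path_time_nonneg)

lemma passage_time_self [simp]: "nonneg_weights \<tau> \<Longrightarrow> passage_time \<tau> u u = 0"
proof (rule antisym)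
  assume "nonneg_weights \<tau>"
  then have "passage_time \<tau> u u \<le> path_time \<tau> [u]"
    by (intro passage_time_le_path_time) (simp_all add: lattice_paths_def)
  then show "passage_time \<tau> u u \<le> 0" by (simp add: path_time_def)
qed (rule passage_time_nonneg)

lemma passage_time_edge:
  assumes "nonneg_weights \<tau>" "nearest_neighbors u v"
  shows "passage_time \<tau> u v \<le> \<tau> {u, v}"
proof -
  have "passage_time \<tau> u v \<le> path_time \<tau> [u, v]"
    using assms by (intro passage_time_le_path_time) (simp_all add: lattice_paths_def)
  then show ?thesis by (simp add: path_time_def)
qed

lemma passage_time_triangle:
  assumes "nonneg_weights \<tau>"
  shows "passage_time \<tau> u w \<le> passage_time \<tau> u v + passage_time \<tau> v w"
proof -
  have *: "passage_time \<tau> u w \<le> path_time \<tau> p + path_time \<tau> q"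
    if p: "p \<in> lattice_paths u v" and q: "q \<in> lattice_paths v w" for p q
  proof -
    have "passage_time \<tau> u w \<le> path_time \<tau> (p @ tl q)"
      by (intro passage_time_le_path_time assms lattice_paths_append(1)[OF p q])
    also have "\<dots> \<le> path_time \<tau> p + path_time \<tau> q"
    proof -
      have "path_time \<tau> (p @ tl q) = sum \<tau> (path_edges p \<union> path_edges q)"
        unfolding path_time_def lattice_paths_append(2)[OF p q] ..
      \<comment> \<open>An edge shared by p and q counts only once in the concatenation; for
        nonnegative weights this can only help.\<close>
      also have "\<dots> = sum \<tau> (path_edges p) + sum \<tau> (path_edges q - path_edges p)"
        by (subst sum.union_disjoint[symmetric]) auto
      also have "sum \<tau> (path_edges q - path_edges p) \<le> sum \<tau> (path_edges q)"
        using path_edges_lattice_paths[OF q] assms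
        by (intro sum_mono2) (auto dest: nonneg_weightsD)
      finally show ?thesis by (simp add: path_time_def)
    qed
    finally show ?thesis .
  qed
  have "passage_time \<tau> u w - path_time \<tau> p \<le> passage_time \<tau> v w"
    if p: "p \<in> lattice_paths u v" for p
    using *[OF p] by (intro passage_time_greatest) (simp add: algebra_simps)
  then have "passage_time \<tau> u w - passage_time \<tau> v w \<le> passage_time \<tau> u v"
    by (intro passage_time_greatest) (simp add: algebra_simps)
  then show ?thesis by simp
qed

text \<open>This Lipschitz property is what makes passage times usable as test functions for the
  capacity.\<close>

lemma passage_time_edge_diff:
  assumes "nonneg_weights \<tau>" "nearest_neighbors u v"
  shows "\<bar>passage_time \<tau> w u - passage_time \<tau> w v\<bar> \<le> \<tau> {u, v}"
proof -
  have "passage_time \<tau> w u \<le> passage_time \<tau> w v + passage_time \<tau> v u"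
    "passage_time \<tau> w v \<le> passage_time \<tau> w u + passage_time \<tau> u v"
    by (intro passage_time_triangle assms)+
  moreover have "passage_time \<tau> v u = passage_time \<tau> u v" by (rule passage_time_commute)
  ultimately show ?thesis using passage_time_edge[OF assms] by linarith
qed

text \<open>The weight of the whole segment pays for any move inside it. A bound that does not
  depend on s and t can be averaged over both of them.\<close>

lemma passage_time_line:
  fixes c :: "int ^ 'd::finite"
  assumes \<tau>: "nonneg_weights \<tau>" and "s \<in> {lo..hi}" "t \<in> {lo..hi}"
  shows "passage_time \<tau> (set_coord c b s) (set_coord c b t) \<le> (\<Sum>j\<in>{lo..<hi}. \<tau> (line_edge c b j))"
proof -
  have up: "passage_time \<tau> (set_coord c b s) (set_coord c b (s + int k))
    \<le> (\<Sum>j\<in>{s..<s + int k}. \<tau> (line_edge c b j))" for s k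
  proof (induction k)
    case (Suc k)
    have "passage_time \<tau> (set_coord c b s) (set_coord c b (s + int k + 1)) \<le>
      passage_time \<tau> (set_coord c b s) (set_coord c b (s + int k)) +
      passage_time \<tau> (set_coord c b (s + int k)) (set_coord c b (s + int k + 1))"
      by (rule passage_time_triangle[OF \<tau>])
    also have "\<dots> \<le> (\<Sum>j\<in>{s..<s + int k}. \<tau> (line_edge c b j)) + \<tau> (line_edge c b (s + int k))"
      unfolding line_edge_def[of c b "s + int k"]
      by (intro add_mono Suc passage_time_edge \<tau> nearest_neighbors_set_coord)
    also have "\<dots> = (\<Sum>j\<in>insert (s + int k) {s..<s + int k}. \<tau> (line_edge c b j))" by simp
    also have "insert (s + int k) {s..<s + int k} = {s..<s + int (Suc k)}" by auto
    finally show ?case by (simp add: algebra_simps)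
  qed (simp add: \<tau>)
  have le: "passage_time \<tau> (set_coord c b s) (set_coord c b t) \<le> (\<Sum>j\<in>{lo..<hi}. \<tau> (line_edge c b j))"
    if "s \<le> t" "lo \<le> s" "t \<le> hi" for s t
  proof -
    have "passage_time \<tau> (set_coord c b s) (set_coord c b t) \<le> (\<Sum>j\<in>{s..<t}. \<tau> (line_edge c b j))"
      using up[of s "nat (t - s)"] that by simp
    also have "\<dots> \<le> (\<Sum>j\<in>{lo..<hi}. \<tau> (line_edge c b j))"
      using that by (intro sum_mono2) (auto intro: nonneg_weightsD[OF \<tau>])
    finally show ?thesis .
  qed
  show ?thesis
  proof (cases "s \<le> t")
    case False
    then show ?thesis using le[of t s] assms by (subst passage_time_commute) auto
  qed (use le assms in auto)
qed

text \<open>A path meets each edge of B at most once in its edge set, so the edges of B contribute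
  at most their total weight, whatever \<tau>' assigns to them.\<close>

lemma passage_time_mono_add:
  assumes "nonneg_weights \<tau>" "\<And>e. e \<in> lattice_edges \<Longrightarrow> e \<notin> B \<Longrightarrow> \<tau> e \<le> \<tau>' e"
    "nonneg_weights \<tau>'" "finite B" "B \<subseteq> lattice_edges"
  shows "passage_time \<tau> u v \<le> passage_time \<tau>' u v + sum \<tau> B"
proof -
  have "passage_time \<tau> u v - sum \<tau> B \<le> path_time \<tau>' p" if p: "p \<in> lattice_paths u v" for p
  proof -
    have sub: "path_edges p \<subseteq> lattice_edges" by (rule path_edges_lattice_paths[OF p])
    have "passage_time \<tau> u v \<le> path_time \<tau> p" by (intro passage_time_le_path_time assms p)
    also have "\<dots> = sum \<tau> (path_edges p - B) + sum \<tau> (path_edges p \<inter> B)"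
      unfolding path_time_def by (subst sum.union_disjoint[symmetric]) (auto intro: sum.cong)
    also have "\<dots> \<le> sum \<tau>' (path_edges p - B) + sum \<tau> B"
      using assms sub
      by (intro add_mono sum_mono sum_mono2) (auto dest: nonneg_weightsD)
    also have "sum \<tau>' (path_edges p - B) \<le> path_time \<tau>' p"
      unfolding path_time_def using assms sub
      by (intro sum_mono2) (auto dest: nonneg_weightsD)
    finally show ?thesis by simp
  qed
  then show ?thesis using passage_time_greatest[of u v "passage_time \<tau> u v - sum \<tau> B" \<tau>'] by simp
qed

text \<open>Edges of a path are counted once, so loops have to be cut out before summing increments.\<close>

lemma potential_le_sum_path_edges:
  fixes c :: "'a set \<Rightarrow> real"
  assumes "p \<noteq> []" "successively R p"
    and c: "\<And>x y. R x y \<Longrightarrow> \<bar>g x - g y\<bar> \<le> c {x, y}"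
  shows "\<bar>g (hd p) - g (last p)\<bar> \<le> sum c (path_edges p)"
  using assms(1,2)
proof (induction "length p" arbitrary: p rule: less_induct)
  case less
  have edges_nonneg: "0 \<le> c e" if "e \<in> path_edges p" for e
    using that less.prems(2)
    by (induction p rule: induct_list012) (auto intro: order_trans[OF abs_ge_zero c])
  obtain v q where p: "p = v # q" using less.prems by (cases p) auto
  show ?case
  proof (cases "v \<in> set q")
    case True
    then obtain q1 q2 where q: "q = q1 @ v # q2" by (auto simp: in_set_conv_decomp)
    have "\<bar>g (hd (v # q2)) - g (last (v # q2))\<bar> \<le> sum c (path_edges (v # q2))"
      using less.prems by (intro less.hyps) (auto simp: p q successively_append_iff
          successively_Cons)
    also have "\<dots> \<le> sum c (path_edges p)"
      using path_edges_append[of "v # q1" v q2]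
      by (intro sum_mono2 edges_nonneg) (auto simp: p q)
    finally show ?thesis by (simp add: p q)
  next
    case False
    show ?thesis
    proof (cases q)
      case (Cons w q')
      have "{v, w} \<notin> path_edges q"
      proof
        assume "{v, w} \<in> path_edges q"
        then obtain i where "{v, w} = {q ! i, q ! Suc i}" "Suc i < length q"
          by (auto simp: path_edges_def)
        then have "v \<in> set q" by (metis Suc_lessD doubleton_eq_iff nth_mem)
        with False show False by simp
      qed
      then have "sum c (path_edges p) = c {v, w} + sum c (path_edges q)"
        by (simp add: p Cons)
      moreover have "\<bar>g v - g w\<bar> \<le> c {v, w}" using less.prems p Cons by (intro c) auto
      moreover have "\<bar>g (hd q) - g (last q)\<bar> \<le> sum c (path_edges q)"
        using less.prems by (intro less.hyps) (auto simp: p Cons)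
      ultimately show ?thesis by (simp add: p Cons)
    qed (simp add: p)
  qed
qed

lemma potential_le_path_time:
  assumes "p \<in> lattice_paths u v"
    and "\<And>x y. nearest_neighbors x y \<Longrightarrow> \<bar>g x - g y\<bar> \<le> c {x, y}"
  shows "\<bar>g u - g v\<bar> \<le> path_time c p"
  using potential_le_sum_path_edges[of p nearest_neighbors g c] assms
  by (auto simp: lattice_paths_def path_time_def)

subsection \<open>Translations\<close>

lemma path_edges_map: "path_edges (map f p) = (`) f ` path_edges p"
  by (induction p rule: induct_list012) auto

lemma translate_lattice_paths:
  "p \<in> lattice_paths u v \<Longrightarrow> map ((+) a) p \<in> lattice_paths (a + u) (a + v)"
  by (auto simp: lattice_paths_def successively_map hd_map last_map)

lemma inj_image_translate: "inj ((`) ((+) (a :: 'a::group_add)))"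
  by (simp add: inj_image_eq_iff inj_def)

lemma path_time_translate: "path_time \<tau> (map ((+) a) p) = path_time (\<lambda>e. \<tau> ((+) a ` e)) p"
  for \<tau> :: "(int ^ 'd::finite) set \<Rightarrow> real"
  unfolding path_time_def path_edges_map
  by (subst sum.reindex) (auto intro: inj_on_subset[OF inj_image_translate])

lemma passage_time_translate:
  "passage_time \<tau> (a + u) (a + v) = passage_time (\<lambda>e. \<tau> ((+) a ` e)) u v"
proof -
  have "lattice_paths (a + u) (a + v) = map ((+) a) ` lattice_paths u v"
  proof
    show "lattice_paths (a + u) (a + v) \<subseteq> map ((+) a) ` lattice_paths u v"
    proof
      fix p assume "p \<in> lattice_paths (a + u) (a + v)"
      from translate_lattice_paths[OF this, of "- a"]
      have "map ((+) (- a)) p \<in> lattice_paths u v" by simp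
      moreover have "p = map ((+) a) (map ((+) (- a)) p)" by (simp add: comp_def)
      ultimately show "p \<in> map ((+) a) ` lattice_paths u v" by blast
    qed
  qed (auto intro: translate_lattice_paths)
  then show ?thesis by (simp add: passage_time_def image_image path_time_translate)
qed

lemma translate_lattice_edges_iff [simp]: "(+) a ` e \<in> lattice_edges \<longleftrightarrow> e \<in> lattice_edges"
proof -
  have *: "(+) a ` e \<in> lattice_edges" if "e \<in> lattice_edges" for a :: "int ^ 'd" and e
    using that by (auto simp: lattice_edges_def) (metis nearest_neighbors_translate)
  have "e = (+) (- a) ` (+) a ` e" by (simp add: image_image)
  with *[of "(+) a ` e" "- a"] *[of e a] show ?thesis by auto
qed

section \<open>Averages over grids\<close>

text \<open>Product sets are used because an average over them disintegrates into averages along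
  lines in any one coordinate direction.\<close>

definition grid :: "('d \<Rightarrow> int set) \<Rightarrow> (int ^ 'd::finite) set" where
  "grid C = {z. \<forall>b. z $ b \<in> C b}"

lemma grid_bij: "bij_betw vec_lambda (PiE UNIV C) (grid C)"
  by (rule bij_betwI[where g = vec_nth]) (auto simp: grid_def PiE_def)

lemma finite_grid: "(\<And>b. finite (C b)) \<Longrightarrow> finite (grid C)"
  using bij_betw_finite[OF grid_bij[of C]] by (simp add: finite_PiE)

lemma card_grid: "card (grid C) = (\<Prod>b\<in>UNIV. card (C b))"
  using bij_betw_same_card[OF grid_bij[of C]] by (simp add: card_PiE)

lemma grid_nonempty: "(\<And>b. C b \<noteq> {}) \<Longrightarrow> grid C \<noteq> {}"
  using grid_bij[of C] by (metis PiE_eq_empty_iff bij_betw_empty2)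

text \<open>The entry 0 in direction b is a placeholder: a base point stands for a whole line in
  direction b, and pinning this entry makes the representative unique.\<close>

abbreviation grid_base :: "('d \<Rightarrow> int set) \<Rightarrow> 'd \<Rightarrow> (int ^ 'd::finite) set" where
  "grid_base C b \<equiv> grid (C(b := {0}))"

lemma sum_grid:
  "(\<Sum>z\<in>grid C. h z) = (\<Sum>c\<in>grid_base C b. \<Sum>t\<in>C b. h (set_coord c b t))"
proof -
  have "bij_betw (\<lambda>(c, t). set_coord c b t) (grid_base C b \<times> C b) (grid C)"
    by (rule bij_betwI[where g = "\<lambda>z. (set_coord z b 0, z $ b)"])
      (auto simp: grid_def vec_eq_iff split: if_splits)
  from sum.reindex_bij_betw[OF this, of h] show ?thesis
    by (simp add: sum.cartesian_product split_def)
qed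

lemma card_grid_base: "card (grid C) = card (grid_base C b) * card (C b)"
proof -
  have "card (grid C) = (\<Prod>j\<in>insert b (UNIV - {b}). card (C j))"
    by (simp add: card_grid insert_absorb)
  also have "\<dots> = card (C b) * (\<Prod>j\<in>UNIV - {b}. card (C j))" by (subst prod.insert) auto
  also have "(\<Prod>j\<in>UNIV - {b}. card (C j)) = (\<Prod>j\<in>UNIV - {b}. card ((C(b := {0})) j))"
    by (rule prod.cong) auto
  also have "\<dots> = (\<Prod>j\<in>insert b (UNIV - {b}). card ((C(b := {0})) j))"
    by (subst prod.insert) auto
  also have "\<dots> = card (grid_base C b)" by (simp add: card_grid insert_absorb)
  finally show ?thesis by simp
qed

section \<open>Averages and their change along one coordinate\<close>

definition average :: "('a \<Rightarrow> real) \<Rightarrow> 'a set \<Rightarrow> real" where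
  "average g A = sum g A / card A"

lemma average_mono: "(\<And>z. z \<in> A \<Longrightarrow> g z \<le> h z) \<Longrightarrow> average g A \<le> average h A"
  unfolding average_def by (intro divide_right_mono sum_mono) auto

lemma average_add: "average (\<lambda>z. g z + h z) A = average g A + average h A"
  by (simp add: average_def sum.distrib add_divide_distrib)

lemma average_const: "finite A \<Longrightarrow> A \<noteq> {} \<Longrightarrow> average (\<lambda>_. c) A = c"
  by (simp add: average_def)

lemma average_grid:
  assumes "\<And>b. finite (C b)" "\<And>b. C b \<noteq> {}"
  shows "average h (grid C) =
    average (\<lambda>c. average (\<lambda>t. h (set_coord c b t)) (C b)) (grid_base C b)"
  unfolding average_def sum_grid[of h C b] card_grid_base[of C b]
  by (simp add: sum_divide_distrib[symmetric] mult.commute)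

text \<open>Each edge enters with the coefficient 1 / \<open>card (grid_base C b)\<close>. The
  smallness of these coefficients makes large values of the average expensive.\<close>

definition line_average ::
  "((int ^ 'd::finite) set \<Rightarrow> real) \<Rightarrow> ('d \<Rightarrow> int set) \<Rightarrow> 'd \<Rightarrow> int \<Rightarrow> int \<Rightarrow> real" where
  "line_average \<tau> C b lo hi =
    average (\<lambda>c. \<Sum>j\<in>{lo..<hi}. \<tau> (line_edge c b j)) (grid_base C b)"

text \<open>Given the other coordinates, the old and the new value of coordinate b lie on one line,
  whose segment from lo to hi pays for the move. Averaging this over the lines gives the error
  term.\<close>

lemma average_transfer:
  fixes \<tau> :: "(int ^ 'd::finite) set \<Rightarrow> real"
  assumes \<tau>: "nonneg_weights \<tau>"
    and g: "\<And>z z'. g z' \<le> g z + passage_time \<tau> z z'"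
    and C: "\<And>j. finite (C j)" "\<And>j. C j \<noteq> {}"
    and V: "finite V" "V \<noteq> {}" "V \<subseteq> {lo..hi}" "C b \<subseteq> {lo..hi}"
  shows "average g (grid (C(b := V))) \<le> average g (grid C) + line_average \<tau> C b lo hi"
proof -
  have base: "grid_base (C(b := V)) b = grid_base C b" by simp
  have "average g (grid (C(b := V))) =
    average (\<lambda>c. average (\<lambda>t. g (set_coord c b t)) V) (grid_base C b)"
    using average_grid[of "C(b := V)" g b] C V by simp
  also have "\<dots> \<le> average (\<lambda>c. average (\<lambda>t. g (set_coord c b t)) (C b)
      + (\<Sum>j\<in>{lo..<hi}. \<tau> (line_edge c b j))) (grid_base C b)"
  proof (rule average_mono)
    fix c :: "int ^ 'd"
    let ?l = "\<Sum>j\<in>{lo..<hi}. \<tau> (line_edge c b j)"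
    have *: "g (set_coord c b t) \<le> average (\<lambda>t. g (set_coord c b t)) (C b) + ?l"
      if "t \<in> V" for t
    proof -
      have "g (set_coord c b t) \<le> g (set_coord c b s) + ?l" if "s \<in> C b" for s
        using g[of "set_coord c b t" "set_coord c b s"] \<open>t \<in> V\<close> that V
          passage_time_line[OF \<tau>, of s lo hi t c b] by force
      then have "average (\<lambda>_. g (set_coord c b t)) (C b) \<le>
        average (\<lambda>s. g (set_coord c b s) + ?l) (C b)" by (rule average_mono)
      then show ?thesis using C by (simp add: average_add average_const)
    qed
    have "average (\<lambda>t. g (set_coord c b t)) V \<le>
      average (\<lambda>_. average (\<lambda>t. g (set_coord c b t)) (C b) + ?l) V"
      by (rule average_mono) (use * in simp)
    then show "average (\<lambda>t. g (set_coord c b t)) V \<le>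
      average (\<lambda>t. g (set_coord c b t)) (C b) + ?l" using V by (simp add: average_const)
  qed
  also have "\<dots> = average g (grid C) + line_average \<tau> C b lo hi"
    using C by (simp add: average_add line_average_def average_grid[symmetric])
  finally show ?thesis .
qed

text \<open>Distinct base points have disjoint lines, so a \<open>line_average\<close> is a sum over
  distinct, hence independent, weights. \<open>line_edge c b j\<close> forgets \<open>c $ b\<close>;
  the restriction to base points restores injectivity.\<close>

lemma inj_line_edge:
  "inj_on (\<lambda>(c, j). line_edge c b j) (grid_base C b \<times> UNIV)"
proof (rule inj_onI, clarify)
  fix c j c' j'
  assume c: "c \<in> grid_base C b" "c' \<in> grid_base C b" and eq: "line_edge c b j = line_edge c' b j'"
  have cb: "c $ b = 0" "c' $ b = 0" using c by (auto simp: grid_def split: if_splits dest: spec[of _ b])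
  have "(set_coord c b j = set_coord c' b j' \<and> set_coord c b (j + 1) = set_coord c' b (j' + 1)) \<or>
    (set_coord c b j = set_coord c' b (j' + 1) \<and> set_coord c b (j + 1) = set_coord c' b j')"
    using eq by (simp add: line_edge_def doubleton_eq_iff)
  then show "c = c' \<and> j = j'"
  proof
    assume a: "set_coord c b j = set_coord c' b j' \<and> set_coord c b (j + 1) = set_coord c' b (j' + 1)"
    have "c $ i = c' $ i" for i using arg_cong[OF conjunct1[OF a], of "\<lambda>v. v $ i"] cb
      by (auto split: if_splits)
    moreover have "j = j'" using arg_cong[OF conjunct1[OF a], of "\<lambda>v. v $ b"] by simp
    ultimately show ?thesis by (simp add: vec_eq_iff)
  next
    assume a: "set_coord c b j = set_coord c' b (j' + 1) \<and> set_coord c b (j + 1) = set_coord c' b j'"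
    have "j = j' + 1" "j + 1 = j'"
      using arg_cong[OF conjunct1[OF a], of "\<lambda>v. v $ b"]
        arg_cong[OF conjunct2[OF a], of "\<lambda>v. v $ b"] by simp_all
    then show ?thesis by simp
  qed
qed

subsection \<open>Chains of grids\<close>

text \<open>Interpolates between two product grids: the directions in D have already been switched
  from A to B.\<close>

definition mixed :: "('d \<Rightarrow> 'a) \<Rightarrow> ('d \<Rightarrow> 'a) \<Rightarrow> 'd set \<Rightarrow> 'd \<Rightarrow> 'a" where
  "mixed A B D b = (if b \<in> D then B b else A b)"

text \<open>The directions are switched one at a time, in an order left open by the induction over
  finite sets; hence the bound s is required for all D.\<close>

lemma average_transfer_all:
  fixes \<tau> :: "(int ^ 'd::finite) set \<Rightarrow> real" and s :: real
  assumes \<tau>: "nonneg_weights \<tau>"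
    and g: "\<And>z z'. g z' \<le> g z + passage_time \<tau> z z'"
    and A: "\<And>j. finite (A j)" "\<And>j. A j \<noteq> {}" "\<And>j. A j \<subseteq> {lo j..hi j}"
    and B: "\<And>j. finite (B j)" "\<And>j. B j \<noteq> {}" "\<And>j. B j \<subseteq> {lo j..hi j}"
    and s: "\<And>D b. b \<notin> D \<Longrightarrow> line_average \<tau> (mixed A B D) b (lo b) (hi b) \<le> s"
  shows "average g (grid B) \<le> average g (grid A) + CARD('d) * s"
proof -
  have "average g (grid (mixed A B D)) \<le> average g (grid A) + card D * s" if "finite D" for D
    using that
  proof (induction D)
    case empty
    have "mixed A B {} = A" by (simp add: mixed_def fun_eq_iff)
    then show ?case by simp
  next
    case (insert b D)
    have eq: "mixed A B (insert b D) = (mixed A B D)(b := B b)"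
      by (rule ext) (simp add: mixed_def)
    have "average g (grid (mixed A B (insert b D))) \<le>
      average g (grid (mixed A B D)) + line_average \<tau> (mixed A B D) b (lo b) (hi b)"
      unfolding eq
    proof (rule average_transfer[OF \<tau> g])
      show "mixed A B D b \<subseteq> {lo b..hi b}" using A(3)[of b] B(3)[of b] by (simp add: mixed_def)
      show "B b \<subseteq> {lo b..hi b}" by (rule B(3))
    qed (use A B in \<open>auto simp: mixed_def\<close>)
    also have "\<dots> \<le> (average g (grid A) + card D * s) + s"
      by (intro add_mono insert.IH s insert.hyps)
    finally show ?case using insert.hyps by (simp add: algebra_simps)
  qed
  from this[of UNIV] show ?thesis by (simp add: mixed_def[abs_def])
qed

section \<open>Dyadic cubes with a fixed corner\<close>

definition cube :: "int ^ 'd::finite \<Rightarrow> nat \<Rightarrow> 'd \<Rightarrow> int set" where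
  "cube y i b = {y $ b..<y $ b + 2 ^ i}"

lemma finite_cube [simp]: "finite (cube y i b)"
  by (simp add: cube_def)

lemma cube_nonempty [simp]: "cube y i b \<noteq> {}"
  by (simp add: cube_def)

lemma card_cube [simp]: "card (cube y i b) = 2 ^ i"
  by (simp add: cube_def)

lemma cube_subset:
  assumes "i \<le> j"
  shows "cube y i b \<subseteq> {y $ b..y $ b + 2 ^ j}"
proof -
  have "(2::int) ^ i \<le> 2 ^ j" using assms by (intro power_increasing) auto
  then have "x \<le> y $ b + 2 ^ j" if "x < y $ b + 2 ^ i" for x using that by linarith
  then show ?thesis by (auto simp: cube_def)
qed

lemma average_cube_chain:
  fixes \<tau> :: "(int ^ 'd::finite) set \<Rightarrow> real" and s :: "nat \<Rightarrow> real"
  assumes \<tau>: "nonneg_weights \<tau>"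
    and s: "\<And>i D b. i < k \<Longrightarrow> b \<notin> D \<Longrightarrow>
      line_average \<tau> (mixed (cube y i) (cube y (Suc i)) D) b (y $ b) (y $ b + 2 ^ Suc i) \<le> s i"
  shows "average (passage_time \<tau> y) (grid (cube y k)) \<le> CARD('d) * (\<Sum>i<k. s i)"
  using s
proof (induction k)
  case 0
  \<comment> \<open>The cube of scale 0 is y alone, where the average is
    \<open>passage_time \<tau> y y = 0\<close>; the chain starts without error.\<close>
  have "grid (cube y 0) = {y}" by (auto simp: grid_def cube_def vec_eq_iff) (meson order_antisym)
  then show ?case using \<tau> by (simp add: average_def)
next
  case (Suc k)
  have "average (passage_time \<tau> y) (grid (cube y (Suc k))) \<le>
    average (passage_time \<tau> y) (grid (cube y k)) + CARD('d) * s k"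
    by (rule average_transfer_all[OF \<tau> passage_time_triangle[OF \<tau>], where lo = "\<lambda>b. y $ b"
          and hi = "\<lambda>b. y $ b + 2 ^ Suc k"])
      (use Suc.prems cube_subset[of k "Suc k" y] cube_subset[of "Suc k" "Suc k" y] in auto)
  with Suc show ?case by (simp add: distrib_left)
qed

lemma line_average_le:
  assumes C: "\<And>j. finite (C j)" "\<And>j. C j \<noteq> {}"
    and \<eta>: "\<And>c j. c \<in> grid_base C b \<Longrightarrow> j \<in> {lo..<hi} \<Longrightarrow> \<tau> (line_edge c b j) \<le> \<eta>" and "lo \<le> hi"
  shows "line_average \<tau> C b lo hi \<le> real_of_int (hi - lo) * \<eta>"
proof -
  have "line_average \<tau> C b lo hi \<le> average (\<lambda>_. real_of_int (hi - lo) * \<eta>) (grid_base C b)"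
    unfolding line_average_def
  proof (rule average_mono)
    fix c assume "c \<in> grid_base C b"
    then have "(\<Sum>j\<in>{lo..<hi}. \<tau> (line_edge c b j)) \<le> (\<Sum>j\<in>{lo..<hi}. \<eta>)"
      by (intro sum_mono \<eta>)
    then show "(\<Sum>j\<in>{lo..<hi}. \<tau> (line_edge c b j)) \<le> real_of_int (hi - lo) * \<eta>" using \<open>lo \<le> hi\<close> by simp
  qed
  also have "\<dots> = real_of_int (hi - lo) * \<eta>"
    using C by (intro average_const finite_grid grid_nonempty) auto
  finally show ?thesis .
qed

text \<open>Serves the small scales, where averaging is too weak: all weights near y obey one bound,
  and only the length of the segment enters.\<close>

lemma cube_line_average_le:
  assumes "\<And>e. e \<in> lattice_edges \<Longrightarrow> e \<subseteq> {z. \<forall>j. z $ j \<in> {y $ j..y $ j + 2 ^ k}} \<Longrightarrow> \<tau> e \<le> \<eta>"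
    and "i < k"
  shows "line_average \<tau> (mixed (cube y i) (cube y (Suc i)) D) b (y $ b) (y $ b + 2 ^ Suc i)
    \<le> 2 ^ Suc i * \<eta>"
proof -
  have "line_average \<tau> (mixed (cube y i) (cube y (Suc i)) D) b (y $ b) (y $ b + 2 ^ Suc i)
    \<le> real_of_int ((y $ b + 2 ^ Suc i) - y $ b) * \<eta>"
  proof (rule line_average_le)
    fix c j assume c: "c \<in> grid_base (mixed (cube y i) (cube y (Suc i)) D) b"
      and j: "j \<in> {y $ b..<y $ b + 2 ^ Suc i}"
    have pow: "(2::int) ^ Suc i \<le> 2 ^ k" using assms(2) by (intro power_increasing) auto
    have "c $ l \<in> {y $ l..y $ l + 2 ^ k}" if "l \<noteq> b" for l
    proof -
      have "c $ l \<in> mixed (cube y i) (cube y (Suc i)) D l"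
        using c that by (auto simp: grid_def dest: spec[of _ l])
      moreover have "mixed (cube y i) (cube y (Suc i)) D l \<subseteq> {y $ l..y $ l + 2 ^ k}"
        using cube_subset[of i k y l] cube_subset[of "Suc i" k y l] assms(2)
        by (auto simp: mixed_def)
      ultimately show ?thesis by blast
    qed
    then show "\<tau> (line_edge c b j) \<le> \<eta>"
      using j pow by (intro assms(1) line_edge_in_lattice_edges) (auto simp: line_edge_def)
  qed (auto simp: mixed_def)
  then show ?thesis by simp
qed

section \<open>Boxes and capacity\<close>

lemma linf_norm_le_iff: "linf_norm v \<le> k \<longleftrightarrow> (\<forall>i. \<bar>v $ i\<bar> \<le> k)"
  unfolding linf_norm_def by (subst Max_le_iff) auto

lemma abs_nth_le_linf_norm: "\<bar>v $ i\<bar> \<le> linf_norm v"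
  using linf_norm_le_iff[of v "linf_norm v"] by simp

lemma linf_norm_minus [simp]: "linf_norm (- v) = linf_norm v"
  by (simp add: linf_norm_def)

lemma linf_norm_zero [simp]: "linf_norm 0 = 0"
  by (simp add: linf_norm_def)

lemma linf_norm_add_le: "linf_norm (v + w) \<le> linf_norm v + linf_norm w"
  by (auto simp: linf_norm_le_iff intro!: order_trans[OF abs_triangle_ineq] add_mono
      abs_nth_le_linf_norm)

lemma linf_norm_le_l1_norm: "linf_norm v \<le> l1_norm v"
  by (auto simp: linf_norm_le_iff l1_norm_def intro: member_le_sum)

lemma linf_norm_neighbor: "nearest_neighbors x y \<Longrightarrow> linf_norm x \<le> linf_norm y + 1"
  using linf_norm_add_le[of y "x - y"] linf_norm_le_l1_norm[of "x - y"]
  by (simp add: nearest_neighbors_def)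

lemma lattice_box_0: "lattice_box m 0 = {y. linf_norm y \<le> int m}"
  by (simp add: lattice_box_def)

lemma finite_lattice_box: "finite (lattice_box m (x :: int ^ 'd::finite))"
proof -
  have "lattice_box m x \<subseteq> grid (\<lambda>b. {x $ b - int m..x $ b + int m})"
  proof
    fix z assume "z \<in> lattice_box m x"
    then have "\<bar>z $ b - x $ b\<bar> \<le> int m" for b by (simp add: lattice_box_def linf_norm_le_iff)
    then show "z \<in> grid (\<lambda>b. {x $ b - int m..x $ b + int m})"
      unfolding grid_def abs_le_iff by (simp add: algebra_simps)
  qed
  then show ?thesis by (rule finite_subset) (auto intro: finite_grid)
qed

lemma box_edges_subset: "box_edges m \<subseteq> lattice_edges"
  by (auto simp: box_edges_def)

lemma linf_norm_le_of_box_edges: "e \<in> box_edges m \<Longrightarrow> x \<in> e \<Longrightarrow> linf_norm x \<le> int m"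
  by (auto simp: box_edges_def lattice_box_0)

lemma box_edges_iff:
  assumes "nearest_neighbors x y"
  shows "{x, y} \<in> box_edges m \<longleftrightarrow> linf_norm x \<le> m \<and> linf_norm y \<le> m"
proof
  show "{x, y} \<in> box_edges m" if "linf_norm x \<le> m \<and> linf_norm y \<le> m"
    using assms that unfolding box_edges_def lattice_box_0 by blast
qed (use linf_norm_le_of_box_edges[of "{x, y}" m] in auto)

lemma box_edges_mono:
  assumes "m \<le> n"
  shows "box_edges m \<subseteq> box_edges n"
proof
  fix e :: "(int ^ 'd) set" assume "e \<in> box_edges m"
  then obtain x y where e: "e = {x, y}" "nearest_neighbors x y" "linf_norm x \<le> m" "linf_norm y \<le> m"
    by (auto simp: box_edges_def lattice_box_0)
  then show "e \<in> box_edges n" using assms by (simp add: box_edges_iff)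
qed

lemma finite_box_edges [simp]: "finite (box_edges m)"
proof -
  have "box_edges m \<subseteq> Pow (lattice_box m 0)" by (auto simp: box_edges_def)
  then show ?thesis by (rule finite_subset) (simp add: finite_lattice_box)
qed

lemma lattice_edgesE:
  assumes "e \<in> lattice_edges"
  obtains x y where "e = {x, y}" "nearest_neighbors x y"
  using assms by (auto simp: lattice_edges_def)

lemma edge_increment_nonneg: "e \<in> lattice_edges \<Longrightarrow> 0 \<le> edge_increment f e"
  by (erule lattice_edgesE) (simp add: edge_increment_doubleton)

lemma edge_increment_translate: "edge_increment (\<lambda>y. f (y - v)) ((+) v ` e) = edge_increment f e"
  for v :: "'a::ab_group_add"
  by (simp add: edge_increment_def image_image)

section \<open>Admissible functions, their energy and the monotonicity of the capacity\<close>

definition admissible :: "nat \<Rightarrow> (int ^ 'd::finite \<Rightarrow> real) \<Rightarrow> bool" where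
  "admissible m f \<longleftrightarrow> (\<forall>x\<in>lattice_box_boundary m 0. f x \<ge> 1) \<and> f 0 = 0"

definition box_energy :: "real \<Rightarrow> nat \<Rightarrow> (int ^ 'd::finite \<Rightarrow> real) \<Rightarrow> real" where
  "box_energy r m f = (\<Sum>e\<in>box_edges m. edge_increment f e powr r)"

lemma box_capacity_eq: "box_capacity TYPE('d::finite) r m = Inf (box_energy r m ` {f :: int ^ 'd \<Rightarrow> real. admissible m f})"
  unfolding box_capacity_def box_energy_def admissible_def by (intro arg_cong[where f = Inf]) auto

lemma box_energy_nonneg: "0 \<le> box_energy r m f"
  unfolding box_energy_def by (intro sum_nonneg) auto

lemma box_capacity_le: "admissible m (f :: int ^ 'd::finite \<Rightarrow> real) \<Longrightarrow> box_capacity TYPE('d) r m \<le> box_energy r m f"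
  unfolding box_capacity_eq by (intro cINF_lower bdd_belowI[of _ 0]) (auto intro: box_energy_nonneg)

lemma admissible_indicator: "1 \<le> m \<Longrightarrow> admissible m (\<lambda>y :: int ^ 'd::finite. if y = 0 then 0 else 1)"
  by (auto simp: admissible_def lattice_box_boundary_def)

lemma box_capacity_nonneg: "1 \<le> m \<Longrightarrow> 0 \<le> box_capacity TYPE('d::finite) r m"
  unfolding box_capacity_eq using admissible_indicator[of m]
  by (intro cINF_greatest) (auto intro: box_energy_nonneg)

text \<open>Capping at 1 is a contraction and does not raise the energy. The constant value 1
  outside the box makes the function a potential on the whole lattice, which is needed both for
  comparing boxes and for the lower bound.\<close>

lemma clipped_minimizer:
  assumes "1 \<le> m" "box_capacity TYPE('d::finite) r m < \<eta>" "0 < r"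
  obtains f :: "int ^ 'd \<Rightarrow> real" where "f 0 = 0" "\<And>y. int m \<le> linf_norm y \<Longrightarrow> f y = 1"
    "box_energy r m f < \<eta>"
proof -
  from assms(2) have "\<exists>f :: int ^ 'd \<Rightarrow> real. admissible m f \<and> box_energy r m f < \<eta>"
    unfolding box_capacity_eq using admissible_indicator[OF assms(1)]
    by (subst (asm) cINF_less_iff) (auto intro!: bdd_belowI[of _ 0] box_energy_nonneg)
  then obtain f :: "int ^ 'd \<Rightarrow> real" where f: "admissible m f" "box_energy r m f < \<eta>" by blast
  define g where "g y = (if int m \<le> linf_norm y then 1 else min (f y) 1)" for y
  \<comment> \<open>On the boundary the two branches of g agree because f is at least 1
    there.\<close>
  have g: "g y = min (f y) 1" if "linf_norm y \<le> m" for y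
    using f(1) that by (auto simp: g_def admissible_def lattice_box_boundary_def)
  have "box_energy r m g \<le> box_energy r m f"
    unfolding box_energy_def
  proof (intro sum_mono powr_mono2)
    fix e :: "(int ^ 'd) set" assume e: "e \<in> box_edges m"
    then have "e \<in> lattice_edges" using box_edges_subset by blast
    then show "0 \<le> edge_increment g e" by (rule edge_increment_nonneg)
    from e obtain x y where "e = {x, y}" "linf_norm x \<le> m" "linf_norm y \<le> m"
      by (auto simp: box_edges_def lattice_box_0)
    then show "edge_increment g e \<le> edge_increment f e"
      by (simp add: edge_increment_doubleton g min_def) 
  qed (use assms in simp)
  with f(2) have "box_energy r m g < \<eta>" by simp
  moreover have "g 0 = 0" using f(1) assms(1) by (simp add: g_def admissible_def)
  ultimately show ?thesis using that[of g] by (simp add: g_def)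
qed

text \<open>The norms of neighbors differ by at most 1, so an edge that leaves the box has both ends
  at norm at least m, where f is constant.\<close>

lemma edge_increment_outside:
  assumes "\<And>y. int m \<le> linf_norm y \<Longrightarrow> f y = 1" "e \<in> lattice_edges" "e \<notin> box_edges m"
  shows "edge_increment f e = 0"
proof -
  obtain x y where e: "e = {x, y}" "nearest_neighbors x y"
    using assms(2) by (rule lattice_edgesE)
  then have "\<not> (linf_norm x \<le> m \<and> linf_norm y \<le> m)" using assms(3) by (simp add: box_edges_iff)
  then have "int m \<le> linf_norm x \<and> int m \<le> linf_norm y"
    using linf_norm_neighbor[OF e(2)] linf_norm_neighbor[of y x] e(2) nearest_neighbors_sym[of x y] by linarith
  then show ?thesis by (simp add: e edge_increment_doubleton assms(1))
qed

text \<open>A near-minimizer for m, continued by 1, is admissible for \<open>Suc m\<close> with the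
  same energy. For m = 0 the conditions at the origin contradict each other, whence
  \<open>1 \<le> m\<close>.\<close>

lemma box_capacity_Suc_le:
  assumes "1 \<le> m" "0 < r"
  shows "box_capacity TYPE('d::finite) r (Suc m) \<le> box_capacity TYPE('d) r m"
proof (rule dense_ge)
  fix \<eta> assume \<eta>: "box_capacity TYPE('d) r m < \<eta>"
  obtain f :: "int ^ 'd \<Rightarrow> real" where f: "f 0 = 0" "\<And>y. int m \<le> linf_norm y \<Longrightarrow> f y = 1"
    "box_energy r m f < \<eta>" using clipped_minimizer[OF assms(1) \<eta> assms(2)] by blast
  have "box_capacity TYPE('d) r (Suc m) \<le> box_energy r (Suc m) f"
    by (intro box_capacity_le) (simp add: admissible_def lattice_box_boundary_def f(1) f(2))
  also have "\<dots> = box_energy r m f" unfolding box_energy_def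
  proof (rule sum.mono_neutral_right)
    show "box_edges m \<subseteq> box_edges (Suc m)" by (rule box_edges_mono) simp
    show "\<forall>e\<in>box_edges (Suc m) - box_edges m. edge_increment f e powr r = 0"
    proof
      fix e :: "(int ^ 'd) set" assume "e \<in> box_edges (Suc m) - box_edges m"
      then have "e \<in> lattice_edges" "e \<notin> box_edges m" using box_edges_subset[of "Suc m"] by blast+
      with f(2) have "edge_increment f e = 0" by (rule edge_increment_outside)
      then show "edge_increment f e powr r = 0" by simp
    qed
  qed simp
  finally show "box_capacity TYPE('d) r (Suc m) \<le> \<eta>" using f(3) by simp
qed

lemma
  assumes "0 < r"
  shows box_capacity_tendsto: "(\<lambda>m. box_capacity TYPE('d::finite) r m) \<longlonglongrightarrow> discrete_capacity TYPE('d) r"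
    and discrete_capacity_le: "1 \<le> m \<Longrightarrow> discrete_capacity TYPE('d) r \<le> box_capacity TYPE('d) r m"
proof -
  \<comment> \<open>The sequence is started at 1, since the infimum for m = 0 is over the empty set;
    this does not change the limit.\<close>
  let ?c = "\<lambda>m. box_capacity TYPE('d) r (Suc m)"
  have dec: "decseq ?c" using assms by (intro decseq_SucI box_capacity_Suc_le) auto
  have bd: "\<forall>i. 0 \<le> ?c i" by (simp add: box_capacity_nonneg)
  obtain L where "?c \<longlonglongrightarrow> L" by (rule decseq_convergent[OF dec bd])
  then have L: "(\<lambda>m. box_capacity TYPE('d) r m) \<longlonglongrightarrow> L" by (rule LIMSEQ_imp_Suc)
  then have "discrete_capacity TYPE('d) r = L" unfolding discrete_capacity_def by (rule limI)
  with L show lim: "(\<lambda>m. box_capacity TYPE('d) r m) \<longlonglongrightarrow> discrete_capacity TYPE('d) r" by simp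
  then have "?c \<longlonglongrightarrow> discrete_capacity TYPE('d) r" by (rule LIMSEQ_Suc)
  from decseq_ge[OF dec this, of "m - 1"] show "1 \<le> m \<Longrightarrow> discrete_capacity TYPE('d) r \<le> box_capacity TYPE('d) r m"
    by simp
qed

lemma discrete_capacity_nonneg:
  assumes "0 < r"
  shows "0 \<le> discrete_capacity TYPE('d::finite) r"
proof (rule LIMSEQ_le_const[OF box_capacity_tendsto[OF assms]])
  show "\<exists>N. \<forall>n\<ge>N. 0 \<le> box_capacity TYPE('d) r n" using box_capacity_nonneg by blast
qed

text \<open>Divided by t, the passage times from a form an admissible function whose increments are
  at most the weights divided by t. For t = 0 one cannot divide, but \<open>0 powr r = 0\<close>
  makes the left side vanish.\<close>

lemma capacity_le_sum_weights:
  fixes \<tau> :: "(int ^ 'd::finite) set \<Rightarrow> real"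
  assumes \<tau>: "nonneg_weights \<tau>" and "1 \<le> m" "0 < r" "0 \<le> t"
    and t: "\<And>y. linf_norm y = int m \<Longrightarrow> t \<le> passage_time \<tau> a (a + y)"
  shows "discrete_capacity TYPE('d) r * t powr r \<le> (\<Sum>e\<in>box_edges m. \<tau> ((+) a ` e) powr r)"
proof (cases "t = 0")
  case False
  with assms have t0: "0 < t" by simp
  define f where "f y = passage_time \<tau> a (a + y) / t" for y
  have "admissible m f" using t t0 \<tau>
    by (auto simp: admissible_def lattice_box_boundary_def f_def divide_simps)
  then have "discrete_capacity TYPE('d) r \<le> box_energy r m f"
    using box_capacity_le[of m f r] discrete_capacity_le[OF \<open>0 < r\<close> \<open>1 \<le> m\<close>, where 'd = 'd] by linarith
  also have "\<dots> \<le> (\<Sum>e\<in>box_edges m. (\<tau> ((+) a ` e) / t) powr r)"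
    unfolding box_energy_def
  proof (intro sum_mono powr_mono2)
    fix e :: "(int ^ 'd) set" assume "e \<in> box_edges m"
    then have e: "e \<in> lattice_edges" using box_edges_subset by blast
    then show "0 \<le> edge_increment f e" by (rule edge_increment_nonneg)
    from e obtain x y where xy: "e = {x, y}" "nearest_neighbors x y" by (rule lattice_edgesE)
    then have "edge_increment f e = \<bar>passage_time \<tau> a (a + x) - passage_time \<tau> a (a + y)\<bar> / t"
      using t0 by (simp add: edge_increment_doubleton f_def diff_divide_distrib[symmetric])
    also have "\<dots> \<le> \<tau> ((+) a ` e) / t"
      using passage_time_edge_diff[OF \<tau>, of "a + x" "a + y" a] xy t0
      by (intro divide_right_mono) auto
    finally show "edge_increment f e \<le> \<tau> ((+) a ` e) / t" .
  qed (use assms in simp)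
  also have "\<dots> = (\<Sum>e\<in>box_edges m. \<tau> ((+) a ` e) powr r / t powr r)"
  proof (rule sum.cong[OF refl])
    fix e :: "(int ^ 'd) set" assume "e \<in> box_edges m"
    then have "(+) a ` e \<in> lattice_edges" using box_edges_subset by auto
    then show "(\<tau> ((+) a ` e) / t) powr r = \<tau> ((+) a ` e) powr r / t powr r"
      using nonneg_weightsD[OF \<tau>] t0 by (simp add: powr_divide)
  qed
  finally show ?thesis using t0 by (simp add: sum_divide_distrib[symmetric] field_simps)
qed (use assms in \<open>auto intro: sum_nonneg\<close>)

lemma disjoint_box_edges:
  assumes "2 * int m < linf_norm v"
  shows "box_edges m \<inter> (`) ((+) v) ` box_edges m = {}"
proof (rule ccontr)
  assume "box_edges m \<inter> (`) ((+) v) ` box_edges m \<noteq> {}"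
  then obtain e where e: "e \<in> box_edges m" "(+) v ` e \<in> box_edges m" by blast
  then obtain x where "x \<in> e" by (auto simp: box_edges_def)
  then have "linf_norm x \<le> m" "linf_norm (v + x) \<le> m"
    using linf_norm_le_of_box_edges[OF e(1)] linf_norm_le_of_box_edges[OF e(2)] by auto
  then show False using linf_norm_add_le[of "v + x" "- x"] assms by simp
qed

text \<open>The two delays add up because a single potential on the lattice climbs by t in each box.
  Its increments live on the edges of the boxes, exactly where the weights of the other term are set
  to 0, so both fit under \<tau> edge by edge.\<close>

lemma passage_time_two_boxes:
  fixes \<tau> :: "(int ^ 'd::finite) set \<Rightarrow> real" and f :: "int ^ 'd \<Rightarrow> real"
  defines "B \<equiv> \<lambda>m v. box_edges m \<union> (`) ((+) v) ` box_edges m"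
  assumes \<tau>: "nonneg_weights \<tau>" and f: "f 0 = 0" "\<And>y. int m \<le> linf_norm y \<Longrightarrow> f y = 1"
    and v: "2 * int m < linf_norm v" and "0 \<le> t"
    and large: "\<And>e. e \<in> box_edges m \<Longrightarrow> t * edge_increment f e \<le> \<tau> e"
      "\<And>e. e \<in> box_edges m \<Longrightarrow> t * edge_increment f e \<le> \<tau> ((+) v ` e)"
  shows "2 * t + passage_time (\<lambda>e. if e \<in> B m v then 0 else \<tau> e) 0 v \<le> passage_time \<tau> 0 v"
proof (rule passage_time_greatest)
  let ?\<tau>0 = "\<lambda>e. if e \<in> B m v then 0 else \<tau> e"
  let ?inc = "\<lambda>e. edge_increment f e" and ?inc' = "\<lambda>e. edge_increment (\<lambda>y. f (y - v)) e"
  fix p assume p: "p \<in> lattice_paths 0 v"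
  have sub: "path_edges p \<subseteq> lattice_edges" by (rule path_edges_lattice_paths[OF p])
  have \<tau>0: "nonneg_weights ?\<tau>0" using \<tau> by (auto simp: nonneg_weights_def)
  have shift: "\<exists>e'\<in>lattice_edges. e = (+) v ` e'" if "e \<in> lattice_edges" for e
  proof
    show "(+) (- v) ` e \<in> lattice_edges" using that by (simp only: translate_lattice_edges_iff)
  qed (simp add: image_image)
  have inc0: "?inc e = 0" if "e \<in> lattice_edges" "e \<notin> box_edges m" for e
    using f(2) that by (rule edge_increment_outside)
  have inc0': "?inc' e = 0" if e: "e \<in> lattice_edges" "e \<notin> (`) ((+) v) ` box_edges m" for e
  proof -
    obtain e' where e': "e' \<in> lattice_edges" "e = (+) v ` e'" using shift[OF e(1)] by blast
    then have "e' \<notin> box_edges m" using e(2) by blast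
    with e' show ?thesis using inc0[of e'] by (simp add: edge_increment_translate)
  qed
  have disj: "box_edges m \<inter> (`) ((+) v) ` box_edges m = {}" by (rule disjoint_box_edges[OF v])
  define c where "c e = t * (?inc e + ?inc' e)" for e
  \<comment> \<open>g is 0 at the origin, t outside both boxes and \<open>2 * t\<close> at
    v.\<close>
  define g where "g y = t * (f y + 1 - f (y - v))" for y
  have g: "\<bar>g x - g y\<bar> \<le> c {x, y}" for x y
  proof -
    have "g x - g y = t * ((f x - f y) + (f (y - v) - f (x - v)))"
      by (simp add: g_def algebra_simps)
    then have "\<bar>g x - g y\<bar> = t * \<bar>(f x - f y) + (f (y - v) - f (x - v))\<bar>"
      using \<open>0 \<le> t\<close> by (simp add: abs_mult)
    also have "\<dots> \<le> c {x, y}"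
      using \<open>0 \<le> t\<close> unfolding c_def by (intro mult_left_mono) (auto simp: edge_increment_doubleton)
    finally show ?thesis .
  qed
  have "f v = 1" "f (- v) = 1" using v by (auto intro!: f(2))
  then have "2 * t = \<bar>g 0 - g v\<bar>" using f(1) \<open>0 \<le> t\<close> by (simp add: g_def)
  also have "\<dots> \<le> path_time c p" using g by (intro potential_le_path_time[OF p]) auto
  finally have "2 * t \<le> path_time c p" .
  moreover have "passage_time ?\<tau>0 0 v \<le> path_time ?\<tau>0 p"
    by (rule passage_time_le_path_time[OF \<tau>0 p])
  moreover have "path_time c p + path_time ?\<tau>0 p \<le> path_time \<tau> p"
    unfolding path_time_def sum.distrib[symmetric]
  proof (rule sum_mono)
    fix e assume "e \<in> path_edges p"
    then have e: "e \<in> lattice_edges" using sub by blast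
    consider (near) "e \<in> box_edges m" | (far) "e \<in> (`) ((+) v) ` box_edges m" "e \<notin> box_edges m"
      | (out) "e \<notin> B m v"
      unfolding B_def by blast
    then show "c e + ?\<tau>0 e \<le> \<tau> e"
    proof cases
      case near
      then have "e \<notin> (`) ((+) v) ` box_edges m" using disj by blast
      then show ?thesis using large(1)[OF near] inc0'[OF e] near by (simp add: c_def B_def)
    next
      case far
      then obtain e' where e': "e = (+) v ` e'" "e' \<in> box_edges m" by blast
      then have "?inc' e = ?inc e'" by (simp add: edge_increment_translate)
      then show ?thesis using large(2)[OF e'(2)] inc0[OF e far(2)] far e'(1)
        by (simp add: c_def B_def)
    next
      case out
      then show ?thesis using inc0[OF e] inc0'[OF e] by (simp add: c_def B_def)
    qed
  qed
  ultimately show "2 * t + passage_time ?\<tau>0 0 v \<le> path_time \<tau> p" by linarith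
qed

section \<open>Random passage times\<close>

lemma borel_measurable_passage_time [measurable]:
  fixes \<sigma> :: "'a \<Rightarrow> (int ^ 'd::finite) set \<Rightarrow> real"
  assumes [measurable]: "\<And>e. e \<in> lattice_edges \<Longrightarrow> (\<lambda>x. \<sigma> x e) \<in> borel_measurable N"
  shows "(\<lambda>x. passage_time (\<sigma> x) u v) \<in> borel_measurable N"
proof -
  have "(\<lambda>x. path_time (\<sigma> x) p) \<in> borel_measurable N" if "p \<in> lattice_paths u v" for p
    unfolding path_time_def using path_edges_lattice_paths[OF that]
    by (intro borel_measurable_sum) auto
  then show ?thesis unfolding passage_time_def by (intro borel_measurable_cINF_real) auto
qed

text \<open>The parameter of the exponential bound is absorbed into X, so each application brings
  its own tilt.\<close>

lemma (in prob_space) chernoff: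
  assumes "finite A" "indep_vars (\<lambda>_. borel) X A"
    and "\<And>i. i \<in> A \<Longrightarrow> integrable M (\<lambda>\<omega>. exp (X i \<omega>) :: real)"
  shows "prob {\<omega> \<in> space M. s \<le> (\<Sum>i\<in>A. X i \<omega>)} \<le> exp (- s) * (\<Prod>i\<in>A. expectation (\<lambda>\<omega>. exp (X i \<omega>)))"
proof -
  have ind: "indep_vars (\<lambda>_. borel) (\<lambda>i \<omega>. exp (X i \<omega>)) A"
    using assms(2) by (rule indep_vars_compose2) auto
  have int: "integrable M (\<lambda>\<omega>. \<Prod>i\<in>A. exp (X i \<omega>))"
    by (rule indep_vars_integrable[OF assms(1) ind assms(3)])
  have "{\<omega> \<in> space M. s \<le> (\<Sum>i\<in>A. X i \<omega>)} = {\<omega> \<in> space M. exp s \<le> (\<Prod>i\<in>A. exp (X i \<omega>))}"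
    using \<open>finite A\<close> by (simp add: exp_sum[symmetric])
  also have "prob \<dots> \<le> expectation (\<lambda>\<omega>. \<Prod>i\<in>A. exp (X i \<omega>)) / exp s"
    by (intro integral_Markov_inequality_measure[OF int, where A = "{}"]) (auto intro!: AE_I2 prod_nonneg)
  also have "expectation (\<lambda>\<omega>. \<Prod>i\<in>A. exp (X i \<omega>)) = (\<Prod>i\<in>A. expectation (\<lambda>\<omega>. exp (X i \<omega>)))"
    by (rule indep_vars_lebesgue_integral[OF assms(1) ind assms(3)])
  finally show ?thesis by (simp add: exp_minus field_simps)
qed

locale fpp = prob_space M
  for M :: "'w measure" +
  fixes \<tau> :: "(int ^ 'd::finite) set \<Rightarrow> 'w \<Rightarrow> real" and r \<alpha> \<beta>\<^sub>1 \<beta>\<^sub>2 :: real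
  assumes indep: "indep_vars (\<lambda>_. borel) \<tau> lattice_edges"
    and ident: "\<And>e e'. e \<in> lattice_edges \<Longrightarrow> e' \<in> lattice_edges \<Longrightarrow>
      distr M borel (\<tau> e) = distr M borel (\<tau> e')"
    and nonneg: "\<And>e \<omega>. e \<in> lattice_edges \<Longrightarrow> \<omega> \<in> space M \<Longrightarrow> \<tau> e \<omega> \<ge> 0"
    and dim: "CARD('d) \<ge> 2" and r_gt_1: "1 < r" and r_less_dim: "r < real CARD('d)"
    and \<beta>\<^sub>1_pos: "\<beta>\<^sub>1 > 0" and \<beta>\<^sub>2_pos: "\<beta>\<^sub>2 > 0" and \<alpha>_pos: "\<alpha> > 0"
    and tail_ge: "\<And>e t. e \<in> lattice_edges \<Longrightarrow> t \<ge> 0 \<Longrightarrow>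
      \<beta>\<^sub>1 * exp (- \<alpha> * t powr r) \<le> prob {\<omega> \<in> space M. \<tau> e \<omega> > t}"
    and tail_le: "\<And>e t. e \<in> lattice_edges \<Longrightarrow> t \<ge> 0 \<Longrightarrow>
      prob {\<omega> \<in> space M. \<tau> e \<omega> > t} \<le> \<beta>\<^sub>2 * exp (- \<alpha> * t powr r)"
begin

definition T :: "int ^ 'd \<Rightarrow> int ^ 'd \<Rightarrow> 'w \<Rightarrow> real" where
  "T u v \<omega> = passage_time (\<lambda>e. \<tau> e \<omega>) u v"

lemma \<tau>_measurable [measurable]: "e \<in> lattice_edges \<Longrightarrow> \<tau> e \<in> borel_measurable M"
  using indep by (simp add: indep_vars_def)

lemma nonneg_weights_\<tau>: "\<omega> \<in> space M \<Longrightarrow> nonneg_weights (\<lambda>e. \<tau> e \<omega>)"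
  by (simp add: nonneg_weights_def nonneg)

lemma T_measurable [measurable]: "T u v \<in> borel_measurable M"
  unfolding T_def[abs_def] by measurable

lemma T_nonneg: "\<omega> \<in> space M \<Longrightarrow> 0 \<le> T u v \<omega>"
  by (simp add: T_def passage_time_nonneg nonneg_weights_\<tau>)

lemma T_triangle: "\<omega> \<in> space M \<Longrightarrow> T u w \<omega> \<le> T u v \<omega> + T v w \<omega>"
  by (simp add: T_def passage_time_triangle nonneg_weights_\<tau>)

lemma indep_subset: "A \<subseteq> lattice_edges \<Longrightarrow> indep_vars (\<lambda>_. borel) \<tau> A"
  using indep by (rule indep_vars_subset)

subsection \<open>Translation invariance of the law\<close>

text \<open>By independence both sides are product measures, and by the common law of the weights
  their factors agree.\<close>

lemma translate_law:
  "distr M (PiM lattice_edges (\<lambda>_. borel)) (\<lambda>\<omega>. \<lambda>e\<in>lattice_edges. \<tau> e \<omega>) =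
   distr M (PiM lattice_edges (\<lambda>_. borel)) (\<lambda>\<omega>. \<lambda>e\<in>lattice_edges. \<tau> ((+) a ` e) \<omega>)"
proof -
  let ?L = "lattice_edges :: (int ^ 'd) set set"
  have ne: "?L \<noteq> {}" using line_edge_in_lattice_edges by blast
  have "indep_vars (\<lambda>_. borel) (\<lambda>e. \<tau> ((+) a ` e)) ?L"
  proof -
    have "indep_vars (\<lambda>j. PiM {(+) a ` j} (\<lambda>_. borel))
      (\<lambda>j \<omega>. restrict (\<lambda>i. \<tau> i \<omega>) {(+) a ` j}) ?L"
      by (rule indep_vars_restrict[OF indep])
        (auto simp: disjoint_family_on_def inj_image_eq_iff)
    then have "indep_vars (\<lambda>_. borel) (\<lambda>j \<omega>. (restrict (\<lambda>i. \<tau> i \<omega>) {(+) a ` j}) ((+) a ` j)) ?L"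
      by (rule indep_vars_compose2[where Y = "\<lambda>j x. x ((+) a ` j)"]) (auto intro: measurable_component_singleton)
    then show ?thesis by simp
  qed
  then have "distr M (PiM ?L (\<lambda>_. borel)) (\<lambda>\<omega>. \<lambda>e\<in>?L. \<tau> ((+) a ` e) \<omega>) =
    PiM ?L (\<lambda>e. distr M borel (\<tau> ((+) a ` e)))"
    using ne by (subst (asm) indep_vars_iff_distr_eq_PiM') auto
  also have "\<dots> = PiM ?L (\<lambda>e. distr M borel (\<tau> e))"
    by (intro PiM_cong refl ident) auto
  also have "\<dots> = distr M (PiM ?L (\<lambda>_. borel)) (\<lambda>\<omega>. \<lambda>e\<in>?L. \<tau> e \<omega>)"
    using ne indep by (subst (asm) indep_vars_iff_distr_eq_PiM') auto
  finally show ?thesis by simp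
qed

text \<open>The product space consists of families restricted to \<open>lattice_edges\<close>; the
  condition \<open>cong\<close> allows g to be applied to unrestricted ones.\<close>

lemma translate_distr:
  assumes [measurable]: "g \<in> borel_measurable (PiM lattice_edges (\<lambda>_. borel))"
    and cong: "\<And>x y. (\<And>e. e \<in> lattice_edges \<Longrightarrow> x e = y e) \<Longrightarrow> g x = (g y :: real)"
  shows "distr M borel (\<lambda>\<omega>. g (\<lambda>e. \<tau> e \<omega>)) = distr M borel (\<lambda>\<omega>. g (\<lambda>e. \<tau> ((+) a ` e) \<omega>))"
proof -
  have *: "distr M borel (\<lambda>\<omega>. g (\<lambda>e. \<sigma> e \<omega>)) =
    distr (distr M (PiM lattice_edges (\<lambda>_. borel)) (\<lambda>\<omega>. \<lambda>e\<in>lattice_edges. \<sigma> e \<omega>)) borel g"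
    if [measurable]: "\<And>e. e \<in> lattice_edges \<Longrightarrow> \<sigma> e \<in> borel_measurable M" for \<sigma>
  proof -
    have "g (\<lambda>e. \<sigma> e \<omega>) = g (\<lambda>e\<in>lattice_edges. \<sigma> e \<omega>)" for \<omega> by (rule cong) simp
    then show ?thesis by (subst distr_distr) (auto simp: comp_def)
  qed
  show ?thesis using *[of \<tau>] *[of "\<lambda>e. \<tau> ((+) a ` e)"] translate_law[of a] by simp
qed

lemma T_translate_distr: "distr M borel (T (a + u) (a + v)) = distr M borel (T u v)"
proof -
  have "distr M borel (\<lambda>\<omega>. passage_time (\<lambda>e. \<tau> e \<omega>) u v) =
    distr M borel (\<lambda>\<omega>. passage_time (\<lambda>e. \<tau> ((+) a ` e) \<omega>) u v)"
    by (rule translate_distr[where g = "\<lambda>x. passage_time x u v"])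
      (auto intro: passage_time_cong measurable_component_singleton)
  then show ?thesis by (simp add: T_def[abs_def] passage_time_translate)
qed

lemma expectation_T_translate: "expectation (T (a + u) (a + v)) = expectation (T u v)"
proof -
  have "expectation (T w z) = integral\<^sup>L (distr M borel (T w z)) (\<lambda>x. x)" for w z
    by (subst integral_distr) auto
  then show ?thesis by (simp add: T_translate_distr)
qed

subsection \<open>Exponential moments\<close>

lemma
  assumes "e \<in> lattice_edges" "e' \<in> lattice_edges" and [measurable]: "f \<in> borel_measurable borel"
  shows expectation_edge_eq: "expectation (\<lambda>\<omega>. f (\<tau> e \<omega>) :: real) = expectation (\<lambda>\<omega>. f (\<tau> e' \<omega>))"
    and integrable_edge_iff: "integrable M (\<lambda>\<omega>. f (\<tau> e \<omega>)) \<longleftrightarrow> integrable M (\<lambda>\<omega>. f (\<tau> e' \<omega>))"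
proof -
  have [measurable]: "\<tau> e \<in> borel_measurable M" "\<tau> e' \<in> borel_measurable M" using assms by simp_all
  show "expectation (\<lambda>\<omega>. f (\<tau> e \<omega>)) = expectation (\<lambda>\<omega>. f (\<tau> e' \<omega>))"
    using ident[OF assms(1,2)] integral_distr[of "\<tau> e" M borel f] integral_distr[of "\<tau> e'" M borel f]
    by simp
  show "integrable M (\<lambda>\<omega>. f (\<tau> e \<omega>)) \<longleftrightarrow> integrable M (\<lambda>\<omega>. f (\<tau> e' \<omega>))"
    using ident[OF assms(1,2)] integrable_distr_eq[of "\<tau> e" M borel f]
      integrable_distr_eq[of "\<tau> e'" M borel f] by simp
qed

text \<open>The moment is compared with a sum over unit layers of \<open>\<tau> e powr r\<close>.
  The tail bound turns it into a geometric series of ratio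
  \<open>exp (\<gamma> - \<alpha>)\<close>.\<close>

lemma integrable_exp_powr:
  assumes e: "e \<in> lattice_edges" and \<gamma>: "0 \<le> \<gamma>" "\<gamma> < \<alpha>"
  shows "integrable M (\<lambda>\<omega>. exp (\<gamma> * \<tau> e \<omega> powr r))"
proof (rule integrableI_bounded)
  note [measurable] = \<tau>_measurable[OF e]
  show "(\<lambda>\<omega>. exp (\<gamma> * \<tau> e \<omega> powr r)) \<in> borel_measurable M" by measurable
  define A where "A k = {\<omega> \<in> space M. real k < \<tau> e \<omega> powr r}" for k
  have [measurable]: "A k \<in> sets M" for k unfolding A_def by measurable
  have prob_A: "prob (A k) \<le> \<beta>\<^sub>2 * exp (- \<alpha> * k)" for k
  proof -
    have "A k = {\<omega> \<in> space M. \<tau> e \<omega> > real k powr (1 / r)}"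
    proof -
      have "real k < t powr r \<longleftrightarrow> t > real k powr (1 / r)" if "0 \<le> t" for t
      proof
        assume "real k < t powr r"
        then have "real k powr (1 / r) < (t powr r) powr (1 / r)"
          using r_gt_1 by (intro powr_less_mono2) auto
        then show "t > real k powr (1 / r)" using that r_gt_1 by (simp add: powr_powr)
      next
        assume "t > real k powr (1 / r)"
        then have "(real k powr (1 / r)) powr r < t powr r"
          using r_gt_1 by (intro powr_less_mono2) auto
        then show "real k < t powr r" using r_gt_1 by (simp add: powr_powr)
      qed
      then show ?thesis using nonneg[OF e] by (auto simp: A_def)
    qed
    then have "prob (A k) \<le> \<beta>\<^sub>2 * exp (- \<alpha> * (real k powr (1 / r)) powr r)"
      using tail_le[OF e, of "real k powr (1 / r)"] by simp
    then show ?thesis using r_gt_1 by (simp add: powr_powr)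
  qed
  have "(\<integral>\<^sup>+\<omega>. ennreal (norm (exp (\<gamma> * \<tau> e \<omega> powr r))) \<partial>M) \<le>
    (\<integral>\<^sup>+\<omega>. 1 + (\<Sum>k. ennreal (exp (\<gamma> * (real k + 1))) * indicator (A k) \<omega>) \<partial>M)"
  proof (rule nn_integral_mono)
    fix \<omega> assume \<omega>: "\<omega> \<in> space M"
    let ?x = "\<tau> e \<omega> powr r" and ?f = "\<lambda>k. ennreal (exp (\<gamma> * (real k + 1))) * indicator (A k) \<omega>"
    show "ennreal (norm (exp (\<gamma> * ?x))) \<le> 1 + (\<Sum>k. ?f k)"
    proof (cases "?x = 0")
      case False
      then have x: "0 < ?x" by (simp add: less_le)
      \<comment> \<open>The layer with \<open>k < ?x \<le> k + 1\<close>, open below to match the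
        strict inequality in the tail bound; the value \<open>?x = 0\<close> lies in no layer and is
        covered by the summand 1.\<close>
      define k where "k = nat (\<lceil>?x\<rceil> - 1)"
      have k: "real k < ?x" "?x \<le> real k + 1"
        using x unfolding k_def by (auto simp: of_nat_nat) linarith+
      have "ennreal (norm (exp (\<gamma> * ?x))) \<le> ?f k"
        using k \<omega> \<gamma> by (auto simp: A_def intro!: ennreal_leI mult_left_mono)
      also have "?f k = sum ?f {k}"
        by (simp only: sum.insert finite.emptyI empty_iff not_False_eq_True sum.empty add_0_right)
      also have "\<dots> \<le> (\<Sum>k. ?f k)" by (rule sum_le_suminf) auto
      also have "\<dots> \<le> 1 + (\<Sum>k. ?f k)" by simp
      finally show ?thesis .
    qed simp
  qed
  also have "\<dots> = 1 + (\<Sum>k. \<integral>\<^sup>+\<omega>. ennreal (exp (\<gamma> * (real k + 1))) * indicator (A k) \<omega> \<partial>M)"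
    by (subst nn_integral_add) (auto simp: nn_integral_suminf emeasure_space_1)
  also have "(\<Sum>k. \<integral>\<^sup>+\<omega>. ennreal (exp (\<gamma> * (real k + 1))) * indicator (A k) \<omega> \<partial>M) \<le>
    (\<Sum>k. ennreal (\<beta>\<^sub>2 * exp \<gamma> * exp (\<gamma> - \<alpha>) ^ k))"
  proof (rule suminf_le)
    fix k
    have "(\<integral>\<^sup>+\<omega>. ennreal (exp (\<gamma> * (real k + 1))) * indicator (A k) \<omega> \<partial>M) =
      ennreal (exp (\<gamma> * (real k + 1)) * prob (A k))"
      by (simp add: nn_integral_cmult emeasure_eq_measure ennreal_mult)
    also have "\<dots> \<le> ennreal (exp (\<gamma> * (real k + 1)) * (\<beta>\<^sub>2 * exp (- \<alpha> * k)))"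
      by (intro ennreal_leI mult_left_mono prob_A) auto
    also have "exp (\<gamma> * (real k + 1)) * (\<beta>\<^sub>2 * exp (- \<alpha> * k)) = \<beta>\<^sub>2 * exp \<gamma> * exp (\<gamma> - \<alpha>) ^ k"
    proof -
      have "exp (\<gamma> * (real k + 1)) * exp (- \<alpha> * k) = exp \<gamma> * exp (real k * (\<gamma> - \<alpha>))"
        unfolding exp_add[symmetric] by (simp add: algebra_simps)
      then show ?thesis by (simp add: exp_of_nat_mult mult.left_commute)
    qed
    finally show "(\<integral>\<^sup>+\<omega>. ennreal (exp (\<gamma> * (real k + 1))) * indicator (A k) \<omega> \<partial>M) \<le>
      ennreal (\<beta>\<^sub>2 * exp \<gamma> * exp (\<gamma> - \<alpha>) ^ k)" .
  qed auto
  also have "1 + (\<Sum>k. ennreal (\<beta>\<^sub>2 * exp \<gamma> * exp (\<gamma> - \<alpha>) ^ k)) < \<infinity>"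
  proof -
    have "(\<Sum>k. ennreal (\<beta>\<^sub>2 * exp \<gamma> * exp (\<gamma> - \<alpha>) ^ k)) \<noteq> top"
      using \<beta>\<^sub>2_pos \<gamma> by (intro ennreal_suminf_neq_top summable_mult summable_geometric) auto
    then show ?thesis by (simp add: less_top)
  qed
  finally show "(\<integral>\<^sup>+\<omega>. ennreal (norm (exp (\<gamma> * \<tau> e \<omega> powr r))) \<partial>M) < \<infinity>" by (simp add: add_left_mono)
qed

text \<open>A fixed edge representing the common law; \<open>undefined\<close> is just some
  direction.\<close>

definition ref_edge :: "(int ^ 'd) set" where
  "ref_edge = line_edge 0 undefined 0"

lemma ref_edge [simp]: "ref_edge \<in> lattice_edges"
  by (simp add: ref_edge_def)

definition exp_moment :: "real \<Rightarrow> real" where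
  "exp_moment \<gamma> = expectation (\<lambda>\<omega>. exp (\<gamma> * \<tau> ref_edge \<omega> powr r))"

lemma exp_moment_eq: "e \<in> lattice_edges \<Longrightarrow> expectation (\<lambda>\<omega>. exp (\<gamma> * \<tau> e \<omega> powr r)) = exp_moment \<gamma>"
  unfolding exp_moment_def by (rule expectation_edge_eq[where f = "\<lambda>t. exp (\<gamma> * t powr r)"]) auto

lemma exp_moment_ge_1:
  assumes "0 \<le> \<gamma>" "\<gamma> < \<alpha>"
  shows "1 \<le> exp_moment \<gamma>"
proof -
  have "expectation (\<lambda>_. 1) \<le> exp_moment \<gamma>" unfolding exp_moment_def
    using assms by (intro integral_mono integrable_exp_powr) auto
  then show ?thesis by (simp add: prob_space)
qed

text \<open>Exponential moments of \<open>\<tau> powr r\<close> at \<gamma> close to \<alpha>. In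
  the upper bound this is the estimate that fixes the constant; the others only have to be small
  enough.\<close>

lemma sum_powr_tail:
  assumes "finite A" "A \<subseteq> lattice_edges" "0 \<le> \<gamma>" "\<gamma> < \<alpha>"
  shows "prob {\<omega> \<in> space M. s \<le> (\<Sum>e\<in>A. \<tau> e \<omega> powr r)} \<le> exp_moment \<gamma> ^ card A * exp (- \<gamma> * s)"
proof -
  have "prob {\<omega> \<in> space M. s \<le> (\<Sum>e\<in>A. \<tau> e \<omega> powr r)} \<le>
    prob {\<omega> \<in> space M. \<gamma> * s \<le> (\<Sum>e\<in>A. \<gamma> * \<tau> e \<omega> powr r)}"
  proof (rule finite_measure_mono)
    have [measurable]: "(\<lambda>\<omega>. \<Sum>e\<in>A. \<gamma> * \<tau> e \<omega> powr r) \<in> borel_measurable M"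
    proof (rule borel_measurable_sum)
      fix e assume "e \<in> A"
      then have [measurable]: "\<tau> e \<in> borel_measurable M" using assms(2) by auto
      show "(\<lambda>\<omega>. \<gamma> * \<tau> e \<omega> powr r) \<in> borel_measurable M" by measurable
    qed
    show "{\<omega> \<in> space M. \<gamma> * s \<le> (\<Sum>e\<in>A. \<gamma> * \<tau> e \<omega> powr r)} \<in> sets M" by measurable
  qed (use assms(3) in \<open>auto simp: sum_distrib_left[symmetric] intro: mult_left_mono\<close>)
  also have "\<dots> \<le> exp (- (\<gamma> * s)) * (\<Prod>e\<in>A. expectation (\<lambda>\<omega>. exp (\<gamma> * \<tau> e \<omega> powr r)))"
    by (rule chernoff[OF assms(1)])
      (use assms in \<open>auto intro!: integrable_exp_powr indep_vars_compose2[OF indep_subset]\<close>)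
  also have "(\<Prod>e\<in>A. expectation (\<lambda>\<omega>. exp (\<gamma> * \<tau> e \<omega> powr r))) = (\<Prod>e\<in>A. exp_moment \<gamma>)"
    by (rule prod.cong) (use assms in \<open>auto intro: exp_moment_eq\<close>)
  finally show ?thesis by (simp add: mult.commute)
qed

text \<open>The first summand is the constant of \<open>young_powr\<close> at \<alpha> / 2, the
  second accounts for the exponential moment that is left over. The choice \<alpha> / 2 is one of
  many between 0 and \<alpha>.\<close>

definition mgf_const :: real where
  "mgf_const = (\<alpha> / 2) powr (- 1 / (r - 1)) + ln (exp_moment (\<alpha> / 2))"

lemma mgf_const_pos: "0 < mgf_const"
proof -
  have "0 \<le> ln (exp_moment (\<alpha> / 2))" using exp_moment_ge_1[of "\<alpha> / 2"] \<alpha>_pos by simp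
  moreover have "0 < (\<alpha> / 2) powr (- 1 / (r - 1))" using \<alpha>_pos by simp
  ultimately show ?thesis unfolding mgf_const_def by linarith
qed

text \<open>Young's inequality with a crude constant, by cases on the size of t: if
  \<open>h powr (r - 1) \<le> a * t powr (r - 1)\<close> the first term is enough, otherwise t is at
  most a multiple of h and the second one is.\<close>

lemma young_powr:
  assumes "0 \<le> t" "0 < h" "0 < a"
  shows "h powr (r - 1) * t \<le> a * t powr r + a powr (- 1 / (r - 1)) * h powr r"
proof (cases "h powr (r - 1) \<le> a * t powr (r - 1)")
  case True
  then have "h powr (r - 1) * t \<le> a * t powr (r - 1) * t" using assms by (intro mult_right_mono) auto
  also have "\<dots> = a * t powr r"
    using assms powr_add[of t "r - 1" 1] by (cases "t = 0") auto
  also have "\<dots> \<le> a * t powr r + a powr (- 1 / (r - 1)) * h powr r" by simp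
  finally show ?thesis .
next
  case False
  then have "t powr (r - 1) \<le> h powr (r - 1) / a" using assms by (simp add: field_simps)
  then have "(t powr (r - 1)) powr (1 / (r - 1)) \<le> (h powr (r - 1) / a) powr (1 / (r - 1))"
    using r_gt_1 by (intro powr_mono2) auto
  also have "\<dots> = (h powr (r - 1)) powr (1 / (r - 1)) / a powr (1 / (r - 1))"
    by (rule powr_divide)
  finally have "t \<le> a powr (- 1 / (r - 1)) * h"
    using assms r_gt_1 powr_minus_divide[of a "1 / (r - 1)"] by (simp add: powr_powr)
  then have "h powr (r - 1) * t \<le> h powr (r - 1) * (a powr (- 1 / (r - 1)) * h)"
    by (intro mult_left_mono) auto
  also have "\<dots> = a powr (- 1 / (r - 1)) * h powr r"
    using assms powr_add[of h "r - 1" 1] by simp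
  also have "\<dots> \<le> a * t powr r + a powr (- 1 / (r - 1)) * h powr r" using assms by simp
  finally show ?thesis .
qed

text \<open>The tilt \<open>h powr (r - 1)\<close> is conjugate to the tail: it favours weights of
  order h, at a cost of order \<open>h powr r\<close>. The condition \<open>1 \<le> h\<close> allows
  the constant factor \<open>exp_moment (\<alpha> / 2)\<close> to be absorbed into the
  exponent.\<close>

lemma
  assumes e: "e \<in> lattice_edges" and h: "1 \<le> h"
  shows integrable_exp_edge: "integrable M (\<lambda>\<omega>. exp (h powr (r - 1) * \<tau> e \<omega>))"
    and mgf_le: "expectation (\<lambda>\<omega>. exp (h powr (r - 1) * \<tau> e \<omega>)) \<le> exp (mgf_const * h powr r)"
proof -
  note [measurable] = \<tau>_measurable[OF e]
  let ?A = "(\<alpha> / 2) powr (- 1 / (r - 1))" and ?K = "exp_moment (\<alpha> / 2)"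
  have le: "exp (h powr (r - 1) * \<tau> e \<omega>) \<le> exp (?A * h powr r) * exp (\<alpha> / 2 * \<tau> e \<omega> powr r)"
    if "\<omega> \<in> space M" for \<omega>
    using young_powr[of "\<tau> e \<omega>" h "\<alpha> / 2"] nonneg[OF e that] h \<alpha>_pos
    by (simp add: exp_add[symmetric] add.commute)
  have int: "integrable M (\<lambda>\<omega>. exp (?A * h powr r) * exp (\<alpha> / 2 * \<tau> e \<omega> powr r))"
    using \<alpha>_pos by (intro integrable_mult_right integrable_exp_powr e) auto
  show int': "integrable M (\<lambda>\<omega>. exp (h powr (r - 1) * \<tau> e \<omega>))"
  proof (rule Bochner_Integration.integrable_bound[OF int])
    show "AE \<omega> in M. norm (exp (h powr (r - 1) * \<tau> e \<omega>)) \<le>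
      norm (exp (?A * h powr r) * exp (\<alpha> / 2 * \<tau> e \<omega> powr r))"
      by (rule AE_I2) (use le in \<open>simp only: real_norm_def abs_mult abs_exp_cancel\<close>)
  qed simp
  have K: "1 \<le> ?K" using exp_moment_ge_1[of "\<alpha> / 2"] \<alpha>_pos by simp
  have "expectation (\<lambda>\<omega>. exp (h powr (r - 1) * \<tau> e \<omega>)) \<le>
    expectation (\<lambda>\<omega>. exp (?A * h powr r) * exp (\<alpha> / 2 * \<tau> e \<omega> powr r))"
    by (intro integral_mono int int' le)
  also have "\<dots> = exp (?A * h powr r) * ?K" using exp_moment_eq[OF e, of "\<alpha> / 2"] by simp
  also have "?K = exp (ln ?K)" using K by simp
  also have "ln ?K \<le> ln ?K * h powr r"
    using K h r_gt_1 ge_one_powr_ge_zero[of h r] by (intro mult_left_mono[of 1 _ "ln ?K", simplified]) auto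
  finally show "expectation (\<lambda>\<omega>. exp (h powr (r - 1) * \<tau> e \<omega>)) \<le> exp (mgf_const * h powr r)"
    by (simp add: mgf_const_def exp_add distrib_right)
qed

lemma integrable_edge: "e \<in> lattice_edges \<Longrightarrow> integrable M (\<tau> e)"
  and integrable_edge_square: "e \<in> lattice_edges \<Longrightarrow> integrable M (\<lambda>\<omega>. (\<tau> e \<omega>)\<^sup>2)"
proof -
  assume e: "e \<in> lattice_edges"
  note [measurable] = \<tau>_measurable[OF e]
  have int: "integrable M (\<lambda>\<omega>. exp (\<tau> e \<omega>))" using integrable_exp_edge[OF e, of 1] by simp
  show "integrable M (\<tau> e)"
  proof (rule Bochner_Integration.integrable_bound[OF int])
    show "AE \<omega> in M. norm (\<tau> e \<omega>) \<le> norm (exp (\<tau> e \<omega>))"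
    proof (rule AE_I2)
      fix \<omega> assume "\<omega> \<in> space M"
      moreover have "\<tau> e \<omega> \<le> exp (\<tau> e \<omega>)" by (rule order_trans[OF _ exp_ge_add_one_self]) simp
      ultimately show "norm (\<tau> e \<omega>) \<le> norm (exp (\<tau> e \<omega>))" using nonneg[OF e] by simp
    qed
  qed simp
  show "integrable M (\<lambda>\<omega>. (\<tau> e \<omega>)\<^sup>2)"
  proof (rule Bochner_Integration.integrable_bound[where f = "\<lambda>\<omega>. 2 * exp (\<tau> e \<omega>)"])
    show "AE \<omega> in M. norm ((\<tau> e \<omega>)\<^sup>2) \<le> norm (2 * exp (\<tau> e \<omega>))"
    proof (rule AE_I2)
      fix \<omega> assume "\<omega> \<in> space M"
      then show "norm ((\<tau> e \<omega>)\<^sup>2) \<le> norm (2 * exp (\<tau> e \<omega>))"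
        using nonneg[OF e, of \<omega>] exp_lower_Taylor_quadratic[of "\<tau> e \<omega>"] by simp
    qed
  qed (use int in auto)
qed

subsection \<open>Tail estimates\<close>

definition line_edges :: "('d \<Rightarrow> int set) \<Rightarrow> 'd \<Rightarrow> int \<Rightarrow> int \<Rightarrow> (int ^ 'd) set set" where
  "line_edges C b lo hi = (\<lambda>(c, j). line_edge c b j) ` (grid_base C b \<times> {lo..<hi})"

lemma line_average_eq:
  "line_average \<sigma> C b lo hi = (\<Sum>e\<in>line_edges C b lo hi. \<sigma> e) / card (grid_base C b)"
proof -
  have "inj_on (\<lambda>(c, j). line_edge c b j) (grid_base C b \<times> {lo..<hi})"
    by (rule inj_on_subset[OF inj_line_edge]) auto
  then show ?thesis
    unfolding line_average_def average_def line_edges_def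
    by (simp add: sum.reindex sum.cartesian_product split_def)
qed

lemma card_line_edges:
  fixes lo hi :: int
  assumes "lo \<le> hi"
  shows "real (card (line_edges C b lo hi)) = card (grid_base C b) * (hi - lo)"
proof -
  have "inj_on (\<lambda>(c, j). line_edge c b j) (grid_base C b \<times> {lo..<hi})"
    by (rule inj_on_subset[OF inj_line_edge]) auto
  then have "card (line_edges C b lo hi) = card (grid_base C b) * nat (hi - lo)"
    unfolding line_edges_def by (simp add: card_image card_cartesian_product)
  then show ?thesis using \<open>lo \<le> hi\<close> by simp
qed

lemma line_edges_subset: "line_edges C b lo hi \<subseteq> lattice_edges"
  by (auto simp: line_edges_def)

lemma line_average_measurable [measurable]:
  "(\<lambda>\<omega>. line_average (\<lambda>e. \<tau> e \<omega>) C b lo hi) \<in> borel_measurable M"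
  unfolding line_average_eq using subsetD[OF line_edges_subset]
  by (intro borel_measurable_divide borel_measurable_sum) auto

text \<open>Every edge is tilted by \<open>h powr (r - 1)\<close>. The condition on s says that the
  logarithmic moment of all \<open>card (grid_base C b) * (hi - lo)\<close> edges uses up at most
  half of the exponent. Later h = 1 on cubes of size comparable to n, while small cubes need large
  h.\<close>

lemma line_average_tail:
  assumes C: "\<And>j. finite (C j)" "\<And>j. C j \<noteq> {}" and "lo \<le> hi" "1 \<le> h"
    and s: "2 * mgf_const * (hi - lo) * h \<le> s"
  shows "prob {\<omega> \<in> space M. s \<le> line_average (\<lambda>e. \<tau> e \<omega>) C b lo hi} \<le>
    exp (- (card (grid_base C b) * h powr (r - 1) * s / 2))"
proof -
  let ?N = "card (grid_base C b)" and ?g = "h powr (r - 1)" and ?E = "line_edges C b lo hi"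
  have fin: "finite (grid_base C b)" using C by (intro finite_grid) auto
  have "grid_base C b \<noteq> {}" using C by (intro grid_nonempty) auto
  with fin have N: "0 < real ?N" by (simp add: card_gt_0_iff)
  have E: "finite ?E" "?E \<subseteq> lattice_edges"
    using fin line_edges_subset by (auto simp: line_edges_def)
  have g: "0 < ?g" using \<open>1 \<le> h\<close> by simp
  have "{\<omega> \<in> space M. s \<le> line_average (\<lambda>e. \<tau> e \<omega>) C b lo hi} =
    {\<omega> \<in> space M. ?g * (?N * s) \<le> (\<Sum>e\<in>?E. ?g * \<tau> e \<omega>)}"
    unfolding line_average_eq sum_distrib_left[symmetric] mult_le_cancel_left_pos[OF g]
    using N by (simp add: pos_le_divide_eq mult.commute)
  also have "prob \<dots> \<le> exp (- (?g * (?N * s))) * (\<Prod>e\<in>?E. expectation (\<lambda>\<omega>. exp (?g * \<tau> e \<omega>)))"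
    by (rule chernoff[OF E(1)])
      (use E \<open>1 \<le> h\<close> in \<open>auto intro!: integrable_exp_edge indep_vars_compose2[OF indep_subset]\<close>)
  also have "(\<Prod>e\<in>?E. expectation (\<lambda>\<omega>. exp (?g * \<tau> e \<omega>))) \<le> (\<Prod>e\<in>?E. exp (mgf_const * h powr r))"
    by (intro prod_mono conjI mgf_le \<open>1 \<le> h\<close>) (use E in auto)
  also have "\<dots> = exp (real (card ?E) * (mgf_const * h powr r))" by (simp add: exp_of_nat_mult)
  also have "exp (- (?g * (?N * s))) * \<dots> = exp (?N * (mgf_const * (hi - lo) * h powr r - ?g * s))"
    using \<open>lo \<le> hi\<close> by (simp add: card_line_edges exp_add[symmetric] algebra_simps)
  also have "\<dots> \<le> exp (- (?N * ?g * s / 2))"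
  proof -
    have "h powr r = ?g * h" using powr_add[of h "r - 1" 1] \<open>1 \<le> h\<close> by simp
    then have "mgf_const * (hi - lo) * h powr r = ?g * (2 * mgf_const * (hi - lo) * h) / 2" by simp
    also have "\<dots> \<le> ?g * s / 2" using s g by (intro divide_right_mono mult_left_mono) auto
    finally have "mgf_const * (hi - lo) * h powr r - ?g * s \<le> - (?g * s / 2)" by simp
    then have "?N * (mgf_const * (hi - lo) * h powr r - ?g * s) \<le> ?N * - (?g * s / 2)"
      by (intro mult_left_mono) auto
    then show ?thesis by (simp add: algebra_simps)
  qed
  finally show ?thesis by (simp add: mult_left_mono)
qed

text \<open>Independence for each J and a union over all of them. The crude count
  \<open>2 ^ card B\<close> is a constant once B is a box of fixed size.\<close>

lemma many_large_edges:
  assumes "finite B" "B \<subseteq> lattice_edges" "0 \<le> t"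
  shows "prob {\<omega> \<in> space M. \<exists>J\<subseteq>B. card J = L \<and> (\<forall>e\<in>J. t < \<tau> e \<omega>)} \<le>
    2 ^ card B * (\<beta>\<^sub>2 * exp (- \<alpha> * t powr r)) ^ L"
proof -
  let ?J = "{J. J \<subseteq> B \<and> card J = L}"
  have fin: "finite ?J" using assms(1) by (intro finite_subset[of ?J "Pow B"]) auto
  define A where "A J = {\<omega> \<in> space M. \<forall>e\<in>J. t < \<tau> e \<omega>}" for J
  have J: "finite J" "J \<subseteq> lattice_edges" if "J \<in> ?J" for J
    using that assms finite_subset by auto
  have meas: "A J \<in> sets M" if "J \<in> ?J" for J
    unfolding A_def
  proof (rule sets.sets_Collect_finite_All[OF _ J(1)[OF that]])
    fix e assume "e \<in> J"
    then have [measurable]: "\<tau> e \<in> borel_measurable M" using J(2)[OF that] by auto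
    show "{\<omega> \<in> space M. t < \<tau> e \<omega>} \<in> sets M" by measurable
  qed
  have "{\<omega> \<in> space M. \<exists>J\<subseteq>B. card J = L \<and> (\<forall>e\<in>J. t < \<tau> e \<omega>)} = (\<Union>J\<in>?J. A J)"
    by (auto simp: A_def)
  also have "prob \<dots> \<le> (\<Sum>J\<in>?J. prob (A J))"
    using meas by (intro finite_measure_subadditive_finite fin) auto
  also have "\<dots> \<le> (\<Sum>J\<in>?J. (\<beta>\<^sub>2 * exp (- \<alpha> * t powr r)) ^ L)"
  proof (rule sum_mono)
    fix J assume J': "J \<in> ?J"
    \<comment> \<open>The empty J, with L = 0, is treated apart: an intersection over no edges is
      the whole type and not \<open>space M\<close>.\<close>
    show "prob (A J) \<le> (\<beta>\<^sub>2 * exp (- \<alpha> * t powr r)) ^ L"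
    proof (cases "J = {}")
      case False
      have "A J = (\<Inter>e\<in>J. \<tau> e -` {t<..} \<inter> space M)" using False by (auto simp: A_def)
      also have "prob \<dots> = (\<Prod>e\<in>J. prob (\<tau> e -` {t<..} \<inter> space M))"
        using J[OF J'] False by (intro indep_varsD[OF indep]) auto
      also have "\<dots> \<le> (\<Prod>e\<in>J. \<beta>\<^sub>2 * exp (- \<alpha> * t powr r))"
      proof (intro prod_mono conjI measure_nonneg)
        fix e assume "e \<in> J"
        have "\<tau> e -` {t<..} \<inter> space M = {\<omega> \<in> space M. t < \<tau> e \<omega>}" by auto
        then show "prob (\<tau> e -` {t<..} \<inter> space M) \<le> \<beta>\<^sub>2 * exp (- \<alpha> * t powr r)"
          using tail_le[of e t] J[OF J'] \<open>e \<in> J\<close> assms(3) by auto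
      qed
      finally show ?thesis using J' by simp
    qed (use J' in auto)
  qed
  also have "\<dots> = card ?J * (\<beta>\<^sub>2 * exp (- \<alpha> * t powr r)) ^ L" by simp
  also have "\<dots> \<le> 2 ^ card B * (\<beta>\<^sub>2 * exp (- \<alpha> * t powr r)) ^ L"
  proof (rule mult_right_mono)
    have "card ?J \<le> card (Pow B)" using assms(1) by (intro card_mono) auto
    then show "real (card ?J) \<le> 2 ^ card B" using assms(1) by (simp add: card_Pow)
  qed (use \<beta>\<^sub>2_pos in simp)
  finally show ?thesis .
qed

end

section \<open>The time constant\<close>

text \<open>The edges of a path parallel to the axes, fixed before the weights, so that moments of
  the right-hand side can be computed. With a list, the count is the l1 distance without any
  discussion of repetitions.\<close>

lemma passage_time_le_sum_edges:
  fixes u v :: "int ^ 'd::finite"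
  obtains es where "length es = nat (l1_norm (v - u))" "set es \<subseteq> lattice_edges"
    "\<And>\<sigma>. nonneg_weights \<sigma> \<Longrightarrow> passage_time \<sigma> u v \<le> (\<Sum>e\<leftarrow>es. \<sigma> e)"
proof -
  have "\<forall>w. (\<forall>j. j \<notin> B \<longrightarrow> w $ j = u $ j) \<longrightarrow>
    (\<exists>es. length es = (\<Sum>j\<in>B. nat \<bar>w $ j - u $ j\<bar>) \<and> set es \<subseteq> lattice_edges \<and>
      (\<forall>\<sigma>. nonneg_weights \<sigma> \<longrightarrow> passage_time \<sigma> u w \<le> (\<Sum>e\<leftarrow>es. \<sigma> e)))"
    if "finite B" for B :: "'d set"
    using that
  proof (induction B)
    case empty
    show ?case
    proof (intro allI impI exI[of _ "[]"] conjI)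
      fix w and \<sigma> :: "(int ^ 'd) set \<Rightarrow> real"
      assume "\<forall>j. j \<notin> {} \<longrightarrow> w $ j = u $ j" "nonneg_weights \<sigma>"
      moreover from this have "w = u" by (simp add: vec_eq_iff)
      ultimately show "passage_time \<sigma> u w \<le> (\<Sum>e\<leftarrow>[]. \<sigma> e)" by simp
    qed auto
  next
    case (insert b B)
    show ?case
    proof (intro allI impI)
      fix w assume w: "\<forall>j. j \<notin> insert b B \<longrightarrow> w $ j = u $ j"
      define w' where "w' = set_coord w b (u $ b)"
      have "\<forall>j. j \<notin> B \<longrightarrow> w' $ j = u $ j" using w by (auto simp: w'_def)
      then obtain es where es: "length es = (\<Sum>j\<in>B. nat \<bar>w' $ j - u $ j\<bar>)" "set es \<subseteq> lattice_edges"
        "\<And>\<sigma>. nonneg_weights \<sigma> \<Longrightarrow> passage_time \<sigma> u w' \<le> (\<Sum>e\<leftarrow>es. \<sigma> e)"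
        using insert.IH by blast
      have eq: "(\<Sum>j\<in>B. nat \<bar>w' $ j - u $ j\<bar>) = (\<Sum>j\<in>B. nat \<bar>w $ j - u $ j\<bar>)"
        using insert.hyps by (intro sum.cong) (auto simp: w'_def)
      define lo hi where "lo = min (u $ b) (w $ b)" and "hi = max (u $ b) (w $ b)"
      let ?es = "es @ map (line_edge w b) [lo..hi - 1]"
      have "length ?es = (\<Sum>j\<in>insert b B. nat \<bar>w $ j - u $ j\<bar>)"
        using insert.hyps es(1) eq by (simp add: lo_def hi_def)
      moreover have "set ?es \<subseteq> lattice_edges" using es(2) by auto
      moreover have "passage_time \<sigma> u w \<le> (\<Sum>e\<leftarrow>?es. \<sigma> e)" if \<sigma>: "nonneg_weights \<sigma>" for \<sigma>
      proof -
        have "passage_time \<sigma> u w \<le> passage_time \<sigma> u w' + passage_time \<sigma> w' w"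
          by (rule passage_time_triangle[OF \<sigma>])
        also have "passage_time \<sigma> w' w \<le> (\<Sum>j\<in>{lo..<hi}. \<sigma> (line_edge w b j))"
          using passage_time_line[OF \<sigma>, of "u $ b" lo hi "w $ b" w b]
          by (simp add: w'_def lo_def hi_def)
        also have "(\<Sum>j\<in>{lo..<hi}. \<sigma> (line_edge w b j)) = (\<Sum>j\<in>set [lo..hi - 1]. \<sigma> (line_edge w b j))"
          by (rule sum.cong) auto
        also have "\<dots> = (\<Sum>e\<leftarrow>map (line_edge w b) [lo..hi - 1]. \<sigma> e)"
          using sum_list_distinct_conv_sum_set[of "[lo..hi - 1]" "\<lambda>j. \<sigma> (line_edge w b j)"]
          by (simp add: comp_def)
        finally show ?thesis using es(3)[OF \<sigma>] by simp
      qed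
      ultimately show "\<exists>es. length es = (\<Sum>j\<in>insert b B. nat \<bar>w $ j - u $ j\<bar>) \<and>
        set es \<subseteq> lattice_edges \<and> (\<forall>\<sigma>. nonneg_weights \<sigma> \<longrightarrow> passage_time \<sigma> u w \<le> (\<Sum>e\<leftarrow>es. \<sigma> e))"
        by blast
    qed
  qed
  from this[of UNIV] have "\<exists>es. length es = (\<Sum>j\<in>UNIV. nat \<bar>v $ j - u $ j\<bar>) \<and> set es \<subseteq> lattice_edges \<and>
      (\<forall>\<sigma>. nonneg_weights \<sigma> \<longrightarrow> passage_time \<sigma> u v \<le> (\<Sum>e\<leftarrow>es. \<sigma> e))" by simp
  then obtain es where es: "length es = (\<Sum>j\<in>UNIV. nat \<bar>v $ j - u $ j\<bar>)"
    "set es \<subseteq> lattice_edges" "\<And>\<sigma>. nonneg_weights \<sigma> \<Longrightarrow> passage_time \<sigma> u v \<le> (\<Sum>e\<leftarrow>es. \<sigma> e)"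
    by blast
  have "(\<Sum>j\<in>UNIV. nat \<bar>v $ j - u $ j\<bar>) = nat (l1_norm (v - u))"
  proof -
    have "int (\<Sum>j\<in>UNIV. nat \<bar>v $ j - u $ j\<bar>) = l1_norm (v - u)" by (simp add: l1_norm_def)
    then show ?thesis by linarith
  qed
  with es show ?thesis using that[of es] by simp
qed

lemma l1_norm_nonneg: "0 \<le> l1_norm v"
  by (simp add: l1_norm_def sum_nonneg)

lemma l1_norm_le: "l1_norm (v :: int ^ 'd::finite) \<le> int CARD('d) * linf_norm v"
  unfolding l1_norm_def using sum_bounded_above[of UNIV "\<lambda>i. \<bar>v $ i\<bar>" "linf_norm v"]
  by (simp add: abs_nth_le_linf_norm)

text \<open>Fekete's argument for a real parameter: adding c to f makes it subadditive, and t is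
  split into a multiple of a fixed s and a remainder, which the linear bound controls.\<close>

lemma subadditive_limit:
  fixes f :: "real \<Rightarrow> real"
  assumes nonneg: "\<And>t. 0 \<le> t \<Longrightarrow> 0 \<le> f t"
    and bound: "\<And>t. 0 \<le> t \<Longrightarrow> f t \<le> C * (t + 1)"
    and sub: "\<And>s t. 0 \<le> s \<Longrightarrow> 0 \<le> t \<Longrightarrow> f (s + t) \<le> f s + f t + c" and "0 \<le> c"
  obtains L where "((\<lambda>t. f t / t) \<longlongrightarrow> L) at_top"
proof -
  define g where "g t = f t + c" for t
  define L where "L = (INF t\<in>{0<..}. g t / t)"
  have C: "0 \<le> C" using nonneg[of 0] bound[of 0] by simp
  have g0: "0 \<le> g t" if "0 \<le> t" for t using nonneg[OF that] \<open>0 \<le> c\<close> by (simp add: g_def)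
  have bdd: "bdd_below ((\<lambda>t. g t / t) ` {0<..})"
  proof (rule bdd_belowI2)
    show "0 \<le> g t / t" if "t \<in> {0<..}" for t using g0[of t] that by simp
  qed
  have gmult: "g (real k * s + t) \<le> real k * g s + g t" if "0 \<le> s" "0 \<le> t" for k s t
  proof (induction k)
    case (Suc k)
    have "g (real (Suc k) * s + t) = g (s + (real k * s + t))" by (simp add: algebra_simps)
    also have "\<dots> \<le> g s + g (real k * s + t)" unfolding g_def
      using sub[of s "real k * s + t"] that by simp
    also have "\<dots> \<le> g s + (real k * g s + g t)" using Suc by simp
    finally show ?case by (simp add: algebra_simps)
  qed simp
  have "((\<lambda>t. g t / t) \<longlongrightarrow> L) at_top"
  proof (rule order_tendstoI)
    fix y assume y: "y < L"
    show "\<forall>\<^sub>F t in at_top. y < g t / t"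
      using eventually_gt_at_top[of 0]
    proof eventually_elim
      case (elim t)
      then have "L \<le> g t / t" unfolding L_def by (intro cINF_lower bdd) auto
      with y show ?case by simp
    qed
  next
    fix y assume "L < y"
    then obtain s where s: "0 < s" "g s / s < y"
      unfolding L_def by (subst (asm) cINF_less_iff[OF _ bdd]) auto
    \<comment> \<open>Bounds g on the interval from 0 to s, where the remainder of t modulo s
      lies.\<close>
    define K where "K = C * (s + 1) + c"
    have "((\<lambda>t. g s / s + K / t) \<longlongrightarrow> g s / s + 0) at_top"
      by (intro tendsto_add tendsto_const real_tendsto_divide_at_top[OF tendsto_const] filterlim_ident)
    then have "\<forall>\<^sub>F t in at_top. g s / s + K / t < y"
      using s by (intro order_tendstoD) auto
    then show "\<forall>\<^sub>F t in at_top. g t / t < y"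
      using eventually_gt_at_top[of 0]
    proof eventually_elim
      case (elim t)
      define k where "k = nat \<lfloor>t / s\<rfloor>"
      have k: "real k \<le> t / s" "t / s < real k + 1"
        using elim s unfolding k_def by (auto simp: of_nat_nat)
      have ks: "real k * s \<le> t" "t < real k * s + s"
        using k s by (simp_all add: pos_le_divide_eq pos_divide_less_eq distrib_right)
      have "g t \<le> real k * g s + g (t - real k * s)"
        using gmult[of s "t - real k * s" k] s ks by simp
      also have "g (t - real k * s) \<le> K"
      proof -
        have "f (t - real k * s) \<le> C * (t - real k * s + 1)" using ks by (intro bound) simp
        also have "\<dots> \<le> C * (s + 1)" using ks C by (intro mult_left_mono) auto
        finally show ?thesis by (simp add: g_def K_def)
      qed
      also have "real k * g s \<le> t / s * g s" using k g0[of s] s by (intro mult_right_mono) auto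
      finally have "g t \<le> t * (g s / s) + K" by simp
      then have "g t / t \<le> (t * (g s / s) + K) / t" using elim by (intro divide_right_mono) auto
      also have "\<dots> = g s / s + K / t" using elim by (simp add: add_divide_distrib)
      finally have "g t / t \<le> g s / s + K / t" .
      with elim show ?case by simp
    qed
  qed
  moreover have "((\<lambda>t. c / t) \<longlongrightarrow> 0) at_top"
    by (intro real_tendsto_divide_at_top[OF tendsto_const] filterlim_ident)
  ultimately have "((\<lambda>t. g t / t - c / t) \<longlongrightarrow> L - 0) at_top" by (intro tendsto_diff)
  moreover have "g t / t - c / t = f t / t" for t by (simp add: g_def diff_divide_distrib[symmetric])
  ultimately show ?thesis using that[of L] by simp
qed

text \<open>Rounding changes each coordinate by at most 1. This is the constant error in the
  subadditivity of the expected passage times.\<close>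

lemma l1_norm_vec_floor_add:
  "l1_norm (vec_floor (x + y) - vec_floor x - vec_floor (y :: real ^ 'd::finite)) \<le> CARD('d)"
proof -
  have "linf_norm (vec_floor (x + y) - vec_floor x - vec_floor y) \<le> 1"
    unfolding linf_norm_le_iff
  proof
    fix i
    show "\<bar>(vec_floor (x + y) - vec_floor x - vec_floor y) $ i\<bar> \<le> 1"
      unfolding vec_floor_def by simp linarith
  qed
  then have "int CARD('d) * linf_norm (vec_floor (x + y) - vec_floor x - vec_floor y) \<le> int CARD('d) * 1"
    by (intro mult_left_mono) auto
  then show ?thesis using l1_norm_le[of "vec_floor (x + y) - vec_floor x - vec_floor y"] by linarith
qed

lemma l1_norm_vec_floor_le:
  "real_of_int (l1_norm (vec_floor (x :: real ^ 'd::finite))) \<le> (\<Sum>i\<in>UNIV. \<bar>x $ i\<bar>) + CARD('d)"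
proof -
  have "real_of_int (l1_norm (vec_floor x)) = (\<Sum>i\<in>UNIV. \<bar>real_of_int \<lfloor>x $ i\<rfloor>\<bar>)"
    by (simp add: l1_norm_def vec_floor_def)
  also have "\<dots> \<le> (\<Sum>i\<in>UNIV. \<bar>x $ i\<bar> + 1)" by (intro sum_mono) linarith
  finally show ?thesis by (simp add: sum.distrib)
qed

context fpp
begin

definition mean :: real where "mean = expectation (\<tau> ref_edge)"
definition second_moment :: real where "second_moment = expectation (\<lambda>\<omega>. (\<tau> ref_edge \<omega>)\<^sup>2)"

lemma expectation_edge: "e \<in> lattice_edges \<Longrightarrow> expectation (\<tau> e) = mean"
  unfolding mean_def using expectation_edge_eq[of e ref_edge "\<lambda>t. t"] by simp

lemma expectation_edge_square: "e \<in> lattice_edges \<Longrightarrow> expectation (\<lambda>\<omega>. (\<tau> e \<omega>)\<^sup>2) = second_moment"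
  unfolding second_moment_def by (rule expectation_edge_eq[where f = "\<lambda>t. t\<^sup>2"]) auto

lemma mean_nonneg: "0 \<le> mean"
  unfolding mean_def by (intro integral_nonneg_AE AE_I2 nonneg) auto

text \<open>All four follow by comparison with one path parallel to the axes; for the square, the
  Cauchy-Schwarz inequality over its edges is enough.\<close>

lemma
  shows integrable_T: "integrable M (T u v)"
    and expectation_T_le: "expectation (T u v) \<le> mean * l1_norm (v - u)"
    and integrable_T_square: "integrable M (\<lambda>\<omega>. (T u v \<omega>)\<^sup>2)"
    and expectation_T_square_le: "expectation (\<lambda>\<omega>. (T u v \<omega>)\<^sup>2) \<le> second_moment * (real_of_int (l1_norm (v - u)))\<^sup>2"
proof -
  obtain es where es: "length es = nat (l1_norm (v - u))" "set es \<subseteq> lattice_edges"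
    "\<And>\<sigma>. nonneg_weights \<sigma> \<Longrightarrow> passage_time \<sigma> u v \<le> (\<Sum>e\<leftarrow>es. \<sigma> e)"
    using passage_time_le_sum_edges[where u = u and v = v] by metis
  define n where "n = nat (l1_norm (v - u))"
  have n: "real n = l1_norm (v - u)" using l1_norm_nonneg[of "v - u"] by (simp add: n_def)
  have mem: "es ! i \<in> lattice_edges" if "i < n" for i using es that by (auto simp: n_def)
  have le: "T u v \<omega> \<le> (\<Sum>i<n. \<tau> (es ! i) \<omega>)" if "\<omega> \<in> space M" for \<omega>
    using es(3)[OF nonneg_weights_\<tau>[OF that]] es(1)
    by (simp add: T_def n_def sum_list_sum_nth atLeast0LessThan)
  have int: "integrable M (\<lambda>\<omega>. \<Sum>i<n. \<tau> (es ! i) \<omega>)"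
    by (intro Bochner_Integration.integrable_sum integrable_edge mem) simp
  show int_T: "integrable M (T u v)"
  proof (rule Bochner_Integration.integrable_bound[OF int])
    show "AE \<omega> in M. norm (T u v \<omega>) \<le> norm (\<Sum>i<n. \<tau> (es ! i) \<omega>)"
    proof (rule AE_I2)
      fix \<omega> assume "\<omega> \<in> space M"
      then show "norm (T u v \<omega>) \<le> norm (\<Sum>i<n. \<tau> (es ! i) \<omega>)" using le[of \<omega>] T_nonneg[of \<omega> u v] by simp
    qed
  qed simp
  have "expectation (T u v) \<le> expectation (\<lambda>\<omega>. \<Sum>i<n. \<tau> (es ! i) \<omega>)"
    by (intro integral_mono int int_T le)
  also have "\<dots> = (\<Sum>i<n. expectation (\<tau> (es ! i)))"
    by (intro Bochner_Integration.integral_sum integrable_edge mem) simp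
  also have "\<dots> = (\<Sum>i<n. mean)" by (intro sum.cong) (auto simp: expectation_edge mem)
  finally show "expectation (T u v) \<le> mean * l1_norm (v - u)" by (simp add: n mult.commute)
  have int2: "integrable M (\<lambda>\<omega>. real n * (\<Sum>i<n. (\<tau> (es ! i) \<omega>)\<^sup>2))"
    by (intro integrable_mult_right Bochner_Integration.integrable_sum integrable_edge_square mem) simp
  have le2: "(T u v \<omega>)\<^sup>2 \<le> real n * (\<Sum>i<n. (\<tau> (es ! i) \<omega>)\<^sup>2)" if "\<omega> \<in> space M" for \<omega>
  proof -
    have "(T u v \<omega>)\<^sup>2 \<le> (\<Sum>i<n. \<tau> (es ! i) \<omega>)\<^sup>2"
      using le[OF that] T_nonneg[OF that] by (intro power_mono)
    also have "\<dots> \<le> real n * (\<Sum>i<n. (\<tau> (es ! i) \<omega>)\<^sup>2)"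
      using sum_squared_le_sum_of_squares[of "\<lambda>i. \<tau> (es ! i) \<omega>" "{..<n}"] by (simp add: mult.commute)
    finally show ?thesis .
  qed
  show int_T2: "integrable M (\<lambda>\<omega>. (T u v \<omega>)\<^sup>2)"
    by (rule Bochner_Integration.integrable_bound[OF int2])
      (auto intro!: AE_I2 order_trans[OF le2] )
  have "expectation (\<lambda>\<omega>. (T u v \<omega>)\<^sup>2) \<le> expectation (\<lambda>\<omega>. real n * (\<Sum>i<n. (\<tau> (es ! i) \<omega>)\<^sup>2))"
    by (intro integral_mono int2 int_T2 le2)
  also have "\<dots> = real n * (\<Sum>i<n. expectation (\<lambda>\<omega>. (\<tau> (es ! i) \<omega>)\<^sup>2))"
    by (subst integral_mult_right_zero, subst Bochner_Integration.integral_sum)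
      (auto intro: integrable_edge_square mem)
  also have "(\<Sum>i<n. expectation (\<lambda>\<omega>. (\<tau> (es ! i) \<omega>)\<^sup>2)) = (\<Sum>i<n. second_moment)"
    by (intro sum.cong) (auto simp: expectation_edge_square mem)
  finally show "expectation (\<lambda>\<omega>. (T u v \<omega>)\<^sup>2) \<le> second_moment * (real_of_int (l1_norm (v - u)))\<^sup>2"
    by (simp add: n[symmetric] power2_eq_square mult_ac)
qed

text \<open>Translation invariance turns the triangle inequality into subadditivity of the
  expectations, up to the bounded cost of rounding. Existence of the limit is the point, since
  \<open>Lim\<close> of a divergent function is an arbitrary value.\<close>

lemma time_constant_tendsto:
  "((\<lambda>t. expectation (T 0 (vec_floor (t *\<^sub>R x))) / t) \<longlongrightarrow> time_constant M \<tau> x) at_top"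
proof -
  define f where "f t = expectation (T 0 (vec_floor (t *\<^sub>R x)))" for t
  define S where "S = (\<Sum>i\<in>UNIV. \<bar>x $ i\<bar>)"
  have S: "0 \<le> S" by (simp add: S_def sum_nonneg)
  have f0: "0 \<le> f t" for t
    unfolding f_def by (intro integral_nonneg_AE AE_I2 T_nonneg)
  have bound: "f t \<le> mean * (S + CARD('d)) * (t + 1)" if "0 \<le> t" for t
  proof -
    have "f t \<le> mean * l1_norm (vec_floor (t *\<^sub>R x))"
      using expectation_T_le[of 0] by (simp add: f_def)
    also have "\<dots> \<le> mean * (t * S + CARD('d))"
      using l1_norm_vec_floor_le[of "t *\<^sub>R x"] that mean_nonneg
      by (intro mult_left_mono) (auto simp: S_def sum_distrib_left abs_mult)
    also have "\<dots> \<le> mean * ((S + CARD('d)) * (t + 1))"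
      using S that mean_nonneg by (intro mult_left_mono) (auto simp: algebra_simps)
    finally show ?thesis by (simp add: mult.assoc)
  qed
  have sub: "f (s + t) \<le> f s + f t + mean * CARD('d)" for s t
  proof -
    let ?u = "vec_floor (s *\<^sub>R x)" and ?v = "vec_floor (t *\<^sub>R x)" and ?w = "vec_floor ((s + t) *\<^sub>R x)"
    have "f (s + t) \<le> expectation (\<lambda>\<omega>. T 0 ?u \<omega> + T ?u (?u + ?v) \<omega> + T (?u + ?v) ?w \<omega>)"
      unfolding f_def
    proof (intro integral_mono Bochner_Integration.integrable_add integrable_T)
      fix \<omega> assume \<omega>: "\<omega> \<in> space M"
      show "T 0 ?w \<omega> \<le> T 0 ?u \<omega> + T ?u (?u + ?v) \<omega> + T (?u + ?v) ?w \<omega>"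
        using T_triangle[OF \<omega>, of 0 ?w ?u] T_triangle[OF \<omega>, of ?u ?w "?u + ?v"] by linarith
    qed
    also have "\<dots> = f s + expectation (T ?u (?u + ?v)) + expectation (T (?u + ?v) ?w)"
      by (simp add: f_def integrable_T)
    also have "expectation (T ?u (?u + ?v)) = f t"
      using expectation_T_translate[of ?u 0 ?v] by (simp add: f_def)
    also have "expectation (T (?u + ?v) ?w) \<le> mean * l1_norm (?w - (?u + ?v))"
      by (rule expectation_T_le)
    also have "\<dots> \<le> mean * CARD('d)"
      using l1_norm_vec_floor_add[of "s *\<^sub>R x" "t *\<^sub>R x"] mean_nonneg
      by (intro mult_left_mono) (auto simp: scaleR_left_distrib diff_diff_eq)
    finally show ?thesis by simp
  qed
  obtain L where L: "((\<lambda>t. f t / t) \<longlongrightarrow> L) at_top"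
    using subadditive_limit[of f "mean * (S + CARD('d))" "mean * CARD('d)"] f0 bound sub mean_nonneg
    by auto
  have "vec_floor (0 :: real ^ 'd) = 0" by (simp add: vec_floor_def vec_eq_iff)
  then have "time_constant M \<tau> x = Lim at_top (\<lambda>t. f t / t)"
    by (simp add: time_constant_def f_def T_def[abs_def] first_passage_time_eq)
  also have "\<dots> = L" using L by (intro tendsto_Lim) auto
  finally show ?thesis using L by (simp add: f_def)
qed

end

section \<open>The lower bound\<close>

text \<open>Here \<open>x \<noteq> 0\<close> enters: boxes of fixed size around the two endpoints
  are eventually disjoint.\<close>

lemma linf_norm_vec_floor_at_top:
  assumes "x \<noteq> (0 :: real ^ 'd::finite)"
  shows "filterlim (\<lambda>n. linf_norm (vec_floor (real n *\<^sub>R x))) at_top sequentially"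
proof -
  obtain i where i: "x $ i \<noteq> 0" using assms by (auto simp: vec_eq_iff)
  have "filterlim (\<lambda>n. real n * \<bar>x $ i\<bar> - 1) at_top sequentially"
    using i by real_asymp
  then have "filterlim (\<lambda>n. real_of_int (linf_norm (vec_floor (real n *\<^sub>R x)))) at_top sequentially"
  proof (rule filterlim_at_top_mono, intro always_eventually allI)
    fix n
    have "real n * \<bar>x $ i\<bar> - 1 \<le> \<bar>real_of_int \<lfloor>real n * x $ i\<rfloor>\<bar>"
    proof -
      have "real n * \<bar>x $ i\<bar> = \<bar>real n * x $ i\<bar>" by (simp add: abs_mult)
      then show ?thesis by linarith
    qed
    also have "\<dots> = real_of_int \<bar>vec_floor (real n *\<^sub>R x) $ i\<bar>" by (simp add: vec_floor_def)
    also have "\<dots> \<le> linf_norm (vec_floor (real n *\<^sub>R x))" 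
      using abs_nth_le_linf_norm[of "vec_floor (real n *\<^sub>R x)" i] by (simp only: of_int_le_iff)
    finally show "real n * \<bar>x $ i\<bar> - 1 \<le> linf_norm (vec_floor (real n *\<^sub>R x))" .
  qed
  then show ?thesis
    unfolding filterlim_at_top by (metis (mono_tags, lifting) eventually_mono of_int_le_iff)
qed

context fpp
begin

lemma expectation_T_over_n:
  "(\<lambda>n. expectation (T 0 (vec_floor (real n *\<^sub>R x))) / real n) \<longlonglongrightarrow> time_constant M \<tau> x"
  by (rule filterlim_compose[OF time_constant_tendsto filterlim_real_sequentially])

lemma T_square_bound:
  obtains C where "0 < C" "\<And>n. 1 \<le> n \<Longrightarrow>
    expectation (\<lambda>\<omega>. (T 0 (vec_floor (real n *\<^sub>R x)) \<omega>)\<^sup>2) \<le> C * (real n)\<^sup>2"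
proof -
  define S where "S = (\<Sum>i\<in>UNIV. \<bar>x $ i\<bar>) + CARD('d)"
  have m2: "0 \<le> second_moment" unfolding second_moment_def by simp
  have "expectation (\<lambda>\<omega>. (T 0 (vec_floor (real n *\<^sub>R x)) \<omega>)\<^sup>2) \<le> (second_moment * S\<^sup>2 + 1) * (real n)\<^sup>2"
    if n: "1 \<le> n" for n
  proof -
    let ?l = "real_of_int (l1_norm (vec_floor (real n *\<^sub>R x)))"
    have "?l \<le> (\<Sum>i\<in>UNIV. \<bar>(real n *\<^sub>R x) $ i\<bar>) + CARD('d)" by (rule l1_norm_vec_floor_le)
    also have "\<dots> \<le> real n * S" using n
      by (simp add: S_def sum_distrib_left abs_mult distrib_left)
    finally have "?l\<^sup>2 \<le> (real n * S)\<^sup>2" by (intro power_mono) (simp_all add: l1_norm_nonneg)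
    then have "second_moment * ?l\<^sup>2 \<le> second_moment * (real n * S)\<^sup>2" using m2 by (rule mult_left_mono)
    moreover have "expectation (\<lambda>\<omega>. (T 0 (vec_floor (real n *\<^sub>R x)) \<omega>)\<^sup>2) \<le> second_moment * ?l\<^sup>2"
      using expectation_T_square_le[of 0 "vec_floor (real n *\<^sub>R x)"] by simp
    moreover have "second_moment * (real n * S)\<^sup>2 \<le> (second_moment * S\<^sup>2 + 1) * (real n)\<^sup>2"
      by (simp add: power_mult_distrib algebra_simps)
    ultimately show ?thesis by linarith
  qed
  moreover have "0 < second_moment * S\<^sup>2 + 1"
    using m2 by (intro add_nonneg_pos mult_nonneg_nonneg) auto
  ultimately show ?thesis using that by blast
qed

text \<open>A second moment argument in the manner of Paley and Zygmund: the second moment is of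
  order \<open>(real n)\<^sup>2\<close>, so an event of small probability cannot carry a fixed
  fraction of an expectation of order n. A constant c is good enough, as it disappears after
  division by \<open>n powr r\<close>.\<close>

lemma prob_T_ge_not_small:
  assumes "0 < \<epsilon>"
  obtains c where "0 < c" "\<forall>\<^sub>F n in sequentially.
    c \<le> prob {\<omega> \<in> space M. (time_constant M \<tau> x - \<epsilon>) * real n \<le> T 0 (vec_floor (real n *\<^sub>R x)) \<omega>}"
proof -
  let ?\<mu> = "time_constant M \<tau> x" and ?T = "\<lambda>n. T 0 (vec_floor (real n *\<^sub>R x))"
  obtain C where C: "0 < C" "\<And>n. 1 \<le> n \<Longrightarrow> expectation (\<lambda>\<omega>. (?T n \<omega>)\<^sup>2) \<le> C * (real n)\<^sup>2"
    using T_square_bound[where x = x] by metis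
  define c where "c = min 1 (\<epsilon>\<^sup>2 / (4 * C))"
  have "\<forall>\<^sub>F n in sequentially. ?\<mu> - \<epsilon> / 2 < expectation (?T n) / real n"
    using expectation_T_over_n[of x] assms by (intro order_tendstoD) auto
  then have "\<forall>\<^sub>F n in sequentially. c \<le> prob {\<omega> \<in> space M. (?\<mu> - \<epsilon>) * real n \<le> ?T n \<omega>}"
    using eventually_ge_at_top[of 1]
  proof eventually_elim
    case (elim n)
    let ?a = "(?\<mu> - \<epsilon>) * real n" and ?A = "{\<omega> \<in> space M. (?\<mu> - \<epsilon>) * real n \<le> ?T n \<omega>}"
    have n: "0 < real n" using elim by simp
    have A: "?A \<in> sets M" by measurable
    \<comment> \<open>For a negative level the event is the whole space; the pointwise bound in the
      other case uses that the level is nonnegative.\<close>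
    show ?case
    proof (cases "0 \<le> ?a")
      case False
      then have "?A = space M" using T_nonneg by (auto intro: order_trans[of _ 0])
      then show ?thesis by (simp add: prob_space c_def)
    next
      case True
      \<comment> \<open>On the event, \<open>T \<le> s / 2 * T\<^sup>2 + 1 / (2 * s)\<close>, an
        additive form of Cauchy-Schwarz. With this s the quadratic term has expectation at most
        \<open>\<epsilon> / 4 * n\<close>.\<close>
      define s where "s = \<epsilon> / (2 * C * real n)"
      have s: "0 < s" using assms C n by (simp add: s_def)
      have le: "?T n \<omega> \<le> ?a + (s / 2 * (?T n \<omega>)\<^sup>2 + 1 / (2 * s) * indicator ?A \<omega>)"
        if "\<omega> \<in> space M" for \<omega>
      proof (cases "\<omega> \<in> ?A")
        case True
        have "0 \<le> (s * ?T n \<omega> - 1)\<^sup>2 / (2 * s)" using s by simp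
        also have "\<dots> = s / 2 * (?T n \<omega>)\<^sup>2 + 1 / (2 * s) - ?T n \<omega>"
          using s by (simp add: power2_eq_square field_simps)
        finally show ?thesis using True \<open>0 \<le> ?a\<close> by simp
      next
        case False
        then have "?T n \<omega> \<le> ?a" using that by auto
        moreover have "0 \<le> s / 2 * (?T n \<omega>)\<^sup>2" using s by simp
        ultimately show ?thesis using False by simp
      qed
      have int: "integrable M (\<lambda>\<omega>. ?a + (s / 2 * (?T n \<omega>)\<^sup>2 + 1 / (2 * s) * indicator ?A \<omega>))"
        using A by (intro Bochner_Integration.integrable_add integrable_const integrable_mult_right
            integrable_T_square integrable_real_indicator) (auto simp: emeasure_eq_measure)
      have "expectation (?T n) \<le> expectation (\<lambda>\<omega>. ?a + (s / 2 * (?T n \<omega>)\<^sup>2 + 1 / (2 * s) * indicator ?A \<omega>))"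
        by (intro integral_mono integrable_T int le)
      also have "\<dots> = ?a + (s / 2 * expectation (\<lambda>\<omega>. (?T n \<omega>)\<^sup>2) + 1 / (2 * s) * prob ?A)"
        using A integrable_T_square[of 0 "vec_floor (real n *\<^sub>R x)"]
        by (simp add: prob_space integrable_real_indicator emeasure_eq_measure)
      also have "s / 2 * expectation (\<lambda>\<omega>. (?T n \<omega>)\<^sup>2) \<le> s / 2 * (C * (real n)\<^sup>2)"
        using s elim by (intro mult_left_mono C) auto
      also have "\<dots> = \<epsilon> / 4 * real n" using C n by (simp add: s_def power2_eq_square)
      finally have "expectation (?T n) \<le> ?a + (\<epsilon> / 4 * real n + 1 / (2 * s) * prob ?A)" by simp
      moreover have "(?\<mu> - \<epsilon> / 2) * real n < expectation (?T n)"
        using elim n by (simp add: pos_less_divide_eq)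
      ultimately have "\<epsilon> / 4 * real n \<le> 1 / (2 * s) * prob ?A" by (simp add: algebra_simps)
      also have "1 / (2 * s) = C * real n / \<epsilon>" using C n assms by (simp add: s_def)
      finally have "\<epsilon> / 4 * \<epsilon> \<le> C * prob ?A" using n assms by (simp add: field_simps)
      then have "\<epsilon>\<^sup>2 / (4 * C) \<le> prob ?A" using C by (simp add: power2_eq_square field_simps)
      then show ?thesis by (simp add: c_def)
    qed
  qed
  moreover have "0 < c" using assms C by (simp add: c_def)
  ultimately show ?thesis using that by blast
qed

text \<open>Erasing the weights of B shortens a passage time by at most their sum, which Markov's
  inequality controls. For a bounded number of edges and s of order n the loss tends to 0; what is
  gained is independence from the weights in B.\<close>

lemma prob_modified_ge:
  assumes "finite B" "B \<subseteq> lattice_edges" "0 < s"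
  shows "prob {\<omega> \<in> space M. t \<le> T u v \<omega>} - card B * mean / s \<le>
    prob {\<omega> \<in> space M. t - s \<le> passage_time (\<lambda>e. if e \<in> B then 0 else \<tau> e \<omega>) u v}"
    (is "prob ?A - _ \<le> prob ?H")
proof -
  have [measurable]: "(\<lambda>\<omega>. passage_time (\<lambda>e. if e \<in> B then 0 else \<tau> e \<omega>) u v) \<in> borel_measurable M"
    by (rule borel_measurable_passage_time) auto
  have int: "integrable M (\<lambda>\<omega>. \<Sum>e\<in>B. \<tau> e \<omega>)"
    using assms by (intro Bochner_Integration.integrable_sum integrable_edge) auto
  let ?S = "{\<omega> \<in> space M. s \<le> (\<Sum>e\<in>B. \<tau> e \<omega>)}"
  have [measurable]: "(\<lambda>\<omega>. \<Sum>e\<in>B. \<tau> e \<omega>) \<in> borel_measurable M" using int by simp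
  have "prob ?S \<le> expectation (\<lambda>\<omega>. \<Sum>e\<in>B. \<tau> e \<omega>) / s"
    using assms by (intro integral_Markov_inequality_measure[OF int, where A = "{}"])
      (auto intro!: AE_I2 sum_nonneg nonneg)
  also have "expectation (\<lambda>\<omega>. \<Sum>e\<in>B. \<tau> e \<omega>) = (\<Sum>e\<in>B. expectation (\<tau> e))"
    using assms by (intro Bochner_Integration.integral_sum integrable_edge) auto
  also have "\<dots> = (\<Sum>e\<in>B. mean)" using assms by (intro sum.cong) (auto intro!: expectation_edge)
  finally have S: "prob ?S \<le> card B * mean / s" by simp
  have "?A \<subseteq> ?H \<union> ?S"
  proof
    fix \<omega> assume "\<omega> \<in> ?A"
    then have \<omega>: "\<omega> \<in> space M" "t \<le> T u v \<omega>" by auto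
    have "T u v \<omega> \<le> passage_time (\<lambda>e. if e \<in> B then 0 else \<tau> e \<omega>) u v + (\<Sum>e\<in>B. \<tau> e \<omega>)"
      unfolding T_def
      by (rule passage_time_mono_add[OF nonneg_weights_\<tau>[OF \<omega>(1)]])
        (use assms nonneg[OF _ \<omega>(1)] in \<open>auto simp: nonneg_weights_def\<close>)
    with \<omega> show "\<omega> \<in> ?H \<union> ?S" by auto
  qed
  then have "prob ?A \<le> prob (?H \<union> ?S)" by (intro finite_measure_mono) auto
  also have "\<dots> \<le> prob ?H + prob ?S" by (intro measure_Un_le) auto
  finally show ?thesis using S by linarith
qed

text \<open>The modified passage time is a function of the weights outside B and therefore
  independent of those in B.\<close>

lemma prob_edges_and_modified:
  assumes B': "finite B" "B \<subseteq> lattice_edges" and w: "\<And>e. e \<in> B \<Longrightarrow> 0 \<le> w e"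
  shows "(\<Prod>e\<in>B. \<beta>\<^sub>1 * exp (- \<alpha> * w e powr r)) *
      prob {\<omega> \<in> space M. t \<le> passage_time (\<lambda>e. if e \<in> B then 0 else \<tau> e \<omega>) u v} \<le>
    prob {\<omega> \<in> space M. (\<forall>e\<in>B. w e < \<tau> e \<omega>) \<and> t \<le> passage_time (\<lambda>e. if e \<in> B then 0 else \<tau> e \<omega>) u v}"
proof (cases "B = {}")
  case False
  note B = B' False
  let ?g = "\<lambda>x. passage_time (\<lambda>e. if e \<in> B then 0 else x e) u v"
  let ?X = "\<lambda>\<omega>. restrict (\<lambda>e. \<tau> e \<omega>) B" and ?Y = "\<lambda>\<omega>. restrict (\<lambda>e. \<tau> e \<omega>) (lattice_edges - B)"
  let ?MX = "PiM B (\<lambda>_. borel :: real measure)" and ?MY = "PiM (lattice_edges - B) (\<lambda>_. borel :: real measure)"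
  have ind: "indep_var ?MX ?X ?MY ?Y"
    by (rule indep_var_restrict[OF indep]) (use B in auto)
  define SX where "SX = PiE B (\<lambda>e. {w e<..})"
  define SY where "SY = {x \<in> space ?MY. t \<le> ?g x}"
  have SX: "SX \<in> sets ?MX" unfolding SX_def using B by (intro sets_PiM_I_finite) auto
  have "?g \<in> borel_measurable ?MY"
  proof (rule borel_measurable_passage_time)
    fix e :: "(int ^ 'd) set" assume "e \<in> lattice_edges"
    then show "(\<lambda>x. if e \<in> B then 0 else x e) \<in> borel_measurable ?MY"
      by (cases "e \<in> B") (auto intro: measurable_component_singleton)
  qed
  then have SY: "SY \<in> sets ?MY" unfolding SY_def by measurable
  have gY: "?g (?Y \<omega>) = ?g (\<lambda>e. \<tau> e \<omega>)" for \<omega> by (rule passage_time_cong) auto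
  have "prob {\<omega> \<in> space M. (\<forall>e\<in>B. w e < \<tau> e \<omega>) \<and> t \<le> ?g (\<lambda>e. \<tau> e \<omega>)} =
    prob ((\<lambda>\<omega>. (?X \<omega>, ?Y \<omega>)) -` (SX \<times> SY) \<inter> space M)"
    by (rule arg_cong[where f = prob]) (auto simp: SX_def SY_def gY space_PiM)
  also have "\<dots> = prob (?X -` SX \<inter> space M) * prob (?Y -` SY \<inter> space M)"
    by (rule indep_varD[OF ind SX SY])
  also have "?Y -` SY \<inter> space M = {\<omega> \<in> space M. t \<le> ?g (\<lambda>e. \<tau> e \<omega>)}"
    by (auto simp: SY_def gY space_PiM)
  also have "?X -` SX \<inter> space M = (\<Inter>e\<in>B. \<tau> e -` {w e<..} \<inter> space M)"
    using B by (auto simp: SX_def)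
  also have "prob \<dots> = (\<Prod>e\<in>B. prob (\<tau> e -` {w e<..} \<inter> space M))"
    using B by (intro indep_varsD[OF indep]) auto
  finally have eq: "prob {\<omega> \<in> space M. (\<forall>e\<in>B. w e < \<tau> e \<omega>) \<and> t \<le> ?g (\<lambda>e. \<tau> e \<omega>)} =
    (\<Prod>e\<in>B. prob (\<tau> e -` {w e<..} \<inter> space M)) * prob {\<omega> \<in> space M. t \<le> ?g (\<lambda>e. \<tau> e \<omega>)}" .
  have "(\<Prod>e\<in>B. \<beta>\<^sub>1 * exp (- \<alpha> * w e powr r)) \<le> (\<Prod>e\<in>B. prob (\<tau> e -` {w e<..} \<inter> space M))"
  proof (intro prod_mono conjI)
    fix e assume e: "e \<in> B"
    show "0 \<le> \<beta>\<^sub>1 * exp (- \<alpha> * w e powr r)" using \<beta>\<^sub>1_pos by simp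
    have "\<tau> e -` {w e<..} \<inter> space M = {\<omega> \<in> space M. w e < \<tau> e \<omega>}" by auto
    then show "\<beta>\<^sub>1 * exp (- \<alpha> * w e powr r) \<le> prob (\<tau> e -` {w e<..} \<inter> space M)"
      using tail_ge[of e "w e"] w[OF e] B(2) e by auto
  qed
  then show ?thesis unfolding eq by (intro mult_right_mono) auto
qed simp

text \<open>As \<epsilon> tends to 0 and \<eta> to the capacity, the exponent tends to the claimed
  one, because \<open>2 * (\<xi> / 2) powr r = 2 powr (1 - r) * \<xi> powr r\<close>. The boxes have
  fixed size, so the number of prescribed edges only affects c.\<close>

lemma lower_tail_bound:
  assumes m: "1 \<le> m" and \<eta>: "box_capacity TYPE('d) r m < \<eta>" and \<epsilon>: "0 < \<epsilon>" and \<xi>: "0 < \<xi>" and "x \<noteq> 0"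
  obtains c where "0 < c" "\<forall>\<^sub>F n in sequentially. c * exp (- 2 * \<alpha> * ((\<xi> / 2 + \<epsilon>) * real n) powr r * \<eta>) \<le>
    prob {\<omega> \<in> space M. (time_constant M \<tau> x + \<xi>) * real n \<le> T 0 (vec_floor (real n *\<^sub>R x)) \<omega>}"
proof -
  let ?\<mu> = "time_constant M \<tau> x" and ?v = "\<lambda>n. vec_floor (real n *\<^sub>R x)"
  let ?E = "box_edges m :: (int ^ 'd) set set"
  obtain f :: "int ^ 'd \<Rightarrow> real" where f: "f 0 = 0" "\<And>y. int m \<le> linf_norm y \<Longrightarrow> f y = 1"
    "box_energy r m f < \<eta>" using clipped_minimizer[OF m \<eta>] r_gt_1 by auto
  obtain c where c: "0 < c" "\<forall>\<^sub>F n in sequentially. c \<le> prob {\<omega> \<in> space M. (?\<mu> - \<epsilon>) * real n \<le> T 0 (?v n) \<omega>}"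
    using prob_T_ge_not_small[OF \<epsilon>, of x] by auto
  define B where "B v = ?E \<union> (`) ((+) v) ` ?E" for v
  define K where "K = 2 * card ?E"
  have "(\<lambda>n. real K * mean / \<epsilon> * (1 / real n)) \<longlonglongrightarrow> 0"
    by (rule tendsto_mult_right_zero[OF lim_1_over_n])
  then have "(\<lambda>n. real K * mean / (\<epsilon> * real n)) \<longlonglongrightarrow> 0" by simp
  then have "\<forall>\<^sub>F n in sequentially. real K * mean / (\<epsilon> * real n) < c / 2"
    by (rule order_tendstoD) (use c(1) in simp)
  moreover have "\<forall>\<^sub>F n in sequentially. 2 * int m + 1 \<le> linf_norm (?v n)"
    using linf_norm_vec_floor_at_top[OF \<open>x \<noteq> 0\<close>] by (simp add: filterlim_at_top)
  ultimately have "\<forall>\<^sub>F n in sequentially. (min \<beta>\<^sub>1 1 ^ K * (c / 2)) * exp (- 2 * \<alpha> * ((\<xi> / 2 + \<epsilon>) * real n) powr r * \<eta>) \<le>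
    prob {\<omega> \<in> space M. (?\<mu> + \<xi>) * real n \<le> T 0 (?v n) \<omega>}"
    using c(2) eventually_gt_at_top[of 0]
  proof eventually_elim
    case (elim n)
    \<comment> \<open>Each box has to produce \<open>\<xi> / 2 + \<epsilon>\<close> per unit of n:
      the rest is only known to take \<open>(?\<mu> - 2 * \<epsilon>) * n\<close>, one \<epsilon>
      being lost in the second moment argument and one in erasing the boxes.\<close>
    let ?B = "B (?v n)" and ?t = "(\<xi> / 2 + \<epsilon>) * real n"
    have n: "0 < real n" using elim by simp
    have t: "0 \<le> ?t" using \<epsilon> \<xi> by simp
    have B: "finite ?B" "?B \<subseteq> lattice_edges" using subsetD[OF box_edges_subset[of m]] by (auto simp: B_def)
    have cardB: "card ?B \<le> K" unfolding B_def K_def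
      by (rule order_trans[OF card_Un_le]) (simp add: card_image_le)
    have disj: "?E \<inter> (`) ((+) (?v n)) ` ?E = {}"
      using disjoint_box_edges[of m "?v n"] elim by simp
    have inj: "inj_on ((`) ((+) (?v n))) ?E" using inj_image_translate by (rule inj_on_subset) simp
    \<comment> \<open>The second box carries a translate of the same profile, pulled back by
      \<open>- ?v n\<close>.\<close>
    define w where "w e = ?t * (if e \<in> ?E then edge_increment f e else edge_increment f ((+) (- ?v n) ` e))" for e
    have w1: "w e = ?t * edge_increment f e" if "e \<in> ?E" for e using that by (simp add: w_def)
    have w2: "w ((+) (?v n) ` e) = ?t * edge_increment f e" if "e \<in> ?E" for e
    proof -
      have "(+) (?v n) ` e \<notin> ?E" using disj that by blast
      then show ?thesis by (simp add: w_def image_image)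
    qed
    have w0: "0 \<le> w e" if "e \<in> ?B" for e
    proof -
      have "0 \<le> edge_increment f e'" if "e' \<in> ?E" for e'
        using that box_edges_subset by (intro edge_increment_nonneg) auto
      then show ?thesis using that t w1 w2 by (auto simp: B_def)
    qed
    let ?T0 = "\<lambda>\<omega>. passage_time (\<lambda>e. if e \<in> ?B then 0 else \<tau> e \<omega>) 0 (?v n)"
    have "(\<Prod>e\<in>?B. \<beta>\<^sub>1 * exp (- \<alpha> * w e powr r)) = \<beta>\<^sub>1 ^ card ?B * exp (- \<alpha> * (\<Sum>e\<in>?B. w e powr r))"
      using B by (simp add: prod.distrib exp_sum[symmetric] sum_distrib_left)
    also have "(\<Sum>e\<in>?B. w e powr r) = (\<Sum>e\<in>?E. w e powr r) + (\<Sum>e\<in>?E. w ((+) (?v n) ` e) powr r)"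
      unfolding B_def using disj inj by (subst sum.union_disjoint) (auto simp: sum.reindex)
    also have "\<dots> = (\<Sum>e\<in>?E. (?t * edge_increment f e) powr r) + (\<Sum>e\<in>?E. (?t * edge_increment f e) powr r)"
      using w1 w2 by (intro arg_cong2[where f = "(+)"] sum.cong) auto
    also have "(\<Sum>e\<in>?E. (?t * edge_increment f e) powr r) = ?t powr r * box_energy r m f"
      unfolding box_energy_def sum_distrib_left
    by (simp add: powr_mult)
    finally have prod_eq: "(\<Prod>e\<in>?B. \<beta>\<^sub>1 * exp (- \<alpha> * w e powr r)) =
      \<beta>\<^sub>1 ^ card ?B * exp (- 2 * \<alpha> * ?t powr r * box_energy r m f)" by (simp add: algebra_simps)
    \<comment> \<open>Only an upper bound K on the number of edges is at hand; capping the base at 1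
      makes the power decreasing in it.\<close>
    have "min \<beta>\<^sub>1 1 ^ K \<le> \<beta>\<^sub>1 ^ card ?B"
    proof -
      have "min \<beta>\<^sub>1 1 ^ K \<le> min \<beta>\<^sub>1 1 ^ card ?B" using \<beta>\<^sub>1_pos cardB by (intro power_decreasing) auto
      also have "\<dots> \<le> \<beta>\<^sub>1 ^ card ?B" using \<beta>\<^sub>1_pos by (intro power_mono) auto
      finally show ?thesis .
    qed
    moreover have "exp (- 2 * \<alpha> * ?t powr r * \<eta>) \<le> exp (- 2 * \<alpha> * ?t powr r * box_energy r m f)"
      using f(3) \<alpha>_pos by (simp add: mult_left_mono)
    moreover have "c / 2 \<le> prob {\<omega> \<in> space M. (?\<mu> - 2 * \<epsilon>) * real n \<le> ?T0 \<omega>}"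
    proof -
      have "real (card ?B) * mean / (\<epsilon> * real n) \<le> real K * mean / (\<epsilon> * real n)"
        using cardB mean_nonneg \<epsilon> by (intro divide_right_mono mult_right_mono) auto
      moreover have eq: "(?\<mu> - \<epsilon>) * real n - \<epsilon> * real n = (?\<mu> - 2 * \<epsilon>) * real n" by (simp add: algebra_simps)
      have "prob {\<omega> \<in> space M. (?\<mu> - \<epsilon>) * real n \<le> T 0 (?v n) \<omega>} - real (card ?B) * mean / (\<epsilon> * real n) \<le>
        prob {\<omega> \<in> space M. (?\<mu> - 2 * \<epsilon>) * real n \<le> ?T0 \<omega>}"
        unfolding eq[symmetric] by (rule prob_modified_ge[OF B]) (use \<epsilon> n in simp)
      ultimately show ?thesis using elim(1,3) by linarith
    qed
    ultimately have "(min \<beta>\<^sub>1 1 ^ K * exp (- 2 * \<alpha> * ?t powr r * \<eta>)) * (c / 2) \<le>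
      (\<beta>\<^sub>1 ^ card ?B * exp (- 2 * \<alpha> * ?t powr r * box_energy r m f)) *
        prob {\<omega> \<in> space M. (?\<mu> - 2 * \<epsilon>) * real n \<le> ?T0 \<omega>}"
      using \<beta>\<^sub>1_pos c(1) by (intro mult_mono) auto
    also have "\<dots> \<le> prob {\<omega> \<in> space M. (\<forall>e\<in>?B. w e < \<tau> e \<omega>) \<and> (?\<mu> - 2 * \<epsilon>) * real n \<le> ?T0 \<omega>}"
      unfolding prod_eq[symmetric] by (rule prob_edges_and_modified[OF B]) (rule w0)
    also have "\<dots> \<le> prob {\<omega> \<in> space M. (?\<mu> + \<xi>) * real n \<le> T 0 (?v n) \<omega>}"
    proof (rule finite_measure_mono, rule subsetI)
      fix \<omega> assume "\<omega> \<in> {\<omega> \<in> space M. (\<forall>e\<in>?B. w e < \<tau> e \<omega>) \<and> (?\<mu> - 2 * \<epsilon>) * real n \<le> ?T0 \<omega>}"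
      then have \<omega>: "\<omega> \<in> space M" "\<And>e. e \<in> ?B \<Longrightarrow> w e < \<tau> e \<omega>" "(?\<mu> - 2 * \<epsilon>) * real n \<le> ?T0 \<omega>" by auto
      have "2 * ?t + ?T0 \<omega> \<le> T 0 (?v n) \<omega>" unfolding T_def B_def
      proof (rule passage_time_two_boxes[where f = f])
        show "nonneg_weights (\<lambda>e. \<tau> e \<omega>)" by (rule nonneg_weights_\<tau>[OF \<omega>(1)])
        show "f 0 = 0" by (rule f(1))
        show "f y = 1" if "int m \<le> linf_norm y" for y by (rule f(2)[OF that])
        show "2 * int m < linf_norm (?v n)" using elim by simp
        show "0 \<le> ?t" by (rule t)
        show "?t * edge_increment f e \<le> \<tau> e \<omega>" if "e \<in> ?E" for e
          using \<omega>(2)[of e] w1 that by (force simp: B_def)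
        show "?t * edge_increment f e \<le> \<tau> ((+) (?v n) ` e) \<omega>" if "e \<in> ?E" for e
          using \<omega>(2)[of "(+) (?v n) ` e"] w2 that by (force simp: B_def)
      qed
      moreover have "2 * ?t + (?\<mu> - 2 * \<epsilon>) * real n = (?\<mu> + \<xi>) * real n" by (simp add: algebra_simps)
      ultimately show "\<omega> \<in> {\<omega> \<in> space M. (?\<mu> + \<xi>) * real n \<le> T 0 (?v n) \<omega>}" using \<omega> by simp
    qed measurable
    finally show ?case by (simp add: mult_ac)
  qed
  moreover have "0 < min \<beta>\<^sub>1 1 ^ K * (c / 2)" using \<beta>\<^sub>1_pos c by simp
  ultimately show ?thesis using that by blast
qed

end

section \<open>Bulk estimate\<close>

text \<open>A substitute for the passage time that sees finitely many edges, so that distant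
  translates are independent. As a minimum over fewer paths it errs on the safe side for an upper
  bound.\<close>

definition min_time :: "(int ^ 'd::finite) list set \<Rightarrow> ((int ^ 'd) set \<Rightarrow> real) \<Rightarrow> real" where
  "min_time P \<sigma> = Min (path_time \<sigma> ` P)"

lemma passage_time_le_min_time:
  assumes "finite P" "P \<noteq> {}" "P \<subseteq> lattice_paths u v" "nonneg_weights \<sigma>"
  shows "passage_time \<sigma> u v \<le> min_time P \<sigma>"
  unfolding min_time_def using assms by (auto intro!: passage_time_le_path_time)

lemma min_time_cong:
  assumes "P \<subseteq> lattice_paths u v" "\<And>e. e \<in> lattice_edges \<Longrightarrow> \<sigma> e = \<sigma>' e"
  shows "min_time P \<sigma> = min_time P \<sigma>'"
proof -
  have "path_time \<sigma> ` P = path_time \<sigma>' ` P"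
    using assms by (intro image_cong refl) (auto intro: path_time_cong)
  then show ?thesis by (simp add: min_time_def)
qed

lemma borel_measurable_min_time:
  assumes "finite P" "P \<noteq> {}"
    and "\<And>p e. p \<in> P \<Longrightarrow> e \<in> path_edges p \<Longrightarrow> (\<lambda>x. \<sigma> x e) \<in> borel_measurable N"
  shows "(\<lambda>x. min_time P (\<sigma> x)) \<in> borel_measurable N"
  unfolding min_time_def path_time_def using assms
  by (intro borel_measurable_Min borel_measurable_sum) auto

text \<open>The derivative of the moment generating function at 0 is the mean. It is taken along
  \<open>u = 1 / Suc k\<close>, where Bernoulli's inequality provides the dominating function
  \<open>exp X\<close>; finally \<open>1 + y \<le> exp y\<close> gives the exponential form.\<close>

lemma (in prob_space) small_exp_moment:
  fixes X :: "'a \<Rightarrow> real"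
  assumes [measurable]: "X \<in> borel_measurable M"
    and nonneg: "\<And>\<omega>. \<omega> \<in> space M \<Longrightarrow> 0 \<le> X \<omega>"
    and int: "integrable M (\<lambda>\<omega>. exp (X \<omega>))" and "0 < \<epsilon>"
  obtains u where "0 < u" "integrable M (\<lambda>\<omega>. exp (u * X \<omega>))"
    "expectation (\<lambda>\<omega>. exp (u * X \<omega>)) \<le> exp (u * (expectation X + \<epsilon>))"
proof -
  let ?Y = "\<lambda>k \<omega>. real (Suc k) * (exp (X \<omega> / real (Suc k)) - 1)"
  have le: "norm (?Y k \<omega>) \<le> exp (X \<omega>)" if "\<omega> \<in> space M" for k \<omega>
  proof -
    let ?y = "exp (X \<omega> / real (Suc k)) - 1"
    have y: "0 \<le> ?y" using nonneg[OF that] by simp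
    then have "1 + real (Suc k) * ?y \<le> (1 + ?y) ^ Suc k" by (intro Bernoulli_inequality) simp
    also have "(1 + ?y) ^ Suc k = exp (X \<omega>)" by (simp add: exp_of_nat_mult[symmetric] del: power_Suc)
    finally show ?thesis using y by simp
  qed
  have lim: "(\<lambda>k. ?Y k \<omega>) \<longlonglongrightarrow> X \<omega>" for \<omega>
  proof -
    have "((\<lambda>h. exp (X \<omega> * h)) has_real_derivative X \<omega>) (at 0)"
      by (auto intro!: derivative_eq_intros)
    then have "((\<lambda>h. (exp (X \<omega> * h) - 1) / h) \<longlongrightarrow> X \<omega>) (at 0)"
      by (auto dest: DERIV_D)
    moreover have "filterlim (\<lambda>k. inverse (real (Suc k))) (at 0) sequentially"
      by (intro filterlim_atI LIMSEQ_inverse_real_of_nat) auto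
    ultimately have "(\<lambda>k. (exp (X \<omega> * inverse (real (Suc k))) - 1) / inverse (real (Suc k))) \<longlonglongrightarrow> X \<omega>"
      by (rule filterlim_compose)
    then show ?thesis by (simp add: divide_inverse mult.commute del: of_nat_Suc)
  qed
  have "(\<lambda>k. expectation (?Y k)) \<longlonglongrightarrow> expectation X"
  proof (rule integral_dominated_convergence[OF _ _ int])
    show "AE \<omega> in M. (\<lambda>k. ?Y k \<omega>) \<longlonglongrightarrow> X \<omega>" by (intro AE_I2 lim)
    show "AE \<omega> in M. norm (?Y k \<omega>) \<le> exp (X \<omega>)" for k by (intro AE_I2 le)
  qed auto
  then have "\<forall>\<^sub>F k in sequentially. expectation (?Y k) < expectation X + \<epsilon>"
    using \<open>0 < \<epsilon>\<close> by (intro order_tendstoD) auto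
  then obtain k where k: "expectation (?Y k) < expectation X + \<epsilon>"
    by (auto dest: eventually_happens)
  define u where "u = 1 / real (Suc k)"
  have u: "0 < u" "u \<le> 1" by (auto simp: u_def)
  have int_u: "integrable M (\<lambda>\<omega>. exp (u * X \<omega>))"
  proof (rule Bochner_Integration.integrable_bound[OF int])
    show "AE \<omega> in M. norm (exp (u * X \<omega>)) \<le> norm (exp (X \<omega>))"
      using u nonneg by (intro AE_I2) (simp add: mult_left_le_one_le)
  qed simp
  have "expectation (?Y k) = (expectation (\<lambda>\<omega>. exp (u * X \<omega>)) - 1) / u"
    using int_u by (simp add: u_def prob_space)
  with k u have "expectation (\<lambda>\<omega>. exp (u * X \<omega>)) \<le> 1 + u * (expectation X + \<epsilon>)"
    by (simp add: pos_divide_less_eq algebra_simps)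
  also have "\<dots> \<le> exp (u * (expectation X + \<epsilon>))" by (rule exp_ge_add_one_self)
  finally show ?thesis using that u int_u by blast
qed

text \<open>The spacing q keeps the translates of a fixed finite set of edges by distinct grid
  points disjoint; q stays fixed while k grows.\<close>

definition spaced :: "int \<Rightarrow> nat \<Rightarrow> 'd \<Rightarrow> int set" where
  "spaced q k b = (\<lambda>j. q * j) ` {0..<2 ^ k}"

lemma finite_spaced [simp]: "finite (spaced q k b)"
  by (simp add: spaced_def)

lemma spaced_nonempty [simp]: "spaced q k b \<noteq> {}"
  by (simp add: spaced_def)

lemma card_spaced: "q \<noteq> 0 \<Longrightarrow> card (spaced q k b) = 2 ^ k"
  unfolding spaced_def by (subst card_image) (auto simp: inj_on_def)

lemma spaced_subset: "0 \<le> q \<Longrightarrow> spaced q k b \<subseteq> {0..q * 2 ^ k}"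
  by (auto simp: spaced_def intro!: mult_left_mono)

lemma card_grid_spaced: "q \<noteq> 0 \<Longrightarrow> card (grid (spaced q k :: 'd::finite \<Rightarrow> int set)) = 2 ^ (k * CARD('d))"
  by (simp add: card_grid card_spaced power_mult)

context fpp
begin

text \<open>There are countably many paths. The minima over initial segments of an enumeration
  decrease to the infimum, and dominated convergence carries this over to expectations.\<close>

lemma finite_min_time:
  assumes "0 < \<epsilon>"
  obtains P where "finite P" "P \<noteq> {}" "P \<subseteq> lattice_paths u v"
    "expectation (\<lambda>\<omega>. min_time P (\<lambda>e. \<tau> e \<omega>)) < expectation (T u v) + \<epsilon>"
proof -
  define p where "p = from_nat_into (lattice_paths u v)"
  have range_p: "range p = lattice_paths u v" unfolding p_def by (intro range_from_nat_into) auto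
  then have p: "p i \<in> lattice_paths u v" for i by auto
  let ?X = "\<lambda>N \<omega>. min_time (p ` {..N}) (\<lambda>e. \<tau> e \<omega>)"
  have meas: "(\<lambda>\<omega>. ?X N \<omega>) \<in> borel_measurable M" for N
    using subsetD[OF path_edges_lattice_paths[OF p]] by (intro borel_measurable_min_time) auto
  have T_le: "T u v \<omega> \<le> ?X N \<omega>" if "\<omega> \<in> space M" for \<omega> N
    unfolding T_def using nonneg_weights_\<tau>[OF that] p by (intro passage_time_le_min_time) auto
  have le: "?X N \<omega> \<le> path_time (\<lambda>e. \<tau> e \<omega>) (p i)" if "i \<le> N" for i N \<omega>
    unfolding min_time_def using that by (intro Min_le) auto
  have lim: "(\<lambda>N. ?X N \<omega>) \<longlonglongrightarrow> T u v \<omega>" if \<omega>: "\<omega> \<in> space M" for \<omega>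
  proof (rule order_tendstoI)
    fix y assume "y < T u v \<omega>"
    then show "\<forall>\<^sub>F N in sequentially. y < ?X N \<omega>"
      using T_le[OF \<omega>] by (intro always_eventually) (auto intro: less_le_trans)
  next
    fix y assume y: "T u v \<omega> < y"
    obtain i where i: "path_time (\<lambda>e. \<tau> e \<omega>) (p i) < y"
    proof -
      have "\<exists>q\<in>lattice_paths u v. path_time (\<lambda>e. \<tau> e \<omega>) q < y"
        using y bdd_below_path_time[OF nonneg_weights_\<tau>[OF \<omega>], of u v]
        unfolding T_def passage_time_def by (subst (asm) cINF_less_iff) auto
      then show ?thesis using that unfolding range_p[symmetric] by blast
    qed
    show "\<forall>\<^sub>F N in sequentially. ?X N \<omega> < y"
      using eventually_ge_at_top[of i]
    proof eventually_elim
      case (elim N)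
      then show ?case using le[of i N \<omega>] i by linarith
    qed
  qed
  have int: "integrable M (\<lambda>\<omega>. path_time (\<lambda>e. \<tau> e \<omega>) (p 0))"
    unfolding path_time_def using subsetD[OF path_edges_lattice_paths[OF p]]
    by (intro Bochner_Integration.integrable_sum integrable_edge) auto
  have "(\<lambda>N. expectation (?X N)) \<longlonglongrightarrow> expectation (T u v)"
  proof (rule integral_dominated_convergence[OF _ _ int])
    show "AE \<omega> in M. norm (?X N \<omega>) \<le> path_time (\<lambda>e. \<tau> e \<omega>) (p 0)" for N
    proof (rule AE_I2)
      fix \<omega> assume "\<omega> \<in> space M"
      then show "norm (?X N \<omega>) \<le> path_time (\<lambda>e. \<tau> e \<omega>) (p 0)"
        using T_le[of \<omega> N] T_nonneg[of \<omega> u v] le[of 0 N \<omega>] by simp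
    qed
  qed (auto intro!: AE_I2 lim meas)
  then have "\<forall>\<^sub>F N in sequentially. expectation (?X N) < expectation (T u v) + \<epsilon>"
    using assms by (intro order_tendstoD) auto
  then obtain N where "expectation (?X N) < expectation (T u v) + \<epsilon>"
    by (auto dest: eventually_happens)
  then show ?thesis using that[of "p ` {..N}"] p by auto
qed

lemma integrable_exp_min_time:
  assumes P: "finite P" "P \<noteq> {}" "P \<subseteq> lattice_paths u v"
  shows "integrable M (\<lambda>\<omega>. exp (min_time P (\<lambda>e. \<tau> e \<omega>)))"
proof -
  obtain p where p: "p \<in> P" using P by blast
  have sub: "path_edges p \<subseteq> lattice_edges" using p P path_edges_lattice_paths by blast
  have "integrable M (\<lambda>\<omega>. \<Prod>e\<in>path_edges p. exp (\<tau> e \<omega>))"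
  proof (rule indep_vars_integrable)
    show "indep_vars (\<lambda>_. borel) (\<lambda>e \<omega>. exp (\<tau> e \<omega>)) (path_edges p)"
      using indep_subset[OF sub] by (rule indep_vars_compose2) auto
    show "integrable M (\<lambda>\<omega>. exp (\<tau> e \<omega>))" if "e \<in> path_edges p" for e
      using integrable_exp_edge[of e 1] sub that by auto
  qed simp
  then have int: "integrable M (\<lambda>\<omega>. exp (path_time (\<lambda>e. \<tau> e \<omega>) p))"
    by (simp add: path_time_def exp_sum)
  have "(\<lambda>\<omega>. min_time P (\<lambda>e. \<tau> e \<omega>)) \<in> borel_measurable M"
    using P path_edges_lattice_paths by (intro borel_measurable_min_time) fastforce+
  then show ?thesis
    by (intro Bochner_Integration.integrable_bound[OF int] AE_I2)
      (use P p in \<open>auto simp: min_time_def\<close>)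
qed

text \<open>A quarter of \<epsilon> pays for the restriction to finitely many paths and a quarter
  for the exponential moment; the remaining half gives the rate. Neither q nor u depends on k or w,
  while the number of independent terms is \<open>2 ^ (k * CARD('d))\<close>.\<close>

lemma bulk_concentration:
  assumes \<epsilon>: "0 < \<epsilon>"
  obtains q u where "0 < q" "0 < u" "\<And>k w. prob {\<omega> \<in> space M. expectation (T 0 v) + \<epsilon> \<le>
      average (\<lambda>z. T (z + w) (z + w + v) \<omega>) (grid (spaced q k))} \<le> exp (- u * 2 ^ (k * CARD('d)))"
proof -
  obtain P where P: "finite P" "P \<noteq> {}" "P \<subseteq> lattice_paths 0 v"
    "expectation (\<lambda>\<omega>. min_time P (\<lambda>e. \<tau> e \<omega>)) < expectation (T 0 v) + \<epsilon> / 4"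
    using finite_min_time[of "\<epsilon> / 4" 0 v] \<epsilon> by auto
  define X where "X w \<omega> = min_time P (\<lambda>e. \<tau> ((+) w ` e) \<omega>)" for w \<omega>
  have edges: "e \<in> lattice_edges" if "p \<in> P" "e \<in> path_edges p" for p e
    using that P path_edges_lattice_paths by blast
  have meas [measurable]: "X w \<in> borel_measurable M" for w
    unfolding X_def using P edges by (intro borel_measurable_min_time) auto
  have X_ge: "T w (w + v) \<omega> \<le> X w \<omega>" if "\<omega> \<in> space M" for w \<omega>
  proof -
    have "T w (w + v) \<omega> = passage_time (\<lambda>e. \<tau> ((+) w ` e) \<omega>) 0 v"
      using passage_time_translate[of "\<lambda>e. \<tau> e \<omega>" w 0 v] by (simp add: T_def)
    also have "\<dots> \<le> X w \<omega>" unfolding X_def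
      using P nonneg[OF _ that] by (intro passage_time_le_min_time) (auto simp: nonneg_weights_def)
    finally show ?thesis .
  qed
  have X0: "X 0 = (\<lambda>\<omega>. min_time P (\<lambda>e. \<tau> e \<omega>))" by (simp add: X_def[abs_def])
  obtain u where u: "0 < u" "integrable M (\<lambda>\<omega>. exp (u * X 0 \<omega>))"
    "expectation (\<lambda>\<omega>. exp (u * X 0 \<omega>)) \<le> exp (u * (expectation (X 0) + \<epsilon> / 4))"
  proof (rule small_exp_moment[of "X 0" "\<epsilon> / 4"])
    show "X 0 \<in> borel_measurable M" by (rule meas)
    show "0 \<le> X 0 \<omega>" if "\<omega> \<in> space M" for \<omega>
      using X_ge[OF that, of 0] T_nonneg[OF that, of 0 "0 + v"] by linarith
    show "integrable M (\<lambda>\<omega>. exp (X 0 \<omega>))" unfolding X0 using P by (intro integrable_exp_min_time)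
    show "0 < \<epsilon> / 4" using \<epsilon> by simp
  qed (erule (2) that)
  have distr_X: "distr M borel (X w) = distr M borel (X 0)" for w
  proof -
    have "distr M borel (\<lambda>\<omega>. min_time P (\<lambda>e. \<tau> e \<omega>)) = distr M borel (\<lambda>\<omega>. min_time P (\<lambda>e. \<tau> ((+) w ` e) \<omega>))"
    proof (rule translate_distr[where g = "min_time P"])
      show "min_time P \<in> borel_measurable (PiM lattice_edges (\<lambda>_. borel))"
        using borel_measurable_min_time[of P "\<lambda>x. x"] P edges
        by (auto intro: measurable_component_singleton)
    qed (rule min_time_cong[OF P(3)])
    then show ?thesis by (simp add: X_def[abs_def])
  qed
  have exp_X: "integrable M (\<lambda>\<omega>. exp (u * X w \<omega>))"
    "expectation (\<lambda>\<omega>. exp (u * X w \<omega>)) = expectation (\<lambda>\<omega>. exp (u * X 0 \<omega>))" for w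
  proof -
    let ?f = "\<lambda>t. exp (u * t)"
    have f: "?f \<in> borel_measurable borel" by measurable
    have "integrable (distr M borel (X 0)) ?f"
      using u(2) integrable_distr_eq[OF meas[of 0] f] by (rule iffD2[rotated])
    then have "integrable (distr M borel (X w)) ?f" by (subst distr_X)
    then show "integrable M (\<lambda>\<omega>. exp (u * X w \<omega>))"
      using integrable_distr_eq[OF meas[of w] f] by (rule iffD1[rotated])
    have "expectation (\<lambda>\<omega>. exp (u * X w \<omega>)) = integral\<^sup>L (distr M borel (X w)) ?f"
      by (rule integral_distr[OF meas f, symmetric])
    also have "\<dots> = integral\<^sup>L (distr M borel (X 0)) ?f" by (subst distr_X) (rule refl)
    also have "\<dots> = expectation (\<lambda>\<omega>. exp (u * X 0 \<omega>))" by (rule integral_distr[OF meas f])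
    finally show "expectation (\<lambda>\<omega>. exp (u * X w \<omega>)) = expectation (\<lambda>\<omega>. exp (u * X 0 \<omega>))" .
  qed
  define F where "F = \<Union> (path_edges ` P)"
  have F_edges: "e \<in> lattice_edges" if "e \<in> F" for e using that edges unfolding F_def by blast
  have F: "finite (\<Union> F)"
  proof (rule finite_Union)
    show "finite F" using P(1) by (simp add: F_def)
    show "finite e" if "e \<in> F" for e using F_edges[OF that] by (elim lattice_edgesE) simp
  qed
  define c where "c = Max (insert 0 (linf_norm ` \<Union> F))"
  have c: "linf_norm x \<le> c" if "x \<in> \<Union> F" for x
    unfolding c_def using F that by (intro Max_ge) auto
  have "0 \<le> c" unfolding c_def using F by (intro Max_ge) auto
  define q where "q = 2 * c + 1"
  have q: "0 < q" using \<open>0 \<le> c\<close> by (simp add: q_def)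
  have bound: "prob {\<omega> \<in> space M. expectation (T 0 v) + \<epsilon> \<le>
      average (\<lambda>z. T (z + w) (z + w + v) \<omega>) (grid (spaced q k))} \<le> exp (- (u * \<epsilon> / 2) * 2 ^ (k * CARD('d)))" for k w
  proof -
    let ?G = "grid (spaced q k) :: (int ^ 'd) set"
    have G: "finite ?G" "card ?G = 2 ^ (k * CARD('d))" using q by (auto simp: card_grid_spaced intro: finite_grid)
    define Kz where "Kz z = (`) ((+) (z + w)) ` F" for z
    have Kz_sub: "Kz z \<subseteq> lattice_edges" for z
    proof
      fix e assume "e \<in> Kz z"
      then obtain e' where "e = (+) (z + w) ` e'" "e' \<in> F" unfolding Kz_def by blast
      then show "e \<in> lattice_edges" by (simp add: F_edges)
    qed
    have "indep_vars (\<lambda>_. borel) (\<lambda>z. X (z + w)) ?G"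
    proof -
      have "disjoint_family_on Kz ?G"
        unfolding disjoint_family_on_def
      proof (intro ballI impI, rule ccontr)
        fix z z' assume z: "z \<in> ?G" "z' \<in> ?G" "z \<noteq> z'" and "Kz z \<inter> Kz z' \<noteq> {}"
        then obtain e e' where e: "e \<in> F" "e' \<in> F" "(+) (z + w) ` e = (+) (z' + w) ` e'"
          unfolding Kz_def by blast
        obtain x where x: "x \<in> e" using F_edges[OF e(1)] by (elim lattice_edgesE) blast
        then have "z + w + x \<in> (+) (z' + w) ` e'" using e(3) by blast
        then obtain x' where x': "x' \<in> e'" "z + w + x = z' + w + x'" by blast
        have "z $ b = z' $ b" for b
        proof -
          have "z $ b - z' $ b = x' $ b - x $ b" using arg_cong[OF x'(2), of "\<lambda>v. v $ b"] by simp
          moreover have "\<bar>x' $ b\<bar> \<le> c"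
            using e(2) x'(1) by (intro order_trans[OF abs_nth_le_linf_norm c]) blast
          moreover have "\<bar>x $ b\<bar> \<le> c"
            using e(1) x by (intro order_trans[OF abs_nth_le_linf_norm c]) blast
          ultimately have small: "\<bar>z $ b - z' $ b\<bar> < q" by (simp add: q_def)
          have "z $ b \<in> spaced q k b" "z' $ b \<in> spaced q k b" using z by (simp_all add: grid_def)
          then obtain j j' where "z $ b = q * j" "z' $ b = q * j'" unfolding spaced_def by blast
          then have eq: "z $ b - z' $ b = q * (j - j')" by (simp add: right_diff_distrib)
          then have "q * \<bar>j - j'\<bar> < q * 1" using small q by (simp add: abs_mult)
          then have "j = j'" using q by (subst (asm) mult_less_cancel_left_pos) auto
          with eq show ?thesis by simp
        qed
        then show False using z by (simp add: vec_eq_iff)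
      qed
      then have "indep_vars (\<lambda>z. PiM (Kz z) (\<lambda>_. borel)) (\<lambda>z \<omega>. restrict (\<lambda>e. \<tau> e \<omega>) (Kz z)) ?G"
        by (intro indep_vars_restrict[OF indep] Kz_sub)
      then have "indep_vars (\<lambda>_. borel)
        (\<lambda>z \<omega>. min_time P (\<lambda>e. restrict (\<lambda>e. \<tau> e \<omega>) (Kz z) ((+) (z + w) ` e))) ?G"
      proof (rule indep_vars_compose2[where Y = "\<lambda>z x. min_time P (\<lambda>e. x ((+) (z + w) ` e))"])
        fix z
        show "(\<lambda>x. min_time P (\<lambda>e. x ((+) (z + w) ` e))) \<in> borel_measurable (PiM (Kz z) (\<lambda>_. borel))"
          using P by (intro borel_measurable_min_time) (auto simp: Kz_def F_def intro!: measurable_component_singleton)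
      qed
      moreover have "min_time P (\<lambda>e. restrict (\<lambda>e. \<tau> e \<omega>) (Kz z) ((+) (z + w) ` e)) = X (z + w) \<omega>" for z \<omega>
      proof -
        have "path_time (\<lambda>e. restrict (\<lambda>e. \<tau> e \<omega>) (Kz z) ((+) (z + w) ` e)) ` P =
          path_time (\<lambda>e. \<tau> ((+) (z + w) ` e) \<omega>) ` P"
          unfolding path_time_def by (intro image_cong refl sum.cong) (auto simp: Kz_def F_def)
        then show ?thesis by (simp add: X_def min_time_def)
      qed
      ultimately show ?thesis by (simp only:)
    qed
    then have ind: "indep_vars (\<lambda>_. borel) (\<lambda>z \<omega>. u * X (z + w) \<omega>) ?G"
      by (rule indep_vars_compose2) auto
    let ?E = "expectation (X 0)" and ?N = "real (card ?G)"
    have N: "0 < ?N" using G by simp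
    have "prob {\<omega> \<in> space M. expectation (T 0 v) + \<epsilon> \<le> average (\<lambda>z. T (z + w) (z + w + v) \<omega>) ?G} \<le>
      prob {\<omega> \<in> space M. ?N * u * (?E + 3 / 4 * \<epsilon>) \<le> (\<Sum>z\<in>?G. u * X (z + w) \<omega>)}"
    proof (rule finite_measure_mono, rule subsetI)
      fix \<omega> assume "\<omega> \<in> {\<omega> \<in> space M. expectation (T 0 v) + \<epsilon> \<le> average (\<lambda>z. T (z + w) (z + w + v) \<omega>) ?G}"
      then have \<omega>: "\<omega> \<in> space M" "expectation (T 0 v) + \<epsilon> \<le> average (\<lambda>z. T (z + w) (z + w + v) \<omega>) ?G" by auto
      have "?E + 3 / 4 * \<epsilon> \<le> expectation (T 0 v) + \<epsilon>" using P(4) X0 by simp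
      also note \<omega>(2)
      also have "average (\<lambda>z. T (z + w) (z + w + v) \<omega>) ?G \<le> average (\<lambda>z. X (z + w) \<omega>) ?G"
        by (intro average_mono X_ge \<omega>)
      finally have "?E + 3 / 4 * \<epsilon> \<le> (\<Sum>z\<in>?G. X (z + w) \<omega>) / ?N" by (simp add: average_def)
      then have "(?E + 3 / 4 * \<epsilon>) * ?N \<le> (\<Sum>z\<in>?G. X (z + w) \<omega>)"
        by (simp only: pos_le_divide_eq[OF N])
      then have "u * ((?E + 3 / 4 * \<epsilon>) * ?N) \<le> u * (\<Sum>z\<in>?G. X (z + w) \<omega>)"
        using u(1) by (intro mult_left_mono) auto
      then have "?N * u * (?E + 3 / 4 * \<epsilon>) \<le> (\<Sum>z\<in>?G. u * X (z + w) \<omega>)"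
        unfolding sum_distrib_left by (simp only: mult_ac)
      then show "\<omega> \<in> {\<omega> \<in> space M. ?N * u * (?E + 3 / 4 * \<epsilon>) \<le> (\<Sum>z\<in>?G. u * X (z + w) \<omega>)}"
        using \<omega>(1) by simp
    qed measurable
    also have "\<dots> \<le> exp (- (?N * u * (?E + 3 / 4 * \<epsilon>))) * (\<Prod>z\<in>?G. expectation (\<lambda>\<omega>. exp (u * X (z + w) \<omega>)))"
      by (rule chernoff[OF G(1) ind exp_X(1)])
    also have "\<dots> \<le> exp (- (?N * u * (?E + 3 / 4 * \<epsilon>))) * (\<Prod>z\<in>?G. exp (u * (?E + \<epsilon> / 4)))"
    proof (intro mult_left_mono prod_mono conjI)
      fix z
      show "expectation (\<lambda>\<omega>. exp (u * X (z + w) \<omega>)) \<le> exp (u * (?E + \<epsilon> / 4))"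
        using u(3) exp_X(2)[of "z + w"] by (simp only:)
    qed simp_all
    also have "(\<Prod>z\<in>?G. exp (u * (?E + \<epsilon> / 4))) = exp (?N * (u * (?E + \<epsilon> / 4)))"
      by (simp only: prod_constant exp_of_nat_mult)
    also have "exp (- (?N * u * (?E + 3 / 4 * \<epsilon>))) * \<dots> =
        exp (- (?N * u * (?E + 3 / 4 * \<epsilon>)) + ?N * (u * (?E + \<epsilon> / 4)))"
      by (simp only: exp_add)
    also have "- (?N * u * (?E + 3 / 4 * \<epsilon>)) + ?N * (u * (?E + \<epsilon> / 4)) = - (u * \<epsilon> / 2) * ?N"
      by (simp add: algebra_simps)
    also have "?N = 2 ^ (k * CARD('d))" by (simp add: G(2))
    finally show ?thesis .
  qed
  have "0 < u * \<epsilon> / 2" using u(1) \<epsilon> by simp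
  from that[OF q this bound] show ?thesis .
qed

text \<open>All starting points z move by v at the same time, so each step costs an average over
  translates. Vectors are multiplied componentwise, whence \<open>of_nat i * v\<close> is the i-th
  multiple of v.\<close>

lemma T_chain_average:
  fixes a :: real
  assumes "\<omega> \<in> space M" "finite G" and g: "\<And>z z'. g z' \<le> g z + T z z' \<omega>"
    and a: "\<And>i. i < m \<Longrightarrow> average (\<lambda>z. T (z + of_nat i * v) (z + of_nat i * v + v) \<omega>) G \<le> a"
  shows "average (\<lambda>z. g (z + of_nat m * v)) G \<le> average g G + real m * a"
  using a
proof (induction m)
  case (Suc m)
  have "average (\<lambda>z. g (z + of_nat (Suc m) * v)) G \<le>
    average (\<lambda>z. g (z + of_nat m * v) + T (z + of_nat m * v) (z + of_nat m * v + v) \<omega>) G"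
  proof (rule average_mono)
    fix z
    have "z + of_nat (Suc m) * v = z + of_nat m * v + v" by (simp add: algebra_simps)
    then show "g (z + of_nat (Suc m) * v) \<le>
      g (z + of_nat m * v) + T (z + of_nat m * v) (z + of_nat m * v + v) \<omega>"
      using g[of "z + of_nat m * v + v" "z + of_nat m * v"] by (simp only:)
  qed
  also have "\<dots> \<le> (average g G + real m * a) + a"
    unfolding average_add using Suc by (intro add_mono) auto
  finally show ?case by (simp add: algebra_simps)
qed (simp add: average_def)

end

section \<open>The upper bound\<close>

subsection \<open>Connecting two points through the bulk\<close>

definition shift :: "int ^ 'd::finite \<Rightarrow> ('d \<Rightarrow> int set) \<Rightarrow> 'd \<Rightarrow> int set" where
  "shift w C b = (\<lambda>t. t + w $ b) ` C b"

lemma grid_shift: "grid (shift w C) = (\<lambda>z. z + w) ` grid C"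
proof
  show "grid (shift w C) \<subseteq> (\<lambda>z. z + w) ` grid C"
  proof
    fix z assume z: "z \<in> grid (shift w C)"
    have "z - w \<in> grid C" unfolding grid_def
    proof (intro CollectI allI)
      fix b
      have "z $ b \<in> (\<lambda>t. t + w $ b) ` C b" using z by (simp add: grid_def shift_def)
      then show "(z - w) $ b \<in> C b" by auto
    qed
    moreover have "z = (z - w) + w" by simp
    ultimately show "z \<in> (\<lambda>z. z + w) ` grid C" by blast
  qed
qed (auto simp: grid_def shift_def)

lemma average_grid_shift: "average g (grid (shift w C)) = average (\<lambda>z. g (z + w)) (grid C)"
proof -
  have inj: "inj_on (\<lambda>z. z + w) (grid C)" by (rule inj_onI) simp
  show ?thesis unfolding average_def grid_shift by (simp add: sum.reindex[OF inj] card_image[OF inj])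
qed

lemma card_shift [simp]: "card (shift w C b) = card (C b)"
  unfolding shift_def by (rule card_image) (simp add: inj_on_def)

text \<open>Joins the two regimes of scales: from i0 on the averages are controlled directly, below
  i0 through the largest weight near y.\<close>

lemma average_cube:
  fixes \<tau> :: "(int ^ 'd::finite) set \<Rightarrow> real" and s :: "nat \<Rightarrow> real"
  assumes \<tau>: "nonneg_weights \<tau>"
    and far: "\<And>i D b. i0 \<le> i \<Longrightarrow> i < k \<Longrightarrow> b \<notin> D \<Longrightarrow>
      line_average \<tau> (mixed (cube y i) (cube y (Suc i)) D) b (y $ b) (y $ b + 2 ^ Suc i) \<le> s i"
    and near: "\<And>e. e \<in> lattice_edges \<Longrightarrow> e \<subseteq> {z. \<forall>j. z $ j \<in> {y $ j..y $ j + 2 ^ i0}} \<Longrightarrow> \<tau> e \<le> t"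
    and t: "\<And>i. i < i0 \<Longrightarrow> 2 ^ Suc i * t \<le> s i"
  shows "average (passage_time \<tau> y) (grid (cube y k)) \<le> CARD('d) * (\<Sum>i<k. s i)"
proof (rule average_cube_chain[OF \<tau>])
  fix i D and b :: 'd assume "i < k" "b \<notin> D"
  show "line_average \<tau> (mixed (cube y i) (cube y (Suc i)) D) b (y $ b) (y $ b + 2 ^ Suc i) \<le> s i"
  proof (cases "i0 \<le> i")
    case True
    then show ?thesis using far \<open>i < k\<close> \<open>b \<notin> D\<close> by blast
  next
    case False
    then have i: "i < i0" by simp
    have "line_average \<tau> (mixed (cube y i) (cube y (Suc i)) D) b (y $ b) (y $ b + 2 ^ Suc i) \<le> 2 ^ Suc i * t"
      by (rule cube_line_average_le[OF _ i]) (rule near)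
    also have "\<dots> \<le> s i" by (rule t[OF i])
    finally show ?thesis .
  qed
qed

text \<open>The route leads from y through its cube, the grid C, the translated grid and the cube at
  y' to y'. Only averages over intermediate points are controlled, so one function g is carried
  through all grids and no particular intermediate point is ever selected.\<close>

lemma passage_time_through_bulk:
  fixes \<tau> :: "(int ^ 'd::finite) set \<Rightarrow> real" and S s B :: real
  assumes \<tau>: "nonneg_weights \<tau>"
    and C: "\<And>b. finite (C b)" "\<And>b. C b \<noteq> {}"
    and start: "average (passage_time \<tau> y) (grid (cube y k)) \<le> S"
    and stop: "average (passage_time \<tau> y') (grid (cube y' k)) \<le> S"
    and bulk: "\<And>g. (\<And>z z'. g z' \<le> g z + passage_time \<tau> z z') \<Longrightarrow>
      average (\<lambda>z. g (z + w)) (grid C) \<le> average g (grid C) + B"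
    and sub1: "\<And>b. cube y k b \<subseteq> {lo b..hi b}" "\<And>b. C b \<subseteq> {lo b..hi b}"
    and sub2: "\<And>b. cube y' k b \<subseteq> {lo' b..hi' b}" "\<And>b. shift w C b \<subseteq> {lo' b..hi' b}"
    and s1: "\<And>D b. b \<notin> D \<Longrightarrow> line_average \<tau> (mixed (cube y k) C D) b (lo b) (hi b) \<le> s"
    and s2: "\<And>D b. b \<notin> D \<Longrightarrow> line_average \<tau> (mixed (shift w C) (cube y' k) D) b (lo' b) (hi' b) \<le> s"
  shows "passage_time \<tau> y y' \<le> 2 * S + 2 * (CARD('d) * s) + B"
proof -
  let ?g = "passage_time \<tau> y"
  have g: "?g z' \<le> ?g z + passage_time \<tau> z z'" for z z' by (rule passage_time_triangle[OF \<tau>])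
  have "average ?g (grid C) \<le> average ?g (grid (cube y k)) + CARD('d) * s"
    by (rule average_transfer_all[where g = ?g, OF \<tau> g, where lo = lo and hi = hi])
      (use C sub1 s1 in simp_all)
  with start have 1: "average ?g (grid C) \<le> S + CARD('d) * s" by simp
  have "average ?g (grid (shift w C)) \<le> average ?g (grid C) + B"
    unfolding average_grid_shift by (rule bulk) (rule g)
  with 1 have 2: "average ?g (grid (shift w C)) \<le> S + CARD('d) * s + B" by simp
  have "average ?g (grid (cube y' k)) \<le> average ?g (grid (shift w C)) + CARD('d) * s"
  proof (rule average_transfer_all[where g = ?g, OF \<tau> g, where lo = lo' and hi = hi'])
    show "finite (shift w C j)" "shift w C j \<noteq> {}" for j using C by (simp_all add: shift_def)
  qed (use sub2 s2 in simp_all)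
  with 2 have 3: "average ?g (grid (cube y' k)) \<le> S + 2 * (CARD('d) * s) + B" by simp
  have fin: "finite (grid (cube y' k))" by (intro finite_grid) simp
  have ne: "grid (cube y' k) \<noteq> {}" by (intro grid_nonempty) simp
  \<comment> \<open>Averaging a constant over the last cube lets the two halves of the route be
    joined at each z and estimated separately.\<close>
  have "passage_time \<tau> y y' = average (\<lambda>_. passage_time \<tau> y y') (grid (cube y' k))"
    by (rule average_const[OF fin ne, symmetric])
  also have "\<dots> \<le> average (\<lambda>z. ?g z + passage_time \<tau> y' z) (grid (cube y' k))"
    using g by (intro average_mono) (simp add: passage_time_commute[of \<tau> y'])
  also have "\<dots> \<le> (S + 2 * (CARD('d) * s) + B) + S"
    unfolding average_add using 3 stop by (rule add_mono)
  finally show ?thesis by simp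
qed

text \<open>Pigeonhole: a bad shell supplies a large edge whose vertices have norm within
  \<open>2 ^ i0\<close> of its radius. Consecutive radii differ by \<open>3 * 2 ^ i0\<close>, more
  than twice that, so L bad shells supply L distinct large edges.\<close>

lemma good_shell:
  fixes \<sigma> :: "(int ^ 'd::finite) set \<Rightarrow> real"
  defines "W \<equiv> \<lambda>i0. 3 * 2 ^ i0 :: nat"
  assumes few: "\<not> (\<exists>J\<subseteq>box_edges ((L + 1) * W i0). card J = L \<and> (\<forall>e\<in>J. t < \<sigma> e))"
  shows "\<exists>j\<in>{1..L}. \<forall>y e. linf_norm y = int (j * W i0) \<longrightarrow> e \<in> lattice_edges \<longrightarrow>
    e \<subseteq> {z. \<forall>b. z $ b \<in> {y $ b..y $ b + 2 ^ i0}} \<longrightarrow> \<sigma> e \<le> t"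
proof (rule ccontr)
  assume "\<not> ?thesis"
  then have "\<forall>j\<in>{1..L}. \<exists>e. \<exists>y. linf_norm y = int (j * W i0) \<and> e \<in> lattice_edges \<and>
    e \<subseteq> {z. \<forall>b. z $ b \<in> {y $ b..y $ b + 2 ^ i0}} \<and> t < \<sigma> e"
    unfolding not_le[symmetric] by blast
  then have "\<exists>e. \<forall>j\<in>{1..L}. \<exists>y. linf_norm y = int (j * W i0) \<and> e j \<in> lattice_edges \<and>
    e j \<subseteq> {z. \<forall>b. z $ b \<in> {y $ b..y $ b + 2 ^ i0}} \<and> t < \<sigma> (e j)"
    by (rule bchoice)
  then obtain e where e: "\<forall>j\<in>{1..L}. \<exists>y. linf_norm y = int (j * W i0) \<and> e j \<in> lattice_edges \<and>
    e j \<subseteq> {z. \<forall>b. z $ b \<in> {y $ b..y $ b + 2 ^ i0}} \<and> t < \<sigma> (e j)"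
    by blast
  have dist: "\<bar>linf_norm z - int (j * W i0)\<bar> \<le> 2 ^ i0" if j: "j \<in> {1..L}" and z: "z \<in> e j" for j z
  proof -
    obtain y where y: "linf_norm y = int (j * W i0)" "e j \<subseteq> {z. \<forall>b. z $ b \<in> {y $ b..y $ b + 2 ^ i0}}"
      using bspec[OF e j] by blast
    have "\<forall>b. z $ b \<in> {y $ b..y $ b + 2 ^ i0}" using y(2) z by blast
    then have "\<bar>(z - y) $ b\<bar> \<le> 2 ^ i0" for b by (auto dest!: spec[of _ b])
    then have "linf_norm (z - y) \<le> 2 ^ i0" unfolding linf_norm_le_iff by blast
    moreover have "linf_norm (y - z) = linf_norm (z - y)"
      using linf_norm_minus[of "z - y"] by simp
    ultimately show ?thesis
      using linf_norm_add_le[of y "z - y"] linf_norm_add_le[of z "y - z"] y(1) by simp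
  qed
  have W: "int (W i0) = 3 * 2 ^ i0" by (simp add: W_def)
  have pow: "(0::int) < 2 ^ i0" by simp
  have vertex: "\<exists>z. z \<in> e j" if "j \<in> {1..L}" for j
  proof -
    have "e j \<in> lattice_edges" using bspec[OF e that] by blast
    then show ?thesis by (elim lattice_edgesE) blast
  qed
  have inj: "inj_on e {1..L}"
  proof (rule inj_onI)
    fix j j' assume j: "j \<in> {1..L}" "j' \<in> {1..L}" and eq: "e j = e j'"
    obtain z where "z \<in> e j" using vertex[OF j(1)] by blast
    then have "\<bar>linf_norm z - int (j * W i0)\<bar> \<le> 2 ^ i0" "\<bar>linf_norm z - int (j' * W i0)\<bar> \<le> 2 ^ i0"
      using dist j eq by auto
    then have "\<bar>(int j - int j') * int (W i0)\<bar> \<le> 2 * 2 ^ i0" by (simp add: left_diff_distrib)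
    then have "\<bar>int j - int j'\<bar> * 3 \<le> 2" by (simp add: W abs_mult)
    then show "j = j'" by presburger
  qed
  have "e ` {1..L} \<subseteq> box_edges ((L + 1) * W i0)"
  proof
    fix a assume "a \<in> e ` {1..L}"
    then obtain j where j: "j \<in> {1..L}" "a = e j" by blast
    then have "a \<in> lattice_edges" using e by blast
    then obtain x y where xy: "a = {x, y}" "nearest_neighbors x y" by (rule lattice_edgesE)
    have "linf_norm z \<le> (L + 1) * W i0" if "z \<in> a" for z
    proof -
      have "linf_norm z \<le> int (j * W i0) + 2 ^ i0" using dist[of j z] j that by simp
      also have "\<dots> \<le> int j * int (W i0) + int (W i0)" using W by simp
      also have "\<dots> \<le> int L * int (W i0) + int (W i0)" using j by (intro add_right_mono mult_right_mono) auto
      finally show ?thesis by (simp add: algebra_simps)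
    qed
    then show "a \<in> box_edges ((L + 1) * W i0)" using xy by (simp add: box_edges_iff)
  qed
  moreover have "card (e ` {1..L}) = L" using card_image[OF inj] by simp
  moreover have "\<forall>a\<in>e ` {1..L}. t < \<sigma> a" using e by blast
  ultimately show False using few by blast
qed

text \<open>Convexity: splitting a delay evenly between the two endpoints is cheapest. This is the
  origin of the factor \<open>2 powr (1 - r)\<close>. The value 0 is treated apart because convexity
  is available on the positive reals.\<close>

lemma powr_convex_two:
  fixes a b :: real
  assumes "0 \<le> a" "0 \<le> b" "1 \<le> p"
  shows "2 powr (1 - p) * (a + b) powr p \<le> a powr p + b powr p"
proof (cases "a = 0 \<or> b = 0")
  case True
  have "2 powr (1 - p) \<le> 2 powr 0" using assms by (intro powr_mono) auto
  then have "2 powr (1 - p) * x \<le> x" if "0 \<le> x" for x :: real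
    using mult_right_mono[of "2 powr (1 - p)" 1 x] that by simp
  then show ?thesis using True by auto
next
  case False
  then have pos: "a \<in> {0<..}" "b \<in> {0<..}" using assms by auto
  have "((1 - 1 / 2) *\<^sub>R a + (1 / 2) *\<^sub>R b) powr p \<le> (1 - 1 / 2) * a powr p + 1 / 2 * b powr p"
    by (rule convex_onD[OF powr_convex[OF assms(3)] _ _ pos]) auto
  moreover have "(1 - 1 / 2) *\<^sub>R a + (1 / 2) *\<^sub>R b = (a + b) / 2" by simp
  ultimately have "((a + b) / 2) powr p \<le> (a powr p + b powr p) / 2" by (simp only:) simp
  moreover have "((a + b) / 2) powr p = (a + b) powr p / 2 powr p" by (rule powr_divide)
  moreover have "2 powr (1 - p) = 2 / 2 powr p" by (simp add: powr_diff)
  ultimately show ?thesis by (simp add: mult.commute)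
qed

text \<open>y and y' are the cheapest points of their spheres; if together they took time s or more,
  the capacity bound at both ends would exceed the available energy. The radii j and j' may differ
  because the good shells at the two ends may.\<close>

lemma capacity_two_boxes:
  fixes \<tau> :: "(int ^ 'd::finite) set \<Rightarrow> real"
  assumes \<tau>: "nonneg_weights \<tau>" and "1 \<le> r" and j: "1 \<le> j" "j \<le> m" "1 \<le> j'" "j' \<le> m"
    and v: "2 * int m < linf_norm v" and "0 \<le> s"
    and small: "(\<Sum>e\<in>box_edges m \<union> (`) ((+) v) ` box_edges m. \<tau> e powr r) <
      discrete_capacity TYPE('d) r * 2 powr (1 - r) * s powr r"
  obtains y y' where "linf_norm y = int j" "linf_norm y' = int j'"
    "passage_time \<tau> 0 y + passage_time \<tau> v (v + y') < s"
proof -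
  have attained: "\<exists>y. linf_norm y = int i \<and> (\<forall>y'. linf_norm y' = int i \<longrightarrow> f y \<le> f y')"
    for i and f :: "int ^ 'd \<Rightarrow> real"
  proof -
    let ?S = "{y :: int ^ 'd. linf_norm y = int i}"
    have "?S \<subseteq> lattice_box i 0" by (auto simp: lattice_box_0)
    then have fin: "finite ?S" using finite_lattice_box finite_subset by blast
    have "(\<chi> b. int i) \<in> ?S" by (simp add: linf_norm_def)
    then have ne: "?S \<noteq> {}" by blast
    show ?thesis using arg_min_if_finite(1)[OF fin ne, of f] arg_min_least[OF fin ne, of _ f] by blast
  qed
  obtain y where y: "linf_norm y = int j"
    "\<And>z. linf_norm z = int j \<Longrightarrow> passage_time \<tau> 0 y \<le> passage_time \<tau> 0 z"
    using attained[of j "passage_time \<tau> 0"] by blast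
  obtain y' where y': "linf_norm y' = int j'"
    "\<And>z. linf_norm z = int j' \<Longrightarrow> passage_time \<tau> v (v + y') \<le> passage_time \<tau> v (v + z)"
    using attained[of j' "\<lambda>z. passage_time \<tau> v (v + z)"] by blast
  define t t' where "t = passage_time \<tau> 0 y" and "t' = passage_time \<tau> v (v + y')"
  have t: "0 \<le> t" "0 \<le> t'" by (simp_all add: t_def t'_def passage_time_nonneg[OF \<tau>])
  let ?c = "discrete_capacity TYPE('d) r"
  have r: "0 < r" using \<open>1 \<le> r\<close> by simp
  have c: "0 \<le> ?c" using r by (rule discrete_capacity_nonneg)
  have "?c * t powr r \<le> (\<Sum>e\<in>box_edges j. \<tau> ((+) 0 ` e) powr r)"
    by (rule capacity_le_sum_weights[OF \<tau> j(1) r t(1)]) (simp add: t_def y(2))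
  also have "\<dots> = (\<Sum>e\<in>box_edges j. \<tau> e powr r)" by simp
  also have "\<dots> \<le> (\<Sum>e\<in>box_edges m. \<tau> e powr r)"
    using box_edges_mono[OF j(2)] by (intro sum_mono2) auto
  finally have 1: "?c * t powr r \<le> (\<Sum>e\<in>box_edges m. \<tau> e powr r)" .
  have "?c * t' powr r \<le> (\<Sum>e\<in>box_edges j'. \<tau> ((+) v ` e) powr r)"
    by (rule capacity_le_sum_weights[OF \<tau> j(3) r t(2)]) (simp add: t'_def y'(2))
  also have "\<dots> \<le> (\<Sum>e\<in>box_edges m. \<tau> ((+) v ` e) powr r)"
    using box_edges_mono[OF j(4)] by (intro sum_mono2) auto
  finally have 2: "?c * t' powr r \<le> (\<Sum>e\<in>box_edges m. \<tau> ((+) v ` e) powr r)" .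
  have inj: "inj_on ((`) ((+) v)) (box_edges m)" using inj_image_translate by (rule inj_on_subset) simp
  have "(\<Sum>e\<in>box_edges m \<union> (`) ((+) v) ` box_edges m. \<tau> e powr r) =
    (\<Sum>e\<in>box_edges m. \<tau> e powr r) + (\<Sum>e\<in>box_edges m. \<tau> ((+) v ` e) powr r)"
    using disjoint_box_edges[OF v] by (subst sum.union_disjoint) (simp_all add: sum.reindex[OF inj])
  with 1 2 have 3: "?c * (t powr r + t' powr r) \<le> (\<Sum>e\<in>box_edges m \<union> (`) ((+) v) ` box_edges m. \<tau> e powr r)"
    by (simp add: distrib_left)
  have "?c * (2 powr (1 - r) * (t + t') powr r) \<le> ?c * (t powr r + t' powr r)"
    using powr_convex_two[OF t \<open>1 \<le> r\<close>] c by (rule mult_left_mono)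
  with 3 small have lt: "?c * (2 powr (1 - r) * (t + t') powr r) < ?c * (2 powr (1 - r) * s powr r)"
    by (simp add: mult.assoc)
  have "t + t' < s"
  proof (rule ccontr)
    assume "\<not> t + t' < s"
    then have "s powr r \<le> (t + t') powr r" using \<open>0 \<le> s\<close> r by (intro powr_mono2) auto
    then have "?c * (2 powr (1 - r) * s powr r) \<le> ?c * (2 powr (1 - r) * (t + t') powr r)"
      using c by (intro mult_left_mono) auto
    with lt show False by simp
  qed
  then show ?thesis using that[OF y(1) y'(1)] by (simp add: t_def t'_def)
qed

lemma card_grid_base_mixed:
  fixes A B :: "'d::finite \<Rightarrow> int set"
  assumes "\<And>j. s \<le> card (A j)" "\<And>j. s \<le> card (B j)"
  shows "s ^ (CARD('d) - 1) \<le> card (grid_base (mixed A B D) b)"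
proof -
  have "s ^ (CARD('d) - 1) = (\<Prod>j\<in>UNIV - {b}. s)" by (simp add: card_Diff_singleton)
  also have "\<dots> \<le> (\<Prod>j\<in>UNIV - {b}. card (((mixed A B D)(b := {0})) j))"
    using assms by (intro prod_mono) (auto simp: mixed_def)
  also have "\<dots> = (\<Prod>j\<in>UNIV. card (((mixed A B D)(b := {0})) j))"
    by (rule prod.mono_neutral_left) auto
  finally show ?thesis by (simp only: card_grid)
qed

subsection \<open>Probability of the exceptional events\<close>

lemma two_powr_mult: "(2::real) powr (c * real i) = (2 powr c) ^ i"
  unfolding powr_powr[symmetric] by (rule powr_realpow) simp

context fpp
begin

lemma prob_UN_le:
  fixes p :: real
  assumes "finite A" "\<And>a. a \<in> A \<Longrightarrow> E a \<in> events" "\<And>a. a \<in> A \<Longrightarrow> prob (E a) \<le> p"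
  shows "prob (\<Union>a\<in>A. E a) \<le> card A * p"
proof -
  have "prob (\<Union>a\<in>A. E a) \<le> (\<Sum>a\<in>A. prob (E a))"
    using assms by (intro finite_measure_subadditive_finite) auto
  also have "\<dots> \<le> (\<Sum>a\<in>A. p)" by (intro sum_mono assms)
  finally show ?thesis by simp
qed

lemma mixed_line_average_tail:
  fixes lo hi :: int and t h :: real
  assumes A: "\<And>j. finite (A j)" "\<And>j. A j \<noteq> {}" "\<And>j. s \<le> card (A j)"
    and B: "\<And>j. finite (B j)" "\<And>j. B j \<noteq> {}" "\<And>j. s \<le> card (B j)"
    and "lo \<le> hi" "1 \<le> h" and t: "2 * mgf_const * (real_of_int hi - real_of_int lo) * h \<le> t"
  shows "prob {\<omega> \<in> space M. t \<le> line_average (\<lambda>e. \<tau> e \<omega>) (mixed A B D) b lo hi} \<le>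
    exp (- (real s ^ (CARD('d) - 1) * h powr (r - 1) * t / 2))"
proof -
  have "0 \<le> 2 * mgf_const * (real_of_int hi - real_of_int lo) * h"
    using \<open>lo \<le> hi\<close> \<open>1 \<le> h\<close> mgf_const_pos by (intro mult_nonneg_nonneg) auto
  with t have t0: "0 \<le> t" by linarith
  have "prob {\<omega> \<in> space M. t \<le> line_average (\<lambda>e. \<tau> e \<omega>) (mixed A B D) b lo hi} \<le>
    exp (- (card (grid_base (mixed A B D) b) * h powr (r - 1) * t / 2))"
    by (rule line_average_tail[OF _ _ \<open>lo \<le> hi\<close> \<open>1 \<le> h\<close> t]) (use A B in \<open>simp_all add: mixed_def\<close>)
  also have "\<dots> \<le> exp (- (real s ^ (CARD('d) - 1) * h powr (r - 1) * t / 2))"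
  proof -
    have "s ^ (CARD('d) - 1) \<le> card (grid_base (mixed A B D) b)"
      by (rule card_grid_base_mixed[OF A(3) B(3)])
    then have "real s ^ (CARD('d) - 1) \<le> card (grid_base (mixed A B D) b)"
      unfolding of_nat_power[symmetric] of_nat_le_iff .
    then have "real s ^ (CARD('d) - 1) * h powr (r - 1) * t \<le>
      card (grid_base (mixed A B D) b) * h powr (r - 1) * t"
      using t0 by (intro mult_right_mono) auto
    then show ?thesis by simp
  qed
  finally show ?thesis .
qed

text \<open>Since \<open>r\<close> is smaller than the dimension, a delay of order \<open>n\<close> at the scale \<open>2\<^sup>i\<close> costs an
  amount of order \<open>2 ^ ((d - r) i) n\<^sup>r\<close>, so that the delays allowed at the different scales can be taken summable.\<close>

definition decay :: real where
  "decay = (CARD('d) - r) / (2 * r)"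

lemma decay_pos: "0 < decay"
  using r_gt_1 r_less_dim by (simp add: decay_def)

text \<open>The first summand is the share of the delay granted to scale i. The second is
  \<open>2 * mgf_const\<close> times the segment length \<open>2 ^ Suc i\<close>; it guarantees that
  the tail bound applies with some \<open>h \<ge> 1\<close> and stays small as long as
  \<open>2 ^ i\<close> is a small fraction of n.\<close>

definition threshold :: "real \<Rightarrow> real \<Rightarrow> nat \<Rightarrow> real" where
  "threshold \<theta> n i = \<theta> * n * 2 powr (- decay * i) + 4 * mgf_const * 2 ^ i"

lemma cube_step_tail:
  assumes "0 < \<theta>" "0 < n"
  shows "prob {\<omega> \<in> space M. threshold \<theta> n i \<le>
      line_average (\<lambda>e. \<tau> e \<omega>) (mixed (cube y i) (cube y (Suc i)) D) b (y $ b) (y $ b + 2 ^ Suc i)} \<le>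
    exp (- (\<theta> powr r / (2 * (4 * mgf_const) powr (r - 1)) * 2 powr ((CARD('d) - r) / 2 * i) * n powr r))"
proof -
  let ?C = "4 * mgf_const" and ?t = "threshold \<theta> n i" and ?d = "CARD('d)"
  define a where "a = \<theta> * n * 2 powr (- decay * i)"
  have a: "0 < a" using assms by (simp add: a_def)
  have C: "0 < ?C" using mgf_const_pos by simp
  \<comment> \<open>The largest h that \<open>line_average_tail\<close> admits for this
    threshold.\<close>
  define h where "h = ?t / (?C * 2 ^ i)"
  have t: "?t = a + ?C * 2 ^ i" by (simp add: threshold_def a_def)
  have h: "1 \<le> h" "a / (?C * 2 ^ i) \<le> h" "?t = ?C * 2 ^ i * h"
    using a C by (simp_all add: h_def t field_simps)
  have "prob {\<omega> \<in> space M. ?t \<le>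
      line_average (\<lambda>e. \<tau> e \<omega>) (mixed (cube y i) (cube y (Suc i)) D) b (y $ b) (y $ b + 2 ^ Suc i)} \<le>
    exp (- (real (2 ^ i) ^ (?d - 1) * h powr (r - 1) * ?t / 2))"
    by (rule mixed_line_average_tail) (use h in \<open>simp_all\<close>)
  also have "\<dots> \<le> exp (- (real (2 ^ i) ^ (?d - 1) * (a / (?C * 2 ^ i)) powr (r - 1) * a / 2))"
  proof -
    have "(a / (?C * 2 ^ i)) powr (r - 1) * a \<le> h powr (r - 1) * ?t"
    proof (rule mult_mono)
      show "(a / (?C * 2 ^ i)) powr (r - 1) \<le> h powr (r - 1)"
        using a C h(2) r_gt_1 by (intro powr_mono2) auto
      show "a \<le> ?t" using t C by simp
    qed (use a in auto)
    then have "real (2 ^ i) ^ (?d - 1) * ((a / (?C * 2 ^ i)) powr (r - 1) * a) \<le>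
      real (2 ^ i) ^ (?d - 1) * (h powr (r - 1) * ?t)" by (rule mult_left_mono) simp
    then show ?thesis by (simp add: mult.assoc)
  qed
  also have "real (2 ^ i) ^ (?d - 1) * (a / (?C * 2 ^ i)) powr (r - 1) * a / 2 =
    \<theta> powr r / (2 * ?C powr (r - 1)) * 2 powr ((?d - r) / 2 * i) * n powr r"
  proof -
    have pow: "(2::real) ^ i = 2 powr i" by (simp add: powr_realpow)
    have e1: "real (2 ^ i) ^ (?d - 1) = 2 powr (real i * (real ?d - 1))"
      using dim by (simp add: pow powr_powr powr_realpow[symmetric] of_nat_diff)
    have e2: "(a / (?C * 2 ^ i)) powr (r - 1) * a = a powr r / (?C powr (r - 1) * 2 powr (real i * (r - 1)))"
    proof -
      have "a powr (r - 1) * a = a powr r" using a powr_add[of a "r - 1" 1] by simp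
      then show ?thesis by (simp add: powr_divide powr_mult pow powr_powr)
    qed
    have e3: "a powr r = \<theta> powr r * n powr r * 2 powr (- decay * i * r)"
      by (simp add: a_def powr_mult powr_powr)
    \<comment> \<open>The number of lines contributes \<open>i * (d - 1)\<close>, the factor
      \<open>a powr r\<close> takes away half of \<open>i * (d - r)\<close>, the length takes away
      \<open>i * (r - 1)\<close>; half of \<open>i * (d - r)\<close> remains.\<close>
    have e4: "2 powr (real i * (real ?d - 1)) * 2 powr (- decay * i * r) / 2 powr (real i * (r - 1)) =
      2 powr ((?d - r) / 2 * i)"
    proof -
      have "- decay * i * r = - (i * (?d - r) / 2)" using r_gt_1 by (simp add: decay_def field_simps)
      then show ?thesis
        unfolding powr_add[symmetric] powr_diff[symmetric] by (simp add: algebra_simps add_divide_distrib diff_divide_distrib)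
    qed
    have "real (2 ^ i) ^ (?d - 1) * (a / (?C * 2 ^ i)) powr (r - 1) * a / 2 =
      real (2 ^ i) ^ (?d - 1) * ((a / (?C * 2 ^ i)) powr (r - 1) * a) / 2" by (simp only: mult.assoc)
    also have "\<dots> = \<theta> powr r / (2 * ?C powr (r - 1)) *
        (2 powr (real i * (real ?d - 1)) * 2 powr (- decay * i * r) / 2 powr (real i * (r - 1))) * n powr r"
      unfolding e1 e2 e3 by (simp only: times_divide_eq_right times_divide_eq_left
          divide_divide_eq_left divide_divide_eq_right mult_ac)
    finally show ?thesis unfolding e4 .
  qed
  finally show ?thesis .
qed

text \<open>The exponent grows geometrically in i, so any rate I is reached from some scale on, and
  this scale is the same for all n and y.\<close>

lemma cube_step_tail_uniform:
  assumes "0 < \<theta>" "0 \<le> I"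
  obtains i0 where "\<And>i n y D b. i0 \<le> i \<Longrightarrow> 0 < n \<Longrightarrow> prob {\<omega> \<in> space M. threshold \<theta> n i \<le>
      line_average (\<lambda>e. \<tau> e \<omega>) (mixed (cube y i) (cube y (Suc i)) D) b (y $ b) (y $ b + 2 ^ Suc i)} \<le>
    exp (- I * n powr r)"
proof -
  define c where "c = \<theta> powr r / (2 * (4 * mgf_const) powr (r - 1))"
  have c: "0 < c" using assms mgf_const_pos by (simp add: c_def)
  define \<sigma> where "\<sigma> = 2 powr ((CARD('d) - r) / 2)"
  have \<sigma>: "1 < \<sigma>" using r_less_dim by (simp add: \<sigma>_def)
  have pow: "2 powr ((CARD('d) - r) / 2 * real i) = \<sigma> ^ i" for i
    unfolding \<sigma>_def by (rule two_powr_mult)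
  obtain i0 where i0: "I / c < \<sigma> ^ i0" using real_arch_pow[OF \<sigma>] by blast
  show ?thesis
  proof (rule that)
    fix i y D b and n :: real assume "i0 \<le> i" "0 < n"
    have "\<sigma> ^ i0 \<le> \<sigma> ^ i" using \<sigma> \<open>i0 \<le> i\<close> by (intro power_increasing) auto
    with i0 have "I / c \<le> \<sigma> ^ i" by linarith
    then have "I \<le> c * \<sigma> ^ i" using c by (simp add: pos_divide_le_eq mult.commute)
    then have "I * n powr r \<le> c * \<sigma> ^ i * n powr r" by (intro mult_right_mono) auto
    then have "exp (- (c * \<sigma> ^ i * n powr r)) \<le> exp (- I * n powr r)" by simp
    with cube_step_tail[OF \<open>0 < \<theta>\<close> \<open>0 < n\<close>, of i y D b]
    show "prob {\<omega> \<in> space M. threshold \<theta> n i \<le>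
      line_average (\<lambda>e. \<tau> e \<omega>) (mixed (cube y i) (cube y (Suc i)) D) b (y $ b) (y $ b + 2 ^ Suc i)} \<le>
      exp (- I * n powr r)" unfolding pow c_def[symmetric] by linarith
  qed
qed

lemma sum_threshold_le:
  assumes "0 \<le> \<theta>" "0 \<le> n"
  shows "(\<Sum>i<k. threshold \<theta> n i) \<le> \<theta> * n / (1 - 2 powr (- decay)) + 4 * mgf_const * 2 ^ k"
proof -
  define \<rho> where "\<rho> = 2 powr (- decay)"
  have \<rho>: "0 < \<rho>" "\<rho> < 1" using decay_pos by (simp_all add: \<rho>_def powr_less_one)
  have pow: "2 powr (- decay * real i) = \<rho> ^ i" for i
    unfolding \<rho>_def by (rule two_powr_mult)
  have "(\<Sum>i<k. \<rho> ^ i) \<le> 1 / (1 - \<rho>)"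
  proof -
    have "(\<Sum>i<k. \<rho> ^ i) = (1 - \<rho> ^ k) / (1 - \<rho>)" using \<rho> by (simp add: sum_gp_strict)
    also have "\<dots> \<le> 1 / (1 - \<rho>)" using \<rho> by (intro divide_right_mono) auto
    finally show ?thesis .
  qed
  then have "\<theta> * n * (\<Sum>i<k. \<rho> ^ i) \<le> \<theta> * n * (1 / (1 - \<rho>))"
    using assms by (intro mult_left_mono) auto
  moreover have "(\<Sum>i<k. (2::real) ^ i) \<le> 2 ^ k" by (simp add: sum_gp_strict)
  then have "4 * mgf_const * (\<Sum>i<k. 2 ^ i) \<le> 4 * mgf_const * 2 ^ k"
    using mgf_const_pos by (intro mult_left_mono) auto
  ultimately show ?thesis
    unfolding threshold_def pow sum.distrib sum_distrib_left[symmetric] \<rho>_def[symmetric] by simp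
qed

text \<open>L large edges cost \<open>L * \<alpha> * \<eta> powr r\<close> in the exponent. L is
  chosen before m because the box has to accommodate L shells and thus grows with L; its size only
  enters K.\<close>

lemma few_large_edges:
  assumes "0 < \<eta>" "0 \<le> I"
  obtains L where "\<And>m. \<exists>K>0. \<forall>v n. 0 < n \<longrightarrow>
    prob {\<omega> \<in> space M. \<exists>J\<subseteq>(`) ((+) v) ` box_edges m. card J = L \<and> (\<forall>e\<in>J. \<eta> * n < \<tau> e \<omega>)} \<le>
      K * exp (- I * n powr r)"
proof -
  have pos: "0 < \<alpha> * \<eta> powr r" using \<alpha>_pos assms by simp
  obtain L where L: "I < real L * (\<alpha> * \<eta> powr r)" using reals_Archimedean3[OF pos] by blast
  show ?thesis
  proof (rule that[of L])
    fix m
    let ?E = "box_edges m :: (int ^ 'd) set set"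
    let ?K = "2 ^ card ?E * \<beta>\<^sub>2 ^ L"
    have "prob {\<omega> \<in> space M. \<exists>J\<subseteq>(`) ((+) v) ` ?E. card J = L \<and> (\<forall>e\<in>J. \<eta> * n < \<tau> e \<omega>)} \<le>
      ?K * exp (- I * n powr r)" if n: "0 < n" for v and n :: real
    proof -
      have inj: "inj_on ((`) ((+) v)) ?E" using inj_image_translate by (rule inj_on_subset) simp
      have sub: "(`) ((+) v) ` ?E \<subseteq> lattice_edges" using subsetD[OF box_edges_subset[of m]] by auto
      have "prob {\<omega> \<in> space M. \<exists>J\<subseteq>(`) ((+) v) ` ?E. card J = L \<and> (\<forall>e\<in>J. \<eta> * n < \<tau> e \<omega>)} \<le>
        2 ^ card ((`) ((+) v) ` ?E) * (\<beta>\<^sub>2 * exp (- \<alpha> * (\<eta> * n) powr r)) ^ L"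
        using n assms by (intro many_large_edges sub) auto
      also have "\<dots> = ?K * exp (- (real L * (\<alpha> * \<eta> powr r)) * n powr r)"
        by (simp add: card_image[OF inj] power_mult_distrib exp_of_nat_mult[symmetric] powr_mult mult_ac)
      also have "\<dots> \<le> ?K * exp (- I * n powr r)"
        using L \<beta>\<^sub>2_pos by (intro mult_left_mono) (auto intro: mult_right_mono)
      finally show ?thesis .
    qed
    moreover have "0 < ?K" using \<beta>\<^sub>2_pos by simp
    ultimately show "\<exists>K>0. \<forall>v n. 0 < n \<longrightarrow>
      prob {\<omega> \<in> space M. \<exists>J\<subseteq>(`) ((+) v) ` ?E. card J = L \<and> (\<forall>e\<in>J. \<eta> * n < \<tau> e \<omega>)} \<le>
      K * exp (- I * n powr r)" by blast
  qed
qed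


subsection \<open>The union bound\<close>

lemma measurable_large_edges:
  assumes "finite B" "B \<subseteq> lattice_edges"
  shows "{\<omega> \<in> space M. \<exists>J\<subseteq>B. card J = L \<and> (\<forall>e\<in>J. t < \<tau> e \<omega>)} \<in> events"
proof -
  have "{\<omega> \<in> space M. \<forall>e\<in>J. t < \<tau> e \<omega>} \<in> events" if "J \<in> {J \<in> Pow B. card J = L}" for J
  proof (rule sets.sets_Collect_finite_All)
    show "finite J" using that assms finite_subset by blast
    fix e assume "e \<in> J"
    then have [measurable]: "\<tau> e \<in> borel_measurable M" using that assms by auto
    show "{\<omega> \<in> space M. t < \<tau> e \<omega>} \<in> events" by measurable
  qed
  then have "(\<Union>J\<in>{J \<in> Pow B. card J = L}. {\<omega> \<in> space M. \<forall>e\<in>J. t < \<tau> e \<omega>}) \<in> events"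
    using assms by (intro sets.finite_UN) auto
  also have "(\<Union>J\<in>{J \<in> Pow B. card J = L}. {\<omega> \<in> space M. \<forall>e\<in>J. t < \<tau> e \<omega>}) =
    {\<omega> \<in> space M. \<exists>J\<subseteq>B. card J = L \<and> (\<forall>e\<in>J. t < \<tau> e \<omega>)}" by blast
  finally show ?thesis .
qed

text \<open>A deterministic implication and a union bound, with the asymptotic estimates as
  hypotheses. Since y and y' depend on the weights, the events range over all candidates in the two
  boxes. The coefficient of p counts, per candidate and pair \<open>(D, b)\<close>, k cube scales
  and one transfer to the grid, and then the m steps through the bulk.\<close>

lemma upper_tail_finite:
  fixes w v :: "int ^ 'd" and s :: "nat \<Rightarrow> real" and R a t \<nu> \<kappa> p p4 p5 :: real and c q :: int
  defines "W \<equiv> \<lambda>h. 3 * 2 ^ h :: nat"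
  assumes w: "2 * int ((L + 1) * W h) < linf_norm w"
    and near: "\<And>i. i < h \<Longrightarrow> 2 ^ Suc i * t \<le> s i"
    and q: "0 < q"
    and c: "\<And>b. \<bar>w $ b - int m * v $ b\<bar> + int ((L + 1) * W h) \<le> c"
    and \<kappa>: "0 \<le> \<kappa>"
    and total: "\<kappa> + (2 * (CARD('d) * (\<Sum>i<k. s i)) + 2 * (CARD('d) * \<nu>) + m * a) \<le> R"
    and p1: "\<And>y i D b. h \<le> i \<Longrightarrow> i < k \<Longrightarrow> prob {\<omega> \<in> space M. s i \<le>
      line_average (\<lambda>e. \<tau> e \<omega>) (mixed (cube y i) (cube y (Suc i)) D) b (y $ b) (y $ b + 2 ^ Suc i)} \<le> p"
    and p2: "\<And>y D b. prob {\<omega> \<in> space M. \<nu> \<le>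
      line_average (\<lambda>e. \<tau> e \<omega>) (mixed (cube y k) (spaced q k) D) b (- c) (c + q * 2 ^ k)} \<le> p"
    and p2': "\<And>y D b. prob {\<omega> \<in> space M. \<nu> \<le>
      line_average (\<lambda>e. \<tau> e \<omega>) (mixed (shift (of_nat m * v) (spaced q k)) (cube y k) D) b
        (int m * v $ b - c) (int m * v $ b + c + q * 2 ^ k)} \<le> p"
    and p3: "\<And>i. prob {\<omega> \<in> space M. a \<le>
      average (\<lambda>z. T (z + of_nat i * v) (z + of_nat i * v + v) \<omega>) (grid (spaced q k))} \<le> p"
    and p4: "\<And>u. prob {\<omega> \<in> space M. \<exists>J\<subseteq>(`) ((+) u) ` box_edges ((L + 1) * W h).
      card J = L \<and> (\<forall>e\<in>J. t < \<tau> e \<omega>)} \<le> p4"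
    and p5: "prob {\<omega> \<in> space M. discrete_capacity TYPE('d) r * 2 powr (1 - r) * \<kappa> powr r \<le>
      (\<Sum>e\<in>box_edges ((L + 1) * W h) \<union> (`) ((+) w) ` box_edges ((L + 1) * W h). \<tau> e \<omega> powr r)} \<le> p5"
  shows "prob {\<omega> \<in> space M. R \<le> T 0 w \<omega>} \<le> p5 + 2 * p4 +
    real (2 * card (lattice_box ((L + 1) * W h) (0 :: int ^ 'd)) * card (UNIV :: ('d set \<times> 'd) set) * (k + 1) + m) * p"
proof -
  let ?m = "(L + 1) * W h"
  let ?Y = "lattice_box ?m (0 :: int ^ 'd)" and ?U = "UNIV :: ('d set \<times> 'd) set"
  let ?E = "box_edges ?m :: (int ^ 'd) set set"
  define LA where "LA \<omega> = line_average (\<lambda>e. \<tau> e \<omega>)" for \<omega>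
  have LA_meas [measurable]: "(\<lambda>\<omega>. LA \<omega> C b lo hi) \<in> borel_measurable M" for C b lo hi
    unfolding LA_def by measurable
  define A1 where "A1 y i = (\<lambda>(D, b). {\<omega> \<in> space M. s i \<le>
      LA \<omega> (mixed (cube y i) (cube y (Suc i)) D) b (y $ b) (y $ b + 2 ^ Suc i)})" for y :: "int ^ 'd" and i
  define A2 where "A2 y = (\<lambda>(D, b). {\<omega> \<in> space M. \<nu> \<le>
      LA \<omega> (mixed (cube y k) (spaced q k) D) b (- c) (c + q * 2 ^ k)})" for y :: "int ^ 'd"
  define A2' where "A2' y = (\<lambda>(D, b). {\<omega> \<in> space M. \<nu> \<le>
      LA \<omega> (mixed (shift (of_nat m * v) (spaced q k)) (cube y k) D) b
        (int m * v $ b - c) (int m * v $ b + c + q * 2 ^ k)})" for y :: "int ^ 'd"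
  define A3 where "A3 i = {\<omega> \<in> space M. a \<le>
      average (\<lambda>z. T (z + of_nat i * v) (z + of_nat i * v + v) \<omega>) (grid (spaced q k))}" for i :: nat
  define A4 where "A4 u = {\<omega> \<in> space M. \<exists>J\<subseteq>(`) ((+) u) ` ?E. card J = L \<and> (\<forall>e\<in>J. t < \<tau> e \<omega>)}" for u
  define A5 where "A5 = {\<omega> \<in> space M. discrete_capacity TYPE('d) r * 2 powr (1 - r) * \<kappa> powr r \<le>
      (\<Sum>e\<in>?E \<union> (`) ((+) w) ` ?E. \<tau> e \<omega> powr r)}"
  define B1 where "B1 = (\<Union>(y, i, z)\<in>(?Y \<union> (+) w ` ?Y) \<times> {h..<k} \<times> ?U. A1 y i z)"
  define B2 where "B2 = (\<Union>(y, z)\<in>?Y \<times> ?U. A2 y z) \<union> (\<Union>(y, z)\<in>(+) w ` ?Y \<times> ?U. A2' y z)"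
  define B3 where "B3 = (\<Union>i<m. A3 i)"
  have finY: "finite ?Y" by (rule finite_lattice_box)
  have m1: "A1 y i z \<in> events" for y i z unfolding A1_def by (cases z) simp
  have m2: "A2 y z \<in> events" for y z unfolding A2_def by (cases z) simp
  have m2': "A2' y z \<in> events" for y z unfolding A2'_def by (cases z) simp
  have m3: "A3 i \<in> events" for i unfolding A3_def average_def by measurable
  have Esub: "?E \<union> (`) ((+) u) ` ?E \<subseteq> lattice_edges" for u
    using subsetD[OF box_edges_subset[of ?m]] by auto
  have m4: "A4 u \<in> events" for u unfolding A4_def
    using Esub[of u] by (intro measurable_large_edges) auto
  have m5: "A5 \<in> events"
  proof -
    have meas: "(\<lambda>\<omega>. \<Sum>e\<in>?E \<union> (`) ((+) w) ` ?E. \<tau> e \<omega> powr r) \<in> borel_measurable M"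
    proof (rule borel_measurable_sum)
      fix e assume "e \<in> ?E \<union> (`) ((+) w) ` ?E"
      then have [measurable]: "\<tau> e \<in> borel_measurable M" using subsetD[OF Esub[of w]] by simp
      show "(\<lambda>\<omega>. \<tau> e \<omega> powr r) \<in> borel_measurable M" by measurable
    qed
    show ?thesis unfolding A5_def by (intro borel_measurable_le borel_measurable_const meas)
  qed
  have mB1: "B1 \<in> events" unfolding B1_def using finY by (intro sets.finite_UN) (auto simp: m1)
  have mB2: "B2 \<in> events" unfolding B2_def using finY by (intro sets.Un sets.finite_UN) (auto simp: m2 m2')
  have mB3: "B3 \<in> events" unfolding B3_def using m3 by (intro sets.finite_UN) auto
  have "0 \<le> p" by (rule order_trans[OF measure_nonneg p3[of 0]])
  have card_shift_Y: "card ((+) w ` ?Y) = card ?Y" by (rule card_image) simp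
  have pB1: "prob B1 \<le> real (2 * card ?Y * k * card ?U) * p"
  proof -
    have "prob B1 \<le> card ((?Y \<union> (+) w ` ?Y) \<times> {h..<k} \<times> ?U) * p" unfolding B1_def
    proof (rule prob_UN_le)
      show "finite ((?Y \<union> (+) w ` ?Y) \<times> {h..<k} \<times> ?U)" using finY by simp
      fix x assume x: "x \<in> (?Y \<union> (+) w ` ?Y) \<times> {h..<k} \<times> ?U"
      obtain y i D b where x': "x = (y, i, (D, b))" by (cases x) auto
      show "(case x of (y, i, z) \<Rightarrow> A1 y i z) \<in> events" unfolding x' by (simp add: m1)
      have "h \<le> i" "i < k" using x unfolding x' by simp_all
      then show "prob (case x of (y, i, z) \<Rightarrow> A1 y i z) \<le> p"
        unfolding x' A1_def LA_def prod.case by (rule p1)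
    qed
    also have "\<dots> \<le> real (2 * card ?Y * k * card ?U) * p"
    proof (intro mult_right_mono \<open>0 \<le> p\<close>)
      have "card (?Y \<union> (+) w ` ?Y) \<le> 2 * card ?Y" using card_Un_le[of ?Y "(+) w ` ?Y"] card_shift_Y by simp
      then have "card ((?Y \<union> (+) w ` ?Y) \<times> {h..<k} \<times> ?U) \<le> (2 * card ?Y) * (k * card ?U)"
        unfolding card_cartesian_product by (intro mult_le_mono) auto
      then show "real (card ((?Y \<union> (+) w ` ?Y) \<times> {h..<k} \<times> ?U)) \<le> real (2 * card ?Y * k * card ?U)"
        unfolding of_nat_le_iff by (simp only: mult.assoc)
    qed
    finally show ?thesis .
  qed
  have pB2: "prob B2 \<le> real (2 * card ?Y * card ?U) * p"
  proof -
    have "prob (\<Union>(y, z)\<in>?Y \<times> ?U. A2 y z) \<le> card (?Y \<times> ?U) * p"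
    proof (rule prob_UN_le)
      show "finite (?Y \<times> ?U)" using finY by simp
      fix x :: "(int ^ 'd) \<times> 'd set \<times> 'd"
      obtain y D b where x': "x = (y, (D, b))" by (cases x) auto
      show "(case x of (y, z) \<Rightarrow> A2 y z) \<in> events" unfolding x' by (simp add: m2)
      show "prob (case x of (y, z) \<Rightarrow> A2 y z) \<le> p"
        unfolding x' A2_def LA_def prod.case by (rule p2)
    qed
    moreover have "prob (\<Union>(y, z)\<in>(+) w ` ?Y \<times> ?U. A2' y z) \<le> card ((+) w ` ?Y \<times> ?U) * p"
    proof (rule prob_UN_le)
      show "finite ((+) w ` ?Y \<times> ?U)" using finY by simp
      fix x :: "(int ^ 'd) \<times> 'd set \<times> 'd"
      obtain y D b where x': "x = (y, (D, b))" by (cases x) auto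
      show "(case x of (y, z) \<Rightarrow> A2' y z) \<in> events" unfolding x' by (simp add: m2')
      show "prob (case x of (y, z) \<Rightarrow> A2' y z) \<le> p"
        unfolding x' A2'_def LA_def prod.case by (rule p2')
    qed
    moreover have "prob B2 \<le> prob (\<Union>(y, z)\<in>?Y \<times> ?U. A2 y z) + prob (\<Union>(y, z)\<in>(+) w ` ?Y \<times> ?U. A2' y z)"
      unfolding B2_def using finY by (intro measure_Un_le sets.finite_UN) (auto simp: m2 m2')
    ultimately have "prob B2 \<le> card (?Y \<times> ?U) * p + card ((+) w ` ?Y \<times> ?U) * p"
      by linarith
    also have "\<dots> = real (2 * card ?Y * card ?U) * p"
      unfolding card_cartesian_product card_shift_Y
      by (simp only: of_nat_mult of_nat_numeral mult.assoc mult_2[symmetric])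
    finally show ?thesis .
  qed
  have pB3: "prob B3 \<le> real m * p"
  proof -
    have "prob (A3 i) \<le> p" for i unfolding A3_def by (rule p3)
    then have "prob B3 \<le> card {..<m} * p" unfolding B3_def by (intro prob_UN_le m3) simp_all
    then show ?thesis by simp
  qed
  \<comment> \<open>The order matters: shells without large edges are found first, the capacity then
    selects y and y' on these very shells, and only then are y and \<open>w + y'\<close> connected
    through the bulk.\<close>
  have good: "T 0 w \<omega> < R" if \<omega>: "\<omega> \<in> space M" and
    not: "\<omega> \<notin> A5" "\<omega> \<notin> A4 0" "\<omega> \<notin> A4 w" "\<omega> \<notin> B1" "\<omega> \<notin> B2" "\<omega> \<notin> B3" for \<omega>
  proof -
    let ?\<sigma> = "\<lambda>e. \<tau> e \<omega>"
    have \<tau>: "nonneg_weights ?\<sigma>" by (rule nonneg_weights_\<tau>[OF \<omega>])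
    have "\<not> (\<exists>J\<subseteq>?E. card J = L \<and> (\<forall>e\<in>J. t < ?\<sigma> e))"
      using not(2) \<omega> by (simp add: A4_def)
    from good_shell[OF this[unfolded W_def]] obtain j where j: "j \<in> {1..L}"
      "\<And>y e. linf_norm y = int (j * W h) \<Longrightarrow> e \<in> lattice_edges \<Longrightarrow>
        e \<subseteq> {z. \<forall>b. z $ b \<in> {y $ b..y $ b + 2 ^ h}} \<Longrightarrow> ?\<sigma> e \<le> t"
      unfolding W_def by blast
    \<comment> \<open>\<open>good_shell\<close> speaks of boxes at the origin; for the other end it
      is applied to the weights translated by w.\<close>
    have "\<not> (\<exists>J\<subseteq>?E. card J = L \<and> (\<forall>e\<in>J. t < ?\<sigma> ((+) w ` e)))"
    proof
      assume "\<exists>J\<subseteq>?E. card J = L \<and> (\<forall>e\<in>J. t < ?\<sigma> ((+) w ` e))"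
      then obtain J where J: "J \<subseteq> ?E" "card J = L" "\<forall>e\<in>J. t < ?\<sigma> ((+) w ` e)" by blast
      have "inj_on ((`) ((+) w)) J" using inj_image_translate by (rule inj_on_subset) simp
      then have "card ((`) ((+) w) ` J) = L" using J(2) by (simp add: card_image)
      moreover have "(`) ((+) w) ` J \<subseteq> (`) ((+) w) ` ?E" using J(1) by blast
      moreover have "\<forall>e\<in>(`) ((+) w) ` J. t < ?\<sigma> e" using J(3) by blast
      ultimately show False using not(3) \<omega> unfolding A4_def by blast
    qed
    from good_shell[OF this[unfolded W_def]] obtain j' where j': "j' \<in> {1..L}"
      "\<And>y e. linf_norm y = int (j' * W h) \<Longrightarrow> e \<in> lattice_edges \<Longrightarrow>
        e \<subseteq> {z. \<forall>b. z $ b \<in> {y $ b..y $ b + 2 ^ h}} \<Longrightarrow> ?\<sigma> ((+) w ` e) \<le> t"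
      unfolding W_def by blast
    have W: "1 \<le> W h" by (simp add: W_def)
    have jW: "1 \<le> j * W h" "j * W h \<le> ?m" "1 \<le> j' * W h" "j' * W h \<le> ?m"
      using mult_le_mono[of 1 j 1 "W h"] mult_le_mono[of 1 j' 1 "W h"]
        mult_le_mono1[of j "L + 1" "W h"] mult_le_mono1[of j' "L + 1" "W h"] j(1) j'(1) W
      by simp_all
    obtain y y' where y: "linf_norm y = int (j * W h)" "linf_norm y' = int (j' * W h)"
      "passage_time ?\<sigma> 0 y + passage_time ?\<sigma> w (w + y') < \<kappa>"
    proof (rule capacity_two_boxes[OF \<tau> less_imp_le[OF r_gt_1] jW w \<kappa>])
      show "(\<Sum>e\<in>?E \<union> (`) ((+) w) ` ?E. ?\<sigma> e powr r) < discrete_capacity TYPE('d) r * 2 powr (1 - r) * \<kappa> powr r"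
        using not(1) \<omega> by (simp add: A5_def)
    qed (erule (2) that)
    have yY: "y \<in> ?Y" "y' \<in> ?Y" 
      unfolding lattice_box_0 mem_Collect_eq y(1,2) of_nat_le_iff by (rule jW)+
    have far: "line_average ?\<sigma> (mixed (cube u i) (cube u (Suc i)) D) b (u $ b) (u $ b + 2 ^ Suc i) \<le> s i"
      if "u \<in> ?Y \<union> (+) w ` ?Y" "h \<le> i" "i < k" for u i D b
    proof -
      have "(u, i, (D, b)) \<in> (?Y \<union> (+) w ` ?Y) \<times> {h..<k} \<times> ?U" using that by simp
      then have "\<omega> \<notin> A1 u i (D, b)" using not(4) unfolding B1_def by blast
      then show ?thesis using \<omega> by (simp add: A1_def LA_def)
    qed
    let ?S = "CARD('d) * (\<Sum>i<k. s i)"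
    have start: "average (passage_time ?\<sigma> y) (grid (cube y k)) \<le> ?S"
    proof (rule average_cube[OF \<tau>])
      show "\<tau> e \<omega> \<le> t" if "e \<in> lattice_edges" "e \<subseteq> {z. \<forall>b. z $ b \<in> {y $ b..y $ b + 2 ^ h}}" for e
        by (rule j(2)[OF y(1) that])
      show "2 ^ Suc i * t \<le> s i" if "i < h" for i by (rule near[OF that])
    qed (use far yY in blast)
    have stop: "average (passage_time ?\<sigma> (w + y')) (grid (cube (w + y') k)) \<le> ?S"
    proof (rule average_cube[OF \<tau>])
      fix e assume e: "e \<in> lattice_edges" "e \<subseteq> {z. \<forall>b. z $ b \<in> {(w + y') $ b..(w + y') $ b + 2 ^ h}}"
      have "(+) (- w) ` e \<subseteq> {z. \<forall>b. z $ b \<in> {y' $ b..y' $ b + 2 ^ h}}"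
      proof
        fix z assume "z \<in> (+) (- w) ` e"
        then obtain z' where z': "z = - w + z'" "z' \<in> e" by blast
        then have "\<forall>b. z' $ b \<in> {(w + y') $ b..(w + y') $ b + 2 ^ h}" using e(2) by blast
        then show "z \<in> {z. \<forall>b. z $ b \<in> {y' $ b..y' $ b + 2 ^ h}}" by (simp add: z'(1) algebra_simps)
      qed
      moreover have "(+) (- w) ` e \<in> lattice_edges" using e(1) by (simp only: translate_lattice_edges_iff)
      ultimately have "?\<sigma> ((+) w ` (+) (- w) ` e) \<le> t" by (intro j'(2)[OF y(2)])
      then show "\<tau> e \<omega> \<le> t" by (simp add: image_image)
    next
      show "2 ^ Suc i * t \<le> s i" if "i < h" for i by (rule near[OF that])
    qed (use far yY in blast)
    have "passage_time ?\<sigma> y (w + y') \<le> 2 * ?S + 2 * (CARD('d) * \<nu>) + m * a"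
    proof (rule passage_time_through_bulk[OF \<tau> _ _ start stop, where C = "spaced q k" and w = "of_nat m * v"])
      fix g :: "int ^ 'd \<Rightarrow> real" assume g: "\<And>z z'. g z' \<le> g z + passage_time ?\<sigma> z z'"
      show "average (\<lambda>z. g (z + of_nat m * v)) (grid (spaced q k)) \<le> average g (grid (spaced q k)) + m * a"
      proof (rule T_chain_average[OF \<omega>])
        show "finite (grid (spaced q k))" by (intro finite_grid) simp
        show "g z' \<le> g z + T z z' \<omega>" for z z' using g[of z' z] by (simp add: T_def)
        show "average (\<lambda>z. T (z + of_nat i * v) (z + of_nat i * v + v) \<omega>) (grid (spaced q k)) \<le> a"
          if "i < m" for i
        proof -
          have "\<omega> \<notin> A3 i" using not(6) that unfolding B3_def by blast
          then show ?thesis using \<omega> by (simp add: A3_def)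
        qed
      qed
    next
      fix b
      \<comment> \<open>c dominates the radius of the boxes together with the mismatch between w and
        m times v, so segments with a margin of c contain both the cubes and the grids.\<close>
      have m_c: "int ?m \<le> c" "\<bar>w $ b - int m * v $ b\<bar> + int ?m \<le> c" using c[of b] by linarith+
      have yb: "\<bar>y $ b\<bar> \<le> int ?m" "\<bar>y' $ b\<bar> \<le> int ?m"
        using yY order_trans[OF abs_nth_le_linf_norm] unfolding lattice_box_0 by blast+
      have pow: "(2::int) ^ k \<le> q * 2 ^ k" "(0::int) < 2 ^ k"
        using mult_right_mono[of 1 q "2 ^ k"] q by simp_all
      have sp: "spaced q k b \<subseteq> {0..q * 2 ^ k}" using q by (intro spaced_subset) simp
      show "cube y k b \<subseteq> {- c..c + q * 2 ^ k}"
      proof (rule order_trans[OF cube_subset[OF order_refl]])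
        have "- c \<le> y $ b" "y $ b + 2 ^ k \<le> c + q * 2 ^ k" using m_c(1) yb(1) pow by linarith+
        then show "{y $ b..y $ b + 2 ^ k} \<subseteq> {- c..c + q * 2 ^ k}" by simp
      qed
      show "spaced q k b \<subseteq> {- c..c + q * 2 ^ k}"
      proof (rule order_trans[OF sp])
        have "- c \<le> 0" "q * 2 ^ k \<le> c + q * 2 ^ k" using m_c(1) by linarith+
        then show "{0..q * 2 ^ k} \<subseteq> {- c..c + q * 2 ^ k}" by simp
      qed
      show "cube (w + y') k b \<subseteq> {int m * v $ b - c..int m * v $ b + c + q * 2 ^ k}"
      proof (rule order_trans[OF cube_subset[OF order_refl]])
        have "(w + y') $ b = w $ b + y' $ b" by simp
        then have "int m * v $ b - c \<le> (w + y') $ b" "(w + y') $ b + 2 ^ k \<le> int m * v $ b + c + q * 2 ^ k"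
          using m_c(2) yb(2) pow by linarith+
        then show "{(w + y') $ b..(w + y') $ b + 2 ^ k} \<subseteq> {int m * v $ b - c..int m * v $ b + c + q * 2 ^ k}"
          by simp
      qed
      show "shift (of_nat m * v) (spaced q k) b \<subseteq> {int m * v $ b - c..int m * v $ b + c + q * 2 ^ k}"
      proof
        fix x assume "x \<in> shift (of_nat m * v) (spaced q k) b"
        then obtain x' where "x = x' + (of_nat m * v) $ b" "x' \<in> spaced q k b" unfolding shift_def by blast
        moreover have "(of_nat m * v) $ b = int m * v $ b" by (simp add: of_nat_index)
        ultimately have "x = x' + int m * v $ b" "0 \<le> x'" "x' \<le> q * 2 ^ k" using sp by auto
        then have "int m * v $ b - c \<le> x" "x \<le> int m * v $ b + c + q * 2 ^ k" using m_c(1) by linarith+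
        then show "x \<in> {int m * v $ b - c..int m * v $ b + c + q * 2 ^ k}" by simp
      qed
    next
      fix D and b :: 'd
      have "\<omega> \<notin> A2 y (D, b)" using not(5) yY unfolding B2_def by blast
      then show "line_average ?\<sigma> (mixed (cube y k) (spaced q k) D) b (- c) (c + q * 2 ^ k) \<le> \<nu>"
        using \<omega> by (simp add: A2_def LA_def)
      have "\<omega> \<notin> A2' (w + y') (D, b)" using not(5) yY unfolding B2_def by blast
      then show "line_average ?\<sigma> (mixed (shift (of_nat m * v) (spaced q k)) (cube (w + y') k) D) b
          (int m * v $ b - c) (int m * v $ b + c + q * 2 ^ k) \<le> \<nu>"
        using \<omega> by (simp add: A2'_def LA_def)
    qed simp_all
    moreover have "T 0 w \<omega> \<le> passage_time ?\<sigma> 0 y + passage_time ?\<sigma> y (w + y') + passage_time ?\<sigma> w (w + y')"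
      using passage_time_triangle[OF \<tau>, of 0 w y] passage_time_triangle[OF \<tau>, of y w "w + y'"]
        passage_time_commute[of ?\<sigma> w "w + y'"] by (simp add: T_def)
    ultimately show ?thesis using y(3) total by linarith
  qed
  have "{\<omega> \<in> space M. R \<le> T 0 w \<omega>} \<subseteq> A5 \<union> (A4 0 \<union> A4 w) \<union> (B1 \<union> B2 \<union> B3)"
  proof (rule subsetI, rule ccontr)
    fix \<omega> assume \<omega>: "\<omega> \<in> {\<omega> \<in> space M. R \<le> T 0 w \<omega>}" "\<omega> \<notin> A5 \<union> (A4 0 \<union> A4 w) \<union> (B1 \<union> B2 \<union> B3)"
    then have "T 0 w \<omega> < R" by (intro good) auto
    with \<omega>(1) show False by simp
  qed
  then have "prob {\<omega> \<in> space M. R \<le> T 0 w \<omega>} \<le> prob (A5 \<union> (A4 0 \<union> A4 w) \<union> (B1 \<union> B2 \<union> B3))"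
    using m4 m5 mB1 mB2 mB3 by (intro finite_measure_mono) auto
  also have "\<dots> \<le> prob (A5 \<union> (A4 0 \<union> A4 w)) + prob (B1 \<union> B2 \<union> B3)"
    using m4 m5 mB1 mB2 mB3 by (intro measure_Un_le) auto
  also have "prob (A5 \<union> (A4 0 \<union> A4 w)) \<le> prob A5 + prob (A4 0 \<union> A4 w)"
    using m4 m5 by (intro measure_Un_le) auto
  also have "prob (A4 0 \<union> A4 w) \<le> prob (A4 0) + prob (A4 w)" using m4 by (intro measure_Un_le) auto
  also have "prob (B1 \<union> B2 \<union> B3) \<le> prob (B1 \<union> B2) + prob B3" using mB1 mB2 mB3 by (intro measure_Un_le) auto
  also have "prob (B1 \<union> B2) \<le> prob B1 + prob B2" using mB1 mB2 by (intro measure_Un_le) auto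
  finally have "prob {\<omega> \<in> space M. R \<le> T 0 w \<omega>} \<le>
    prob A5 + (prob (A4 0) + prob (A4 w)) + (prob B1 + prob B2 + prob B3)" by simp
  moreover have "prob A5 \<le> p5" "prob (A4 0) \<le> p4" "prob (A4 w) \<le> p4"
    using p4[of 0] p4[of w] p5 by (simp_all only: A4_def A5_def)
  ultimately have "prob {\<omega> \<in> space M. R \<le> T 0 w \<omega>} \<le> p5 + 2 * p4 +
    (real (2 * card ?Y * k * card ?U) * p + real (2 * card ?Y * card ?U) * p + real m * p)"
    using pB1 pB2 pB3 by linarith
  also have "real (2 * card ?Y * k * card ?U) * p + real (2 * card ?Y * card ?U) * p + real m * p =
    real (2 * card ?Y * card ?U * (k + 1) + m) * p"
    by (simp only: of_nat_mult of_nat_add of_nat_1 of_nat_numeral distrib_left distrib_right mult_1_right mult_ac)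
  finally show ?thesis .
qed

end

section \<open>Growth rates, dyadic sizes and rounding\<close>

lemma eventually_powr_le_power:
  assumes "r < real D" "0 < c"
  shows "\<forall>\<^sub>F n :: nat in sequentially. I * real n powr r \<le> c * real n ^ D"
proof -
  have "filterlim (\<lambda>n :: nat. real n powr (real D - r)) at_top sequentially"
    using assms(1) by real_asymp
  then have "\<forall>\<^sub>F n :: nat in sequentially. I / c \<le> real n powr (real D - r)"
    by (simp add: filterlim_at_top)
  then show ?thesis using eventually_gt_at_top[of 0]
  proof eventually_elim
    case (elim n)
    then have n: "0 < real n" by simp
    have "I / c * c \<le> real n powr (real D - r) * c" using elim assms by (intro mult_right_mono) auto
    then have "I \<le> c * real n powr (real D - r)" using assms by (simp add: mult.commute)
    then have "I * real n powr r \<le> c * real n powr (real D - r) * real n powr r"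
      by (rule mult_right_mono) simp
    also have "\<dots> = c * real n ^ D" using n by (simp add: mult.assoc powr_add[symmetric] powr_realpow)
    finally show ?case .
  qed
qed

lemma dyadic_approximation:
  assumes "1 \<le> y"
  obtains k :: nat where "2 ^ k \<le> (y :: real)" "y / 2 \<le> 2 ^ k"
proof -
  have "1 \<le> nat \<lfloor>y\<rfloor>" using assms by (simp add: le_nat_floor)
  then obtain k where k: "2 ^ k \<le> nat \<lfloor>y\<rfloor>" "nat \<lfloor>y\<rfloor> < 2 ^ (k + 1)"
    using ex_power_ivl1[of 2 "nat \<lfloor>y\<rfloor>"] by auto
  have "real (2 ^ k) \<le> real (nat \<lfloor>y\<rfloor>)" using k(1) by (simp only: of_nat_le_iff)
  also have "\<dots> \<le> y" using assms by simp
  finally have 1: "2 ^ k \<le> y" by simp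
  have "real (nat \<lfloor>y\<rfloor> + 1) \<le> real (2 ^ (k + 1))" using k(2) by (simp only: of_nat_le_iff Suc_le_eq Suc_eq_plus1[symmetric])
  moreover have "y \<le> real (nat \<lfloor>y\<rfloor> + 1)" using assms by (simp add: of_nat_nat) linarith
  ultimately have "y / 2 \<le> 2 ^ k" by simp
  with 1 show ?thesis by (rule that)
qed

text \<open>The three contributions are the rounding in each of the \<open>n div K\<close> steps,
  the remainder of n modulo K, and the rounding of the endpoint.\<close>

lemma vec_floor_multiple_close:
  fixes x :: "real ^ 'd::finite"
  assumes "0 < K" "\<And>b. \<bar>x $ b\<bar> \<le> real X"
  shows "\<bar>vec_floor (real n *\<^sub>R x) $ b - int (n div K) * vec_floor (real K *\<^sub>R x) $ b\<bar> \<le> int (n div K + K * X + 1)"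
proof -
  let ?m = "n div K"
  have n: "real n = real ?m * real K + real (n mod K)"
    by (metis div_mult_mod_eq of_nat_add of_nat_mult)
  define f where "f = real n * x $ b - real_of_int \<lfloor>real n * x $ b\<rfloor>"
  define g where "g = real K * x $ b - real_of_int \<lfloor>real K * x $ b\<rfloor>"
  have f: "0 \<le> f" "f \<le> 1" unfolding f_def by linarith+
  have g: "0 \<le> g" "g \<le> 1" unfolding g_def by linarith+
  have eq: "real_of_int (\<lfloor>real n * x $ b\<rfloor> - int ?m * \<lfloor>real K * x $ b\<rfloor>) = real (n mod K) * x $ b - f + real ?m * g"
    unfolding f_def g_def by (simp add: n distrib_right right_diff_distrib mult.assoc)
  have "\<bar>real (n mod K) * x $ b\<bar> \<le> real K * real X"
    unfolding abs_mult using assms by (intro mult_mono) (auto intro: less_imp_le)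
  moreover have "0 \<le> real ?m * g" "real ?m * g \<le> real ?m" using g by (simp_all add: mult_left_le)
  ultimately have "\<bar>real (n mod K) * x $ b - f + real ?m * g\<bar> \<le> real ?m + real K * real X + 1"
    using f by linarith
  then have "real_of_int \<bar>\<lfloor>real n * x $ b\<rfloor> - int ?m * \<lfloor>real K * x $ b\<rfloor>\<bar> \<le> real_of_int (int (?m + K * X + 1))"
    unfolding of_int_abs eq by simp
  then show ?thesis unfolding of_int_le_iff vec_floor_def by simp
qed

context fpp
begin

text \<open>The constants are fixed in the order i0, \<eta>, L, K, q, \<delta>, and only then does n
  grow; the largest cubes have side \<open>2 ^ k\<close> comparable to \<open>\<delta> * n\<close>.
  The moment at \<gamma> sets the rate I, which every other error has to match.\<close>

lemma upper_tail_bound: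
  fixes x :: "real ^ 'd"
  assumes "x \<noteq> 0" and \<epsilon>: "0 < \<epsilon>" "\<epsilon> < \<xi>" and \<gamma>: "0 \<le> \<gamma>" "\<gamma> < \<alpha>"
  obtains K where "0 < K" "\<forall>\<^sub>F n in sequentially.
    prob {\<omega> \<in> space M. (time_constant M \<tau> x + \<xi>) * real n \<le> T 0 (vec_floor (real n *\<^sub>R x)) \<omega>} \<le>
    K * real n * exp (- (\<gamma> * discrete_capacity TYPE('d) r * 2 powr (1 - r) * (\<xi> - \<epsilon>) powr r) * real n powr r)"
proof -
  let ?\<mu> = "time_constant M \<tau> x" and ?cap = "discrete_capacity TYPE('d) r" and ?C = mgf_const
  define d where "d = real CARD('d)"
  have d: "2 \<le> d" using dim by (simp add: d_def)
  have C: "0 < ?C" by (rule mgf_const_pos)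
  define I where "I = \<gamma> * ?cap * 2 powr (1 - r) * (\<xi> - \<epsilon>) powr r"
  have "0 \<le> ?cap" using r_gt_1 by (intro discrete_capacity_nonneg) simp
  then have I: "0 \<le> I" using \<gamma> by (simp add: I_def)
  define \<rho> where "\<rho> = 2 powr (- decay)"
  have \<rho>: "0 < \<rho>" "\<rho> < 1" using decay_pos by (simp_all add: \<rho>_def powr_less_one)
  \<comment> \<open>The factor \<open>1 - \<rho>\<close> cancels the geometric series: the
    thresholds sum to at most \<open>\<epsilon>1 * n\<close>, apart from the part proportional to
    \<open>2 ^ k\<close>.\<close>
  define \<theta> where "\<theta> = (1 - \<rho>) * \<epsilon> / (8 * d)"
  have \<theta>: "0 < \<theta>" using \<rho> \<epsilon> d by (simp add: \<theta>_def)
  define \<epsilon>1 where "\<epsilon>1 = \<epsilon> / (8 * d)"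
  have \<epsilon>1: "0 < \<epsilon>1" using \<epsilon> d by (simp add: \<epsilon>1_def)
  obtain i0 where i0: "\<And>i n y D b. i0 \<le> i \<Longrightarrow> 0 < n \<Longrightarrow> prob {\<omega> \<in> space M. threshold \<theta> n i \<le>
      line_average (\<lambda>e. \<tau> e \<omega>) (mixed (cube y i) (cube y (Suc i)) D) b (y $ b) (y $ b + 2 ^ Suc i)} \<le>
    exp (- I * n powr r)"
    using cube_step_tail_uniform[OF \<theta> I] by blast
  \<comment> \<open>Small enough that, for i < i0, a segment of \<open>2 ^ Suc i\<close> edges with
    weights up to \<open>\<eta> * n\<close> stays below the threshold of scale i.\<close>
  define \<eta> where "\<eta> = \<theta> * 2 powr (- decay * i0) / 2 ^ i0"
  have \<eta>: "0 < \<eta>" using \<theta> by (simp add: \<eta>_def)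
  obtain L where L: "\<And>m. \<exists>K>0. \<forall>v n. 0 < n \<longrightarrow>
    prob {\<omega> \<in> space M. \<exists>J\<subseteq>(`) ((+) v) ` box_edges m. card J = L \<and> (\<forall>e\<in>J. \<eta> * n < \<tau> e \<omega>)} \<le>
      K * exp (- I * n powr r)"
    using few_large_edges[OF \<eta> I] by blast
  define m0 where "m0 = (L + 1) * (3 * 2 ^ i0)"
  obtain K4 where K4: "0 < K4" "\<And>v n. 0 < n \<Longrightarrow>
    prob {\<omega> \<in> space M. \<exists>J\<subseteq>(`) ((+) v) ` box_edges m0. card J = L \<and> (\<forall>e\<in>J. \<eta> * n < \<tau> e \<omega>)} \<le>
      K4 * exp (- I * n powr r)"
    using L[of m0] by blast
  \<comment> \<open>K is the length of one step in the bulk: large enough that the mean time per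
    unit is close to \<open>?\<mu>\<close>, and that rounding errors of up to 1 in each of the n / K
    steps displace the endpoint by a small fraction of n only.\<close>
  obtain K where K: "1 \<le> K" "12 * ?C / \<epsilon>1 \<le> real K"
    "expectation (T 0 (vec_floor (real K *\<^sub>R x))) \<le> (?\<mu> + \<epsilon>1) * real K"
  proof -
    have "\<forall>\<^sub>F n in sequentially. expectation (T 0 (vec_floor (real n *\<^sub>R x))) / real n < ?\<mu> + \<epsilon>1"
      using expectation_T_over_n[of x] \<epsilon>1 by (intro order_tendstoD) auto
    moreover have "\<forall>\<^sub>F n in sequentially. 12 * ?C / \<epsilon>1 \<le> real n"
      using filterlim_real_sequentially by (simp add: filterlim_at_top)
    ultimately have "\<forall>\<^sub>F n in sequentially. 1 \<le> n \<and> 12 * ?C / \<epsilon>1 \<le> real n \<and>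
      expectation (T 0 (vec_floor (real n *\<^sub>R x))) / real n < ?\<mu> + \<epsilon>1"
      using eventually_ge_at_top[of 1] by eventually_elim simp
    then obtain n where n: "1 \<le> n" "12 * ?C / \<epsilon>1 \<le> real n"
      "expectation (T 0 (vec_floor (real n *\<^sub>R x))) / real n < ?\<mu> + \<epsilon>1"
      by (auto dest: eventually_happens)
    then have "expectation (T 0 (vec_floor (real n *\<^sub>R x))) < (?\<mu> + \<epsilon>1) * real n"
      by (simp add: pos_divide_less_eq)
    with n show ?thesis using that[of n] by simp
  qed
  define v where "v = vec_floor (real K *\<^sub>R x)"
  define a where "a = expectation (T 0 v) + \<epsilon>1"
  have a0: "0 \<le> a" unfolding a_def using \<epsilon>1 T_nonneg
    by (intro add_nonneg_nonneg integral_nonneg_AE AE_I2) auto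
  have aK: "a \<le> (?\<mu> + 2 * \<epsilon>1) * real K"
  proof -
    have "\<epsilon>1 * 1 \<le> \<epsilon>1 * real K" using \<epsilon>1 K(1) by (intro mult_left_mono) auto
    then show ?thesis using K(3) unfolding a_def v_def by (simp add: distrib_right)
  qed
  obtain q u where q: "0 < q" and u: "0 < u" and bulk: "\<And>k w. prob {\<omega> \<in> space M. a \<le>
      average (\<lambda>z. T (z + w) (z + w + v) \<omega>) (grid (spaced q k))} \<le> exp (- u * 2 ^ (k * CARD('d)))"
    using bulk_concentration[OF \<epsilon>1, of v] unfolding a_def by blast
  \<comment> \<open>The bound 1 yields k < n. The second bound limits the parts of the thresholds
    proportional to \<open>2 ^ k\<close> to \<open>\<epsilon> / 4 * n\<close> in total, the third
    limits the cost of crossing the extent \<open>q * 2 ^ k\<close> of the spaced grid.\<close>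
  define \<delta> where "\<delta> = min 1 (min (\<epsilon> / (32 * d * ?C)) (\<epsilon>1 / (6 * ?C * q)))"
  have \<delta>: "0 < \<delta>" "\<delta> \<le> 1" "\<delta> \<le> \<epsilon> / (32 * d * ?C)" "\<delta> \<le> \<epsilon>1 / (6 * ?C * q)"
    using \<epsilon> \<epsilon>1 d C q by (auto simp: \<delta>_def)
  have \<delta>C: "8 * d * ?C * \<delta> \<le> \<epsilon> / 4" "2 * ?C * q * \<delta> \<le> \<epsilon>1 / 3"
    using \<delta>(3,4) d C q by (simp_all add: field_simps)
  define X where "X = nat \<lceil>norm x\<rceil>"
  have X: "\<bar>x $ b\<bar> \<le> real X" for b
    using component_le_norm_cart[of x b] unfolding X_def by (meson order_trans real_nat_ceiling_ge)
  define K5 where "K5 = exp_moment \<gamma> ^ (2 * card (box_edges m0 :: (int ^ 'd) set set))"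
  have K5: "0 < K5" using exp_moment_ge_1[OF \<gamma>] by (simp add: K5_def)
  define N where "N = 2 * card (lattice_box m0 (0 :: int ^ 'd)) * card (UNIV :: ('d set \<times> 'd) set)"
  define K' where "K' = K5 + 2 * K4 + real (N * 2 + 1)"
  have "0 < K'" using K5 K4 by (simp add: K'_def)
  let ?v = "\<lambda>n. vec_floor (real n *\<^sub>R x)"
  have "\<forall>\<^sub>F n in sequentially. 2 * int m0 + 1 \<le> linf_norm (?v n)"
    using linf_norm_vec_floor_at_top[OF \<open>x \<noteq> 0\<close>] by (simp add: filterlim_at_top)
  moreover have "\<forall>\<^sub>F n in sequentially. 1 / \<delta> \<le> real n"
    using filterlim_real_sequentially by (simp add: filterlim_at_top)
  moreover have "\<forall>\<^sub>F n in sequentially. 12 * ?C * real (m0 + K * X + 1) / \<epsilon>1 \<le> real n"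
    using filterlim_real_sequentially by (simp add: filterlim_at_top)
  moreover have "\<forall>\<^sub>F n :: nat in sequentially. I * real n powr r \<le> (\<delta> / 2) ^ (CARD('d) - 1) * \<epsilon>1 / 2 * real n ^ CARD('d)"
    using \<delta> \<epsilon>1 by (intro eventually_powr_le_power r_less_dim) simp
  moreover have "\<forall>\<^sub>F n :: nat in sequentially. I * real n powr r \<le> u * (\<delta> / 2) ^ CARD('d) * real n ^ CARD('d)"
    using \<delta> u by (intro eventually_powr_le_power r_less_dim) simp
  ultimately have "\<forall>\<^sub>F n in sequentially.
    prob {\<omega> \<in> space M. (?\<mu> + \<xi>) * real n \<le> T 0 (?v n) \<omega>} \<le> K' * real n * exp (- I * real n powr r)"
    using eventually_ge_at_top[of 1]
  proof eventually_elim
    case (elim n)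
    have n: "1 \<le> real n" using elim(6) by simp
    have "1 \<le> \<delta> * real n" using elim(2) \<delta>(1) by (simp add: pos_divide_le_eq mult.commute)
    then obtain k :: nat where k: "2 ^ k \<le> \<delta> * real n" "\<delta> * real n / 2 \<le> 2 ^ k"
      using dyadic_approximation by blast
    define m where "m = n div K"
    have mK: "real m * real K \<le> real n"
      unfolding m_def of_nat_mult[symmetric] of_nat_le_iff by simp
    have mn: "m \<le> n" unfolding m_def by simp
    have kn: "k + 1 \<le> 2 * n"
    proof -
      have "real k < 2 ^ k" by simp
      also have "\<dots> \<le> 1 * real n" using k(1) mult_right_mono[OF \<delta>(2), of "real n"] by linarith
      finally have "k < n" by simp
      then show ?thesis by simp
    qed
    define c where "c = int (m0 + (m + K * X + 1))"
    \<comment> \<open>The length condition of the tail bound at h = 1: the fixed part of c, the part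
      m and the extent of the grid take a third of \<open>\<epsilon>1 * n\<close> each.\<close>
    have c: "2 * ?C * (2 * real_of_int c + real_of_int q * 2 ^ k) \<le> \<epsilon>1 * real n"
    proof -
      have "12 * ?C * real (m0 + K * X + 1) \<le> \<epsilon>1 * real n" using elim(3) \<epsilon>1 by (simp add: pos_divide_le_eq mult.commute)
      moreover have "12 * ?C * real m \<le> \<epsilon>1 * real n"
      proof -
        have "12 * ?C \<le> \<epsilon>1 * real K" using K(2) \<epsilon>1 by (simp add: pos_divide_le_eq mult.commute)
        then have "12 * ?C * real m \<le> \<epsilon>1 * real K * real m" by (rule mult_right_mono) simp
        also have "\<dots> \<le> \<epsilon>1 * real n" using mK \<epsilon>1 by (simp add: mult.assoc mult.commute[of "real K"])
        finally show ?thesis .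
      qed
      moreover have "2 * ?C * real_of_int q * 2 ^ k \<le> \<epsilon>1 / 3 * real n"
      proof -
        have "2 * ?C * real_of_int q * 2 ^ k \<le> 2 * ?C * real_of_int q * (\<delta> * real n)"
          using k(1) C q by (intro mult_left_mono) auto
        also have "\<dots> \<le> \<epsilon>1 / 3 * real n"
          using mult_right_mono[OF \<delta>C(2), of "real n"] by (simp add: mult.assoc)
        finally show ?thesis .
      qed
      moreover have "real_of_int c = real (m0 + K * X + 1) + real m" by (simp add: c_def)
      ultimately show ?thesis by (simp add: distrib_left mult.assoc)
    qed
    let ?p = "exp (- I * real n powr r)" and ?s = "threshold \<theta> (real n)"
    have card_ok: "2 ^ k \<le> card (cube y k j)" "2 ^ k \<le> card (spaced q k j)"
      "2 ^ k \<le> card (shift w (spaced q k) j)" for y w :: "int ^ 'd" and j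
      using q by (simp_all add: card_spaced)
    \<comment> \<open>At the largest scale there are at least
      \<open>(\<delta> * n / 2) ^ (d - 1)\<close> lines, so already the tilt h = 1 gives an exponent
      of order \<open>n ^ d\<close>, which beats \<open>I * n powr r\<close>.\<close>
    have p2: "exp (- (real (2 ^ k) ^ (CARD('d) - 1) * 1 powr (r - 1) * (\<epsilon>1 * real n) / 2)) \<le> ?p"
    proof -
      have "(\<delta> * real n / 2) ^ (CARD('d) - 1) \<le> real (2 ^ k) ^ (CARD('d) - 1)"
        using k(2) \<delta> by (intro power_mono) simp_all
      then have "(\<delta> * real n / 2) ^ (CARD('d) - 1) * (\<epsilon>1 * real n) / 2 \<le>
        real (2 ^ k) ^ (CARD('d) - 1) * (\<epsilon>1 * real n) / 2"
        using \<epsilon>1 by (intro divide_right_mono mult_right_mono) auto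
      moreover have "(\<delta> * real n / 2) ^ (CARD('d) - 1) * (\<epsilon>1 * real n) / 2 =
        (\<delta> / 2) ^ (CARD('d) - 1) * \<epsilon>1 / 2 * real n ^ CARD('d)"
      proof -
        have "real n ^ CARD('d) = real n ^ (CARD('d) - 1) * real n"
          using power_Suc2[of "real n" "CARD('d) - 1"] dim by simp
        then show ?thesis by (simp add: power_mult_distrib power_divide)
      qed
      ultimately have "I * real n powr r \<le> real (2 ^ k) ^ (CARD('d) - 1) * (\<epsilon>1 * real n) / 2"
        using elim(4) by linarith
      then show ?thesis by simp
    qed
    have "prob {\<omega> \<in> space M. (?\<mu> + \<xi>) * real n \<le> T 0 (?v n) \<omega>} \<le> K5 * ?p + 2 * (K4 * ?p) +
      real (2 * card (lattice_box m0 (0 :: int ^ 'd)) * card (UNIV :: ('d set \<times> 'd) set) * (k + 1) + m) * ?p"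
    proof (rule upper_tail_finite[where h = i0 and L = L and t = "\<eta> * real n" and s = ?s and q = q and
          c = c and m = m and v = v and \<nu> = "\<epsilon>1 * real n" and a = a and \<kappa> = "(\<xi> - \<epsilon>) * real n",
          folded m0_def])
      show "2 * int m0 < linf_norm (?v n)" using elim(1) by simp
      show "2 ^ Suc i * (\<eta> * real n) \<le> ?s i" if "i < i0" for i
      proof -
        have "2 ^ Suc i * (2 powr (- decay * i0) / 2 ^ i0) \<le> 2 powr (- decay * i)"
        proof -
          have "(2::real) ^ Suc i \<le> 2 ^ i0" using that by (intro power_increasing) auto
          then have "2 ^ Suc i * (2 powr (- decay * i0) / 2 ^ i0) \<le> 2 ^ i0 * (2 powr (- decay * i0) / 2 ^ i0)"
            by (rule mult_right_mono) simp
          also have "\<dots> = 2 powr (- decay * i0)" by simp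
          also have "\<dots> \<le> 2 powr (- decay * i)" using that decay_pos by (intro powr_mono) auto
          finally show ?thesis .
        qed
        then have "\<theta> * real n * (2 ^ Suc i * (2 powr (- decay * i0) / 2 ^ i0)) \<le> \<theta> * real n * 2 powr (- decay * i)"
          using \<theta> by (intro mult_left_mono) auto
        moreover have "2 ^ Suc i * (\<eta> * real n) = \<theta> * real n * (2 ^ Suc i * (2 powr (- decay * i0) / 2 ^ i0))"
          unfolding \<eta>_def by (simp only: times_divide_eq_right times_divide_eq_left mult_ac)
        moreover have "0 \<le> 4 * ?C * 2 ^ i" using C by simp
        ultimately show ?thesis unfolding threshold_def by linarith
      qed
      show "0 < q" by (rule q)
      show "\<bar>?v n $ b - int m * v $ b\<bar> + int m0 \<le> c" for b
        using vec_floor_multiple_close[of K x X n b] K(1) X unfolding m_def v_def c_def by simp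
      show "0 \<le> (\<xi> - \<epsilon>) * real n" using \<epsilon> by simp
      \<comment> \<open>The budget in units of \<open>\<epsilon> * n\<close>: 1/2 for the cubes at
        both ends, 1/4 for the transfers to the grid and back, 1/8 for the excess of the bulk over
        \<open>?\<mu>\<close>; 1/8 is left, which makes the bound hold.\<close>
      show "(\<xi> - \<epsilon>) * real n + (2 * (real CARD('d) * (\<Sum>i<k. ?s i)) + 2 * (real CARD('d) * (\<epsilon>1 * real n)) + real m * a)
        \<le> (?\<mu> + \<xi>) * real n"
      proof -
        have "(\<Sum>i<k. ?s i) \<le> \<theta> * real n / (1 - \<rho>) + 4 * ?C * 2 ^ k"
          unfolding \<rho>_def using \<theta> by (intro sum_threshold_le) auto
        also have "\<theta> * real n / (1 - \<rho>) = \<epsilon>1 * real n" using \<rho> by (simp add: \<theta>_def \<epsilon>1_def)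
        also have "4 * ?C * 2 ^ k \<le> 4 * ?C * (\<delta> * real n)" using k(1) C by (intro mult_left_mono) auto
        finally have "2 * (d * (\<Sum>i<k. ?s i)) \<le> 2 * (d * (\<epsilon>1 * real n + 4 * ?C * (\<delta> * real n)))"
          using d by simp
        also have "\<dots> = 2 * d * \<epsilon>1 * real n + 8 * d * ?C * \<delta> * real n" by (simp add: algebra_simps)
        also have "8 * d * ?C * \<delta> * real n \<le> \<epsilon> / 4 * real n"
          by (rule mult_right_mono[OF \<delta>C(1)]) simp
        finally have 1: "2 * (d * (\<Sum>i<k. ?s i)) \<le> 2 * d * \<epsilon>1 * real n + \<epsilon> / 4 * real n" by simp
        have d1: "d * \<epsilon>1 = \<epsilon> / 8" using d by (simp add: \<epsilon>1_def)
        then have d2: "2 * d * \<epsilon>1 * real n = \<epsilon> / 4 * real n" by (simp add: mult.assoc)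
        have d3: "2 * (d * (\<epsilon>1 * real n)) = \<epsilon> / 4 * real n" using d2 by (simp add: mult.assoc)
        have "2 * \<epsilon>1 \<le> d * \<epsilon>1" using d \<epsilon>1 by (intro mult_right_mono) auto
        with d1 have "2 * \<epsilon>1 \<le> \<epsilon> / 8" by simp
        then have e1: "2 * \<epsilon>1 * real n \<le> \<epsilon> / 8 * real n" by (rule mult_right_mono) simp
        \<comment> \<open>Since \<open>m * K\<close> may fall short of n, the sign of this factor
          matters; it follows from that of a.\<close>
        have "0 \<le> ?\<mu> + 2 * \<epsilon>1"
        proof -
          have "0 \<le> (?\<mu> + 2 * \<epsilon>1) * real K" using a0 aK by linarith
          then show ?thesis using K(1) by (simp add: zero_le_mult_iff)
        qed
        then have "(?\<mu> + 2 * \<epsilon>1) * (real m * real K) \<le> (?\<mu> + 2 * \<epsilon>1) * real n"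
          using mK by (intro mult_left_mono)
        moreover have "real m * a \<le> real m * ((?\<mu> + 2 * \<epsilon>1) * real K)" using aK by (intro mult_left_mono) auto
        moreover have "real m * ((?\<mu> + 2 * \<epsilon>1) * real K) = (?\<mu> + 2 * \<epsilon>1) * (real m * real K)" by simp
        ultimately have "real m * a \<le> (?\<mu> + 2 * \<epsilon>1) * real n" by linarith
        then have 2: "real m * a \<le> ?\<mu> * real n + 2 * \<epsilon>1 * real n" by (simp only: distrib_right)
        define E where "E = \<epsilon> * real n"
        have E: "0 \<le> E" using \<epsilon> by (simp add: E_def)
        have 3: "2 * (d * (\<Sum>i<k. ?s i)) \<le> E / 2" using 1 d2 by (simp add: E_def)
        have 4: "2 * (d * (\<epsilon>1 * real n)) = E / 4" using d3 by (simp add: E_def)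
        have 5: "real m * a \<le> ?\<mu> * real n + E / 8" using 2 e1 by (simp add: E_def)
        have "(\<xi> - \<epsilon>) * real n + (2 * (d * (\<Sum>i<k. ?s i)) + 2 * (d * (\<epsilon>1 * real n)) + real m * a) \<le>
          (\<xi> - \<epsilon>) * real n + (E / 2 + E / 4 + (?\<mu> * real n + E / 8))"
          by (intro add_mono order_refl 3 5 eq_refl[OF 4])
        also have "\<dots> = (?\<mu> + \<xi>) * real n - E / 8"
          by (simp add: E_def left_diff_distrib distrib_right)
        finally show ?thesis using E unfolding d_def by linarith
      qed
      show "prob {\<omega> \<in> space M. ?s i \<le> line_average (\<lambda>e. \<tau> e \<omega>) (mixed (cube y i) (cube y (Suc i)) D) b
          (y $ b) (y $ b + 2 ^ Suc i)} \<le> ?p" if "i0 \<le> i" for y i D b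
        using n by (intro i0 that) simp
      show "prob {\<omega> \<in> space M. \<epsilon>1 * real n \<le>
          line_average (\<lambda>e. \<tau> e \<omega>) (mixed (cube y k) (spaced q k) D) b (- c) (c + q * 2 ^ k)} \<le> ?p" for y D b
      proof (rule order_trans[OF mixed_line_average_tail[where s = "2 ^ k" and h = 1] p2])
        show "2 * ?C * (real_of_int (c + q * 2 ^ k) - real_of_int (- c)) * 1 \<le> \<epsilon>1 * real n"
          using c by (simp add: algebra_simps)
        show "- c \<le> c + q * 2 ^ k" using q by (simp add: c_def)
      qed (rule card_ok | simp)+
      show "prob {\<omega> \<in> space M. \<epsilon>1 * real n \<le>
          line_average (\<lambda>e. \<tau> e \<omega>) (mixed (shift (of_nat m * v) (spaced q k)) (cube y k) D) b
            (int m * v $ b - c) (int m * v $ b + c + q * 2 ^ k)} \<le> ?p" for y D b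
      proof (rule order_trans[OF mixed_line_average_tail[where s = "2 ^ k" and h = 1] p2])
        show "2 * ?C * (real_of_int (int m * v $ b + c + q * 2 ^ k) - real_of_int (int m * v $ b - c)) * 1 \<le> \<epsilon>1 * real n"
          using c by (simp add: algebra_simps)
        show "int m * v $ b - c \<le> int m * v $ b + c + q * 2 ^ k" using q by (simp add: c_def)
        show "finite (shift (of_nat m * v) (spaced q k) j)" "shift (of_nat m * v) (spaced q k) j \<noteq> {}" for j
          by (simp_all add: shift_def)
      qed (rule card_ok | simp)+
      show "prob {\<omega> \<in> space M. a \<le> average (\<lambda>z. T (z + of_nat i * v) (z + of_nat i * v + v) \<omega>) (grid (spaced q k))} \<le> ?p" for i
      proof (rule order_trans[OF bulk])
        have "(\<delta> * real n / 2) ^ CARD('d) \<le> (2 ^ k) ^ CARD('d)" using k(2) \<delta> by (intro power_mono) simp_all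
        then have "u * (\<delta> * real n / 2) ^ CARD('d) \<le> u * 2 ^ (k * CARD('d))"
          using u unfolding power_mult by (intro mult_left_mono) auto
        moreover have "u * (\<delta> * real n / 2) ^ CARD('d) = u * (\<delta> / 2) ^ CARD('d) * real n ^ CARD('d)"
          by (simp add: power_mult_distrib power_divide)
        ultimately show "exp (- u * 2 ^ (k * CARD('d))) \<le> ?p" using elim(5) by simp
      qed
      show "prob {\<omega> \<in> space M. \<exists>J\<subseteq>(`) ((+) w) ` box_edges m0. card J = L \<and> (\<forall>e\<in>J. \<eta> * real n < \<tau> e \<omega>)} \<le> K4 * ?p" for w
        using n by (intro K4(2)) simp
      let ?B = "box_edges m0 \<union> (`) ((+) (?v n)) ` box_edges m0"
      have B: "finite ?B" "?B \<subseteq> lattice_edges" using subsetD[OF box_edges_subset[of m0]] by auto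
      have cardB: "card ?B \<le> 2 * card (box_edges m0 :: (int ^ 'd) set set)"
        by (rule order_trans[OF card_Un_le]) (simp add: card_image_le)
      have "prob {\<omega> \<in> space M. ?cap * 2 powr (1 - r) * ((\<xi> - \<epsilon>) * real n) powr r \<le> (\<Sum>e\<in>?B. \<tau> e \<omega> powr r)} \<le>
        exp_moment \<gamma> ^ card ?B * exp (- \<gamma> * (?cap * 2 powr (1 - r) * ((\<xi> - \<epsilon>) * real n) powr r))"
        by (rule sum_powr_tail[OF B \<gamma>])
      also have "exp_moment \<gamma> ^ card ?B \<le> K5"
        unfolding K5_def using exp_moment_ge_1[OF \<gamma>] cardB by (intro power_increasing) auto
      also have "- \<gamma> * (?cap * 2 powr (1 - r) * ((\<xi> - \<epsilon>) * real n) powr r) = - I * real n powr r"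
        by (simp add: I_def powr_mult)
      finally show "prob {\<omega> \<in> space M. ?cap * 2 powr (1 - r) * ((\<xi> - \<epsilon>) * real n) powr r \<le> (\<Sum>e\<in>?B. \<tau> e \<omega> powr r)} \<le> K5 * ?p"
        by simp
    qed
    also have "2 * card (lattice_box m0 (0 :: int ^ 'd)) * card (UNIV :: ('d set \<times> 'd) set) * (k + 1) + m = N * (k + 1) + m"
      unfolding N_def ..
    \<comment> \<open>With \<open>k < n\<close> and \<open>m \<le> n\<close> there are at most order
      n events, a factor that is invisible on the logarithmic scale.\<close>
    also have "K5 * ?p + 2 * (K4 * ?p) + real (N * (k + 1) + m) * ?p \<le> K' * real n * ?p"
    proof -
      have "N * (k + 1) + m \<le> N * (2 * n) + n" using kn mn by (intro add_mono mult_le_mono2)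
      then have "real (N * (k + 1) + m) \<le> real (N * (2 * n) + n)" by (simp only: of_nat_le_iff)
      also have "\<dots> = real (N * 2 + 1) * real n" by (simp add: algebra_simps)
      finally have "real (N * (k + 1) + m) \<le> real (N * 2 + 1) * real n" .
      moreover have "K5 * 1 \<le> K5 * real n" "K4 * 1 \<le> K4 * real n" using K5 K4(1) n by (auto intro: mult_left_mono)
      ultimately have "K5 + 2 * K4 + real (N * (k + 1) + m) \<le> K' * real n"
        unfolding K'_def by (simp add: distrib_right)
      then have "(K5 + 2 * K4 + real (N * (k + 1) + m)) * ?p \<le> K' * real n * ?p" by (rule mult_right_mono) simp
      then show ?thesis by (simp only: distrib_right mult.assoc)
    qed
    finally show ?case .
  qed
  then show ?thesis using that[OF \<open>0 < K'\<close>] unfolding I_def by blast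
qed


text \<open>The two tail bounds hold for every small \<epsilon>, and their exponents are continuous
  at \<epsilon> = 0 with the same value there.\<close>

lemma T_limit:
  fixes x :: "real ^ 'd"
  assumes "x \<noteq> 0" "0 < \<xi>"
  shows "(\<lambda>n::nat. 1 / real n powr r * ln (prob {\<omega> \<in> space M.
      (time_constant M \<tau> x + \<xi>) * real n \<le> T 0 (vec_floor (real n *\<^sub>R x)) \<omega>}))
    \<longlonglongrightarrow> - \<alpha> * 2 powr (1 - r) * discrete_capacity TYPE('d) r * \<xi> powr r"
    (is "(\<lambda>n. 1 / real n powr r * ln (?P n)) \<longlonglongrightarrow> ?L")
proof (rule order_tendstoI)
  let ?cap = "discrete_capacity TYPE('d) r"
  have powr_top: "filterlim (\<lambda>n::nat. real n powr r) at_top sequentially"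
    using r_gt_1 by real_asymp
  \<comment> \<open>Used twice: for the lower bound itself and for the positivity of the
    probabilities.\<close>
  have lower: "\<exists>c J. 0 < c \<and> y < - J \<and> (\<forall>\<^sub>F n in sequentially. c * exp (- J * real n powr r) \<le> ?P n)"
    if y: "y < ?L" for y
  proof -
    have lim: "((\<lambda>\<epsilon>. - (2 * \<alpha> * (\<xi> / 2 + \<epsilon>) powr r * (?cap + \<epsilon>))) \<longlongrightarrow>
      - (2 * \<alpha> * (\<xi> / 2 + 0) powr r * (?cap + 0))) (at_right 0)"
      using assms by (intro tendsto_intros) auto
    have eq: "- (2 * \<alpha> * (\<xi> / 2 + 0) powr r * (?cap + 0)) = ?L"
      by (simp add: powr_divide powr_diff)
    have "\<forall>\<^sub>F \<epsilon> in at_right 0. y < - (2 * \<alpha> * (\<xi> / 2 + \<epsilon>) powr r * (?cap + \<epsilon>))"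
      by (rule order_tendstoD(1)[OF lim[unfolded eq] y])
    then have "\<forall>\<^sub>F \<epsilon> in at_right 0. 0 < \<epsilon> \<and> y < - (2 * \<alpha> * (\<xi> / 2 + \<epsilon>) powr r * (?cap + \<epsilon>))"
      using eventually_at_right_less[of 0] by eventually_elim simp
    then obtain \<epsilon> where \<epsilon>: "0 < \<epsilon>" "y < - (2 * \<alpha> * (\<xi> / 2 + \<epsilon>) powr r * (?cap + \<epsilon>))"
      by (auto dest!: eventually_happens)
    have "\<forall>\<^sub>F m in sequentially. box_capacity TYPE('d) r m < ?cap + \<epsilon>"
      using box_capacity_tendsto[of r] r_gt_1 \<epsilon> by (intro order_tendstoD) auto
    then have "\<forall>\<^sub>F m in sequentially. 1 \<le> m \<and> box_capacity TYPE('d) r m < ?cap + \<epsilon>"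
      using eventually_ge_at_top[of 1] by eventually_elim simp
    then obtain m where m: "1 \<le> m" "box_capacity TYPE('d) r m < ?cap + \<epsilon>"
      by (auto dest: eventually_happens)
    obtain c where c: "0 < c" "\<forall>\<^sub>F n in sequentially.
      c * exp (- 2 * \<alpha> * ((\<xi> / 2 + \<epsilon>) * real n) powr r * (?cap + \<epsilon>)) \<le> ?P n"
      using lower_tail_bound[OF m \<epsilon>(1) \<open>0 < \<xi>\<close> \<open>x \<noteq> 0\<close>] by blast
    have eq: "- 2 * \<alpha> * ((\<xi> / 2 + \<epsilon>) * real n) powr r * (?cap + \<epsilon>) =
      - (2 * \<alpha> * (\<xi> / 2 + \<epsilon>) powr r * (?cap + \<epsilon>)) * real n powr r" for n
      by (simp add: powr_mult)
    show ?thesis using c(1) \<epsilon>(2) c(2)[unfolded eq] by blast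
  qed
  \<comment> \<open>\<open>ln\<close> is total on the reals, so the upper bound passes to logarithms
    only where the probability is positive.\<close>
  have P_pos: "\<forall>\<^sub>F n in sequentially. 0 < ?P n"
  proof -
    obtain c J where "0 < c" "\<forall>\<^sub>F n in sequentially. c * exp (- J * real n powr r) \<le> ?P n"
      using lower[of "?L - 1"] by auto
    then show ?thesis by (elim eventually_mono) (meson exp_gt_zero less_le_trans mult_pos_pos)
  qed
  show "\<forall>\<^sub>F n in sequentially. y < 1 / real n powr r * ln (?P n)" if y: "y < ?L" for y
  proof -
    obtain c J where c: "0 < c" "y < - J" "\<forall>\<^sub>F n in sequentially. c * exp (- J * real n powr r) \<le> ?P n"
      using lower[OF y] by blast
    have "((\<lambda>n. ln c / real n powr r + - J) \<longlongrightarrow> 0 + - J) sequentially"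
      by (intro tendsto_add tendsto_const real_tendsto_divide_at_top[OF tendsto_const powr_top])
    then have "\<forall>\<^sub>F n in sequentially. y < ln c / real n powr r + - J"
      using c(2) by (intro order_tendstoD) auto
    then show ?thesis using c(3) eventually_gt_at_top[of 0]
    proof eventually_elim
      case (elim n)
      have n: "0 < real n powr r" using elim(3) by simp
      have pos: "0 < c * exp (- J * real n powr r)" using c(1) by simp
      have "ln c + - J * real n powr r = ln (c * exp (- J * real n powr r))"
        using c(1) by (simp add: ln_mult)
      also have "\<dots> \<le> ln (?P n)" using elim(2) pos by (intro ln_mono) auto
      finally have "(ln c + - J * real n powr r) / real n powr r \<le> ln (?P n) / real n powr r"
        using n by (intro divide_right_mono) auto
      then have "ln c / real n powr r + - J \<le> 1 / real n powr r * ln (?P n)"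
        using n by (simp add: add_divide_distrib diff_divide_distrib)
      with elim(1) show ?case by linarith
    qed
  qed
  show "\<forall>\<^sub>F n in sequentially. 1 / real n powr r * ln (?P n) < y" if y: "?L < y" for y
  proof -
    have lim: "((\<lambda>\<epsilon>. - ((\<alpha> - \<epsilon>) * ?cap * 2 powr (1 - r) * (\<xi> - \<epsilon>) powr r)) \<longlongrightarrow>
      - ((\<alpha> - 0) * ?cap * 2 powr (1 - r) * (\<xi> - 0) powr r)) (at_right 0)"
      using assms by (intro tendsto_intros) auto
    have eq: "- ((\<alpha> - 0) * ?cap * 2 powr (1 - r) * (\<xi> - 0) powr r) = ?L" by simp
    have "\<forall>\<^sub>F \<epsilon> in at_right 0. - ((\<alpha> - \<epsilon>) * ?cap * 2 powr (1 - r) * (\<xi> - \<epsilon>) powr r) < y"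
      by (rule order_tendstoD(2)[OF lim[unfolded eq] y])
    moreover have "\<forall>\<^sub>F \<epsilon> in at_right 0. \<epsilon> \<in> {0<..<min \<xi> \<alpha>}"
      using assms \<alpha>_pos by (intro eventually_at_right_real) auto
    ultimately have "\<forall>\<^sub>F \<epsilon> in at_right 0. \<epsilon> \<in> {0<..<min \<xi> \<alpha>} \<and>
      - ((\<alpha> - \<epsilon>) * ?cap * 2 powr (1 - r) * (\<xi> - \<epsilon>) powr r) < y" by eventually_elim simp
    then obtain \<epsilon> where \<epsilon>: "0 < \<epsilon>" "\<epsilon> < \<xi>" "\<epsilon> < \<alpha>"
      "- ((\<alpha> - \<epsilon>) * ?cap * 2 powr (1 - r) * (\<xi> - \<epsilon>) powr r) < y"
      by (auto dest!: eventually_happens)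
    define J where "J = (\<alpha> - \<epsilon>) * ?cap * 2 powr (1 - r) * (\<xi> - \<epsilon>) powr r"
    have \<gamma>: "0 \<le> \<alpha> - \<epsilon>" "\<alpha> - \<epsilon> < \<alpha>" using \<epsilon> by auto
    obtain K where K: "0 < K" "\<forall>\<^sub>F n in sequentially. ?P n \<le> K * real n * exp (- J * real n powr r)"
      using upper_tail_bound[OF \<open>x \<noteq> 0\<close> \<epsilon>(1,2) \<gamma>] unfolding J_def by blast
    \<comment> \<open>The factor \<open>K * n\<close> left by the union bound vanishes after
      division by \<open>n powr r\<close>.\<close>
    have "(\<lambda>n::nat. (ln K + ln (real n)) / real n powr r) \<longlonglongrightarrow> 0"
      using r_gt_1 by real_asymp
    then have "(\<lambda>n. (ln K + ln (real n)) / real n powr r + - J) \<longlonglongrightarrow> 0 + - J"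
      by (intro tendsto_add tendsto_const)
    then have "\<forall>\<^sub>F n in sequentially. (ln K + ln (real n)) / real n powr r + - J < y"
      using \<epsilon>(4) by (intro order_tendstoD) (auto simp: J_def)
    then show ?thesis using K(2) P_pos eventually_gt_at_top[of 0]
    proof eventually_elim
      case (elim n)
      have n: "0 < real n" "0 < real n powr r" using elim(4) by simp_all
      have "ln (?P n) \<le> ln (K * real n * exp (- J * real n powr r))"
        using elim(2,3) by (intro ln_mono)
      also have "\<dots> = ln K + ln (real n) + - J * real n powr r"
        using K(1) n by (simp add: ln_mult)
      finally have "ln (?P n) / real n powr r \<le> (ln K + ln (real n) + - J * real n powr r) / real n powr r"
        using n by (intro divide_right_mono) auto
      then have "1 / real n powr r * ln (?P n) \<le> (ln K + ln (real n)) / real n powr r + - J"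
        using n by (simp add: add_divide_distrib diff_divide_distrib)
      with elim(1) show ?case by linarith
    qed
  qed
qed

end

theorem theorem1p5:
  fixes M :: "'w measure"
    and \<tau> :: "(int ^ 'd::finite) set \<Rightarrow> 'w \<Rightarrow> real"
    and r \<alpha> \<beta>\<^sub>1 \<beta>\<^sub>2 \<xi> :: real
    and x :: "real ^ 'd"
  assumes "prob_space M"
    and "prob_space.indep_vars M (\<lambda>_. borel) \<tau> lattice_edges"
    and "\<And>e e'. e \<in> lattice_edges \<Longrightarrow> e' \<in> lattice_edges \<Longrightarrow>
          distr M borel (\<tau> e) = distr M borel (\<tau> e')"
    and "\<And>e \<omega>. e \<in> lattice_edges \<Longrightarrow> \<omega> \<in> space M \<Longrightarrow> \<tau> e \<omega> \<ge> 0"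
    and "CARD('d) \<ge> 2"
    and "1 < r" and "r < real CARD('d)"
    and "\<beta>\<^sub>1 > 0" and "\<beta>\<^sub>2 > 0" and "\<alpha> > 0"
    and "\<And>e t. e \<in> lattice_edges \<Longrightarrow> t \<ge> 0 \<Longrightarrow>
          \<beta>\<^sub>1 * exp (- \<alpha> * t powr r) \<le> measure M {\<omega> \<in> space M. \<tau> e \<omega> > t}"
    and "\<And>e t. e \<in> lattice_edges \<Longrightarrow> t \<ge> 0 \<Longrightarrow>
          measure M {\<omega> \<in> space M. \<tau> e \<omega> > t} \<le> \<beta>\<^sub>2 * exp (- \<alpha> * t powr r)"
    and "\<xi> > 0" and "x \<noteq> 0"
  shows "(\<lambda>n::nat. 1 / real n powr r *
            ln (measure M {\<omega> \<in> space M.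
              first_passage_time (\<lambda>e. \<tau> e \<omega>) 0 (real n *\<^sub>R x)
                \<ge> (time_constant M \<tau> x + \<xi>) * real n}))
         \<longlonglongrightarrow> - \<alpha> * 2 powr (1 - r) * discrete_capacity TYPE('d) r * \<xi> powr r"
proof -
  interpret fpp M \<tau> r \<alpha> \<beta>\<^sub>1 \<beta>\<^sub>2
    by (intro fpp.intro fpp_axioms.intro assms)
  have "vec_floor (0 :: real ^ 'd) = 0" by (simp add: vec_floor_def vec_eq_iff)
  then show ?thesis
    using T_limit[OF \<open>x \<noteq> 0\<close> \<open>\<xi> > 0\<close>] by (simp add: first_passage_time_eq T_def)
qed

end
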